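(* Let $\varrho\colon\mathrm{Is}(\mathbf{H}_{\mathbf{C}}^\infty)\to\mathrm{Is}(\mathbf{H}_{\mathbf{C}}^\infty)$ be any irreducible self-representation (no continuity is assumed) whose canonical orbit contains the canonical orbit of $\mathrm{Is}(\mathbf{H}_{\mathbf{R}}^\infty)$ (i.e. of the restriction of $\varrho$ to $\mathrm{Is}(\mathbf{H}_{\mathbf{R}}^\infty)$). Then there is $0<t\leq 1$ such that $\varrho$ is conjugated, by an element of $\mathrm{Is}(\mathbf{H}_{\mathbf{C}}^\infty)$, to an irreducible continuous representation $\varrho_t\colon\mathrm{Is}(\mathbf{H}_{\mathbf{C}}^\infty)\to\mathrm{Is}(\mathbf{H}_{\mathbf{C}}^\infty)$ admitting a $\varrho_t$-equivariant map $f\colon\mathbf{H}_{\mathbf{C}}^\infty\to\mathbf{H}_{\mathbf{C}}^\infty$ with $$\cosh d\big(f(x),f(y)\big)=\big(\cosh d(x,y)\big)^t\quad\text{and}\quad\mathrm{Cart}\big(f(x),f(y),f(z)\big)=t\,\mathrm{Cart}(x,y,z)$$ for all $x,y,z\in\mathbf{H}_{\mathbf{C}}^\infty$.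
   Context: Sesquilinear forms are linear in the second variable. For a separable infinite-dimensional complex Hilbert space $H$, let $B(z\oplus u,w\oplus v)=\overline{z}w-\langle u,v\rangle$ on $\mathbf{C}\oplus H$. $\mathbf{H}_{\mathbf{C}}^\infty$ is the projectivisation of the set of $B$-positive vectors, with distance $\cosh d(x,y)=|B(X,Y)|/(B(X,X)B(Y,Y))^{1/2}$ for representatives $X,Y$. $\mathbf{H}_{\mathbf{R}}^\infty$ is defined in the same way over $\mathbf{R}$ and embedded in $\mathbf{H}_{\mathbf{C}}^\infty$ through a real form of $\mathbf{C}\oplus H$; correspondingly $\mathrm{Is}(\mathbf{H}_{\mathbf{R}}^\infty)\subseteq\mathrm{Is}(\mathbf{H}_{\mathbf{C}}^\infty)$ is induced by $\mathbf{O}(1,\infty)\subseteq\mathbf{U}(1,\infty)$. $\mathrm{Is}(\mathbf{H}_{\mathbf{C}}^\infty)$ is the full isometry group (holomorphic and anti-holomorphic isometries), with the topology of pointwise convergence. The Cartan argument $\mathrm{Cart}(x,y,z)\in(-\tfrac\pi2,\tfrac\pi2)$ of points represented by positive vectors $X,Y,Z$ is the argument of $B(X,Y)B(Y,Z)B(Z,X)$. An isometric action on $\mathbf{H}_{\mathbf{C}}^\kappa$ is non-elementary if it preserves no non-empty finite subset of $\mathbf{H}_{\mathbf{C}}^\kappa\cup\partial\mathbf{H}_{\mathbf{C}}^\kappa$; it then has a unique minimal invariant complex hyperbolic subspace, its irreducible part. It is irreducible if it is non-elementary and this subspace is everything (equivalently, for $\kappa\geq 2$, the projective action on the underlying linear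 space has no non-trivial proper closed invariant complex subspace). Canonical orbit: let $\mathbf{K}=\mathbf{R}$ or $\mathbf{C}$ and let $\sigma$ be a continuous non-elementary representation of $G=\mathrm{Is}(\mathbf{H}_{\mathbf{K}}^\infty)$ on $\mathbf{H}_{\mathbf{C}}^\infty$ with irreducible part $Y$. For a point $q\in\mathbf{H}_{\mathbf{K}}^\infty$, $\sigma(\mathrm{Stab}_G(q))$ has a unique fixed point $p\in Y$; the canonical orbit of $\sigma$ is $\sigma(G)p$ (independent of $q$). It is the unique orbit in $Y$ isomorphic to $\mathbf{H}_{\mathbf{K}}^\infty$ as a homogeneous space. Irreducible self-representations $\varrho$ of $\mathrm{Is}(\mathbf{H}_{\mathbf{C}}^\infty)$ are automatically continuous and their restriction to $\mathrm{Is}(\mathbf{H}_{\mathbf{R}}^\infty)$ is non-elementary, so that both canonical orbits in the statement are defined. *)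

theory Defs
  imports "HOL-Analysis.Analysis" "HOL-Algebra.Group"
begin

section \<open>Complex Hilbert spaces\<close>

class complex_vector = real_vector +
  fixes scaleC :: "complex \<Rightarrow> 'a \<Rightarrow> 'a"  (infixr "*\<^sub>C" 75)
  assumes scaleC_add_right: "a *\<^sub>C (x + y) = a *\<^sub>C x + a *\<^sub>C y"
    and scaleC_add_left: "(a + b) *\<^sub>C x = a *\<^sub>C x + b *\<^sub>C x"
    and scaleC_scaleC: "a *\<^sub>C b *\<^sub>C x = (a * b) *\<^sub>C x"
    and scaleC_of_real: "complex_of_real r *\<^sub>C x = r *\<^sub>R x"

instantiation complex :: complex_vector
begin
definition scaleC_complex :: "complex \<Rightarrow> complex \<Rightarrow> complex"
  where "scaleC_complex c z = c * z"
instance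
  by standard (simp_all add: scaleC_complex_def algebra_simps scaleR_conv_of_real)
end

instantiation prod :: (complex_vector, complex_vector) complex_vector
begin
definition scaleC_prod :: "complex \<Rightarrow> 'a \<times> 'b \<Rightarrow> 'a \<times> 'b"
  where "scaleC_prod c X = (c *\<^sub>C fst X, c *\<^sub>C snd X)"
instance
  by standard
    (simp_all add: scaleC_prod_def scaleC_add_right scaleC_add_left scaleC_scaleC
      scaleC_of_real prod_eq_iff)
end

text \<open>
  The scalar product is linear in the second variable. Norm and topology are those of the
  underlying real Hilbert space, whose scalar product is the real part of \<open>cinner\<close>.
\<close>

class complex_hilbert = complex_vector + real_inner + complete_space +
  fixes cinner :: "'a \<Rightarrow> 'a \<Rightarrow> complex"
  assumes cinner_commute: "cinner x y = cnj (cinner y x)"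
    and cinner_add_right: "cinner x (y + z) = cinner x y + cinner x z"
    and cinner_scaleC_right: "cinner x (c *\<^sub>C y) = c * cinner x y"
    and inner_eq_Re_cinner: "x \<bullet> y = Re (cinner x y)"

definition clinear :: "('a::complex_vector \<Rightarrow> 'b::complex_vector) \<Rightarrow> bool"
  where "clinear T \<longleftrightarrow>
    (\<forall>x y. T (x + y) = T x + T y) \<and> (\<forall>c x. T (c *\<^sub>C x) = c *\<^sub>C T x)"

definition csubspace :: "'a::complex_vector set \<Rightarrow> bool"
  where "csubspace W \<longleftrightarrow>
    0 \<in> W \<and> (\<forall>x\<in>W. \<forall>y\<in>W. x + y \<in> W) \<and> (\<forall>c. \<forall>x\<in>W. c *\<^sub>C x \<in> W)"


section \<open>The form of signature \<open>(1,\<infinity>)\<close>\<close>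

definition hform :: "complex \<times> 'h::complex_hilbert \<Rightarrow> complex \<times> 'h \<Rightarrow> complex"
  where "hform X Y = cnj (fst X) * fst Y - cinner (snd X) (snd Y)"

text \<open>\<^term>\<open>hform X X\<close> is always real, see \<open>hform_self\<close> below.\<close>

definition hpositive :: "complex \<times> 'h::complex_hilbert \<Rightarrow> bool"
  where "hpositive X \<longleftrightarrow> 0 < Re (hform X X)"

lemma scaleC_one [simp]: "1 *\<^sub>C (x::'a::complex_vector) = x"
  using scaleC_of_real[of 1 x] by simp

lemma scaleC_zero_left [simp]: "0 *\<^sub>C (x::'a::complex_vector) = 0"
  using scaleC_of_real[of 0 x] by simp

lemma scaleC_minus_left: "(- c) *\<^sub>C (x::'a::complex_vector) = - (c *\<^sub>C x)"
  using scaleC_add_left[of "-c" c x] by (simp add: eq_neg_iff_add_eq_0)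

lemma hform_commute: "hform X Y = cnj (hform Y X)"
  unfolding hform_def by (subst cinner_commute) (simp add: mult.commute)

lemma hform_add_right: "hform X (Y + Z) = hform X Y + hform X Z"
  by (simp add: hform_def cinner_add_right algebra_simps)

lemma hform_scaleC_right: "hform X (c *\<^sub>C Y) = c * hform X Y"
  by (simp add: hform_def scaleC_prod_def scaleC_complex_def cinner_scaleC_right algebra_simps)

lemma hform_add_left: "hform (Y + Z) X = hform Y X + hform Z X"
  by (subst (1 2 3) hform_commute) (simp add: hform_add_right)

lemma hform_scaleC_left: "hform (c *\<^sub>C Y) X = cnj c * hform Y X"
  by (subst (1 2) hform_commute) (simp add: hform_scaleC_right)

lemma hform_zero_right [simp]: "hform X 0 = 0"
  using hform_scaleC_right[of X 0 0] by simp

lemma hform_zero_left [simp]: "hform 0 X = 0"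
  using hform_scaleC_left[of 0 0 X] by simp

lemma hform_self: "hform X X = complex_of_real (Re (hform X X))"
proof -
  have "Im (hform X X) = - Im (hform X X)"
    using arg_cong[OF hform_commute[of X X], of Im] by simp
  then show ?thesis by (simp add: complex_eq_iff)
qed

lemma norm_hform_commute: "cmod (hform X Y) = cmod (hform Y X)"
  by (subst hform_commute) simp

lemma norm_scaleC: "norm (c *\<^sub>C (x::'h::complex_hilbert)) = cmod c * norm x"
proof -
  have "cinner (c *\<^sub>C x) (c *\<^sub>C x) = c * cnj (c * cinner x x)"
    by (simp only: cinner_scaleC_right) (subst cinner_commute, simp only: cinner_scaleC_right)
  also have "\<dots> = (c * cnj c) * cnj (cinner x x)" by simp
  finally have "Re (cinner (c *\<^sub>C x) (c *\<^sub>C x)) = (cmod c)^2 * Re (cinner x x)"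
    by (simp add: complex_norm_square[symmetric] del: of_real_power)
  then have "(norm (c *\<^sub>C x))^2 = (cmod c * norm x)^2"
    by (simp add: power2_norm_eq_inner inner_eq_Re_cinner power_mult_distrib)
  then show ?thesis by (simp add: power2_eq_iff_nonneg)
qed

lemma norm_cinner_le: "cmod (cinner x y) \<le> norm x * norm (y::'h::complex_hilbert)"
proof (cases "cinner x y = 0")
  case False
  define c where "c = cnj (cinner x y) / cmod (cinner x y)"
  have c: "cmod c = 1" using False by (simp add: c_def norm_divide)
  have "cinner x (c *\<^sub>C y) = cmod (cinner x y)"
    using False by (simp add: c_def cinner_scaleC_right complex_norm_square[symmetric]
        mult.commute power2_eq_square del: of_real_power)
  then have "cmod (cinner x y) = x \<bullet> (c *\<^sub>C y)" by (simp add: inner_eq_Re_cinner)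
  also have "\<dots> \<le> norm x * norm (c *\<^sub>C y)" by (rule norm_cauchy_schwarz)
  finally show ?thesis by (simp add: norm_scaleC c)
qed simp

lemma Re_hform_self: "Re (hform X X) = (cmod (fst X))^2 - (norm (snd X))^2"
proof -
  have "Re (cnj (fst X) * fst X) = (cmod (fst X))^2"
    by (simp only: mult.commute[of "cnj _"] complex_norm_square[symmetric] Re_complex_of_real)
  then show ?thesis by (simp add: hform_def power2_norm_eq_inner inner_eq_Re_cinner)
qed

lemma hform_orthogonal_neg:
  assumes "hpositive Y" "hform Y u = 0" "u \<noteq> 0"
  shows "Re (hform u u) < 0"
proof -
  have 1: "norm (snd Y) < cmod (fst Y)"
    using assms(1) by (simp add: hpositive_def Re_hform_self power_less_imp_less_base)
  have "cmod (fst Y) * cmod (fst u) = cmod (cinner (snd Y) (snd u))"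
  proof -
    have "cinner (snd Y) (snd u) = cnj (fst Y) * fst u" using assms(2) by (simp add: hform_def)
    then show ?thesis by (simp add: norm_mult)
  qed
  also have "\<dots> \<le> norm (snd Y) * norm (snd u)" by (rule norm_cinner_le)
  finally have 2: "cmod (fst Y) * cmod (fst u) \<le> norm (snd Y) * norm (snd u)" .
  have pos: "0 < cmod (fst Y)" using 1 norm_ge_zero[of "snd Y"] by linarith
  have n: "snd u \<noteq> 0"
  proof
    assume "snd u = 0"
    with 2 pos have "fst u = 0" by (simp add: mult_le_0_iff)
    with \<open>snd u = 0\<close> assms(3) show False by (simp add: prod_eq_iff)
  qed
  have "norm (snd Y) * norm (snd u) < cmod (fst Y) * norm (snd u)"
    using 1 n by simp
  with 2 have "cmod (fst Y) * cmod (fst u) < cmod (fst Y) * norm (snd u)" by linarith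
  then have "cmod (fst u) < norm (snd u)" using pos by simp
  then have "(cmod (fst u))^2 < (norm (snd u))^2" by (simp add: power_strict_mono)
  then show ?thesis by (simp add: Re_hform_self)
qed

lemma hform_projection:
  assumes "Re (hform Y Y) \<noteq> 0"
  defines "w X \<equiv> X + (- (hform Y X / hform Y Y)) *\<^sub>C Y"
  shows "hform Y (w X) = 0"
    and "hform (w X) (w Z) = hform X Z - cnj (hform Y X) * hform Y Z / Re (hform Y Y)"
proof -
  define q where "q = Re (hform Y Y)"
  have q: "hform Y Y = complex_of_real q" "q \<noteq> 0"
    using hform_self[of Y] assms(1) by (simp_all add: q_def)
  have c: "hform X Y = cnj (hform Y X)" for X by (rule hform_commute)
  show 1: "hform Y (w X) = 0" for X
    using q by (simp add: w_def hform_add_right hform_scaleC_right del: scaleC_minus_left)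
  show "hform (w X) (w Z) = hform X Z - cnj (hform Y X) * hform Y Z / Re (hform Y Y)"
    unfolding w_def q q_def[symmetric]
    using q(2)
    by (simp add: hform_add_right hform_scaleC_right hform_add_left hform_scaleC_left q c[of X]
        field_simps)
qed

lemma hform_orthogonal_cauchy_schwarz:
  assumes Y: "hpositive Y" "hform Y u = 0" "hform Y v = 0"
  shows "(cmod (hform u v))^2 \<le> Re (hform u u) * Re (hform v v)"
proof (cases "v = 0")
  case False
  define w where "w = u + (- (hform v u / hform v v)) *\<^sub>C v"
  have neg: "Re (hform v v) < 0" using hform_orthogonal_neg Y False by blast
  have "hform Y w = 0" using Y by (simp add: w_def hform_add_right hform_scaleC_right)
  then have "Re (hform w w) \<le> 0" using hform_orthogonal_neg[OF Y(1), of w] by fastforce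
  moreover have "hform w w = hform u u - cnj (hform v u) * hform v u / Re (hform v v)"
    unfolding w_def using hform_projection(2)[of v u u] neg by simp
  moreover have "cnj (hform v u) * hform v u = complex_of_real ((cmod (hform v u))^2)"
    by (simp add: complex_norm_square mult.commute del: of_real_power)
  ultimately have "Re (hform u u) - (cmod (hform v u))^2 / Re (hform v v) \<le> 0" by simp
  then have "Re (hform u u) * Re (hform v v) \<ge> (cmod (hform v u))^2"
    using neg by (simp add: field_simps)
  then show ?thesis by (simp add: norm_hform_commute)
qed simp

lemma hform_reverse_cauchy_schwarz:
  assumes "hpositive X" "hpositive Y"
  shows "Re (hform X X) * Re (hform Y Y) \<le> (cmod (hform X Y))^2"
    and "Re (hform X X) * Re (hform Y Y) = (cmod (hform X Y))^2 \<longleftrightarrow> (\<exists>c. Y = c *\<^sub>C X)"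
proof -
  define w where "w = Y + (- (hform X Y / hform X X)) *\<^sub>C X"
  have p: "Re (hform X X) > 0" using assms by (simp add: hpositive_def)
  have o: "hform X w = 0" unfolding w_def using hform_projection(1)[of X Y] p by simp
  have "hform w w = hform Y Y - cnj (hform X Y) * hform X Y / Re (hform X X)"
    unfolding w_def using hform_projection(2)[of X Y Y] p by simp
  moreover have "cnj (hform X Y) * hform X Y = complex_of_real ((cmod (hform X Y))^2)"
    by (simp add: complex_norm_square mult.commute del: of_real_power)
  ultimately have e: "Re (hform w w) = Re (hform Y Y) - (cmod (hform X Y))^2 / Re (hform X X)"
    by simp
  have le: "Re (hform w w) \<le> 0" and eq0: "Re (hform w w) = 0 \<longleftrightarrow> w = 0"
    using hform_orthogonal_neg[OF assms(1) o] by fastforce+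
  show "Re (hform X X) * Re (hform Y Y) \<le> (cmod (hform X Y))^2"
    using le e p by (simp add: field_simps)
  have "Re (hform X X) * Re (hform Y Y) = (cmod (hform X Y))^2 \<longleftrightarrow> w = 0"
    using eq0 e p by (auto simp: field_simps)
  also have "\<dots> \<longleftrightarrow> (\<exists>c. Y = c *\<^sub>C X)"
  proof
    assume "w = 0"
    then show "\<exists>c. Y = c *\<^sub>C X" by (auto simp: w_def scaleC_minus_left)
  next
    assume "\<exists>c. Y = c *\<^sub>C X"
    then obtain c where "Y = c *\<^sub>C X" by blast
    moreover have "hform X X \<noteq> 0" using p by auto
    ultimately show "w = 0" by (simp add: w_def hform_scaleC_right scaleC_minus_left)
  qed
  finally show "Re (hform X X) * Re (hform Y Y) = (cmod (hform X Y))^2 \<longleftrightarrow> (\<exists>c. Y = c *\<^sub>C X)" .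
qed

definition hcosh :: "complex \<times> 'h::complex_hilbert \<Rightarrow> complex \<times> 'h \<Rightarrow> real"
  where "hcosh X Y = cmod (hform X Y) / sqrt (Re (hform X X) * Re (hform Y Y))"

lemma hcosh_commute: "hcosh X Y = hcosh Y X"
  unfolding hcosh_def by (subst norm_hform_commute) (simp only: mult.commute)

lemma hcosh_power2:
  assumes "hpositive X" "hpositive Y"
  shows "(hcosh X Y)^2 = (cmod (hform X Y))^2 / (Re (hform X X) * Re (hform Y Y))"
  using assms by (simp add: hcosh_def hpositive_def power_divide)

lemma hcosh_ge_1:
  assumes "hpositive X" "hpositive Y"
  shows "1 \<le> hcosh X Y"
proof -
  have "0 < Re (hform X X) * Re (hform Y Y)" using assms by (simp add: hpositive_def)
  then have "1 \<le> (hcosh X Y)^2"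
    unfolding hcosh_power2[OF assms]
    using hform_reverse_cauchy_schwarz(1)[OF assms] by (simp only: le_divide_eq_1_pos)
  moreover have "0 \<le> hcosh X Y"
    using assms by (simp add: hcosh_def hpositive_def)
  ultimately show ?thesis by (rule power2_le_imp_le[of 1, simplified])
qed

lemma hcosh_eq_1_iff:
  assumes "hpositive X" "hpositive Y"
  shows "hcosh X Y = 1 \<longleftrightarrow> (\<exists>c. Y = c *\<^sub>C X)"
proof -
  have p: "0 < Re (hform X X) * Re (hform Y Y)" using assms by (simp add: hpositive_def)
  have "hcosh X Y = 1 \<longleftrightarrow> (hcosh X Y)^2 = 1"
    using hcosh_ge_1[OF assms] by (auto simp: power2_eq_1_iff)
  also have "\<dots> \<longleftrightarrow> Re (hform X X) * Re (hform Y Y) = (cmod (hform X Y))^2"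
    unfolding hcosh_power2[OF assms] using p by (auto simp only: divide_eq_1_iff)
  finally show ?thesis using hform_reverse_cauchy_schwarz(2)[OF assms] by simp
qed

lemma hcosh_scaleC:
  assumes "a \<noteq> 0" "b \<noteq> 0"
  shows "hcosh (a *\<^sub>C X) (b *\<^sub>C Y) = hcosh X Y"
proof -
  have r: "Re (hform (c *\<^sub>C X) (c *\<^sub>C X)) = (cmod c)^2 * Re (hform X X)" for c and X :: "complex \<times> 'a"
  proof -
    have "hform (c *\<^sub>C X) (c *\<^sub>C X) = complex_of_real ((cmod c)^2) * hform X X"
      by (simp add: hform_scaleC_left hform_scaleC_right complex_norm_square algebra_simps
          del: of_real_power)
    then show ?thesis by simp
  qed
  have "sqrt (Re (hform (a *\<^sub>C X) (a *\<^sub>C X)) * Re (hform (b *\<^sub>C Y) (b *\<^sub>C Y)))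
     = cmod a * cmod b * sqrt (Re (hform X X) * Re (hform Y Y))"
    by (simp add: r real_sqrt_mult)
  then show ?thesis
    using assms by (simp add: hcosh_def hform_scaleC_left hform_scaleC_right norm_mult)
qed

lemma hcosh_triangle:
  assumes "hpositive X" "hpositive Y" "hpositive Z"
  shows "hcosh X Z \<le> hcosh X Y * hcosh Y Z + sqrt ((hcosh X Y)^2 - 1) * sqrt ((hcosh Y Z)^2 - 1)"
proof -
  define q where "q V = Re (hform V V)" for V :: "complex \<times> 'a"
  define w where "w V = V + (- (hform Y V / hform Y Y)) *\<^sub>C Y" for V
  have p: "q X > 0" "q Y > 0" "q Z > 0" using assms by (simp_all add: q_def hpositive_def)
  have o: "hform Y (w V) = 0" for V
    unfolding w_def using hform_projection(1)[of Y V] p by (simp add: q_def)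
  have f: "hform (w V) (w W) = hform V W - cnj (hform Y V) * hform Y W / q Y" for V W
    unfolding w_def using hform_projection(2)[of Y V W] p by (simp add: q_def)
  have qw: "- q (w V) = q V * ((hcosh V Y)^2 - 1)" if "hpositive V" for V
  proof -
    have "cnj (hform Y V) * hform Y V = complex_of_real ((cmod (hform Y V))^2)"
      by (simp add: complex_norm_square mult.commute del: of_real_power)
    then have "q (w V) = q V - (cmod (hform Y V))^2 / q Y"
      using f[of V V] by (simp add: q_def)
    moreover have "q V > 0" using that by (simp add: q_def hpositive_def)
    moreover have "(hcosh V Y)^2 = (cmod (hform Y V))^2 / (q V * q Y)"
      using hcosh_power2[OF that assms(2)] by (simp add: q_def norm_hform_commute[of V Y])
    ultimately show ?thesis by (simp add: right_diff_distrib)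
  qed
  have "cmod (hform (w X) (w Z)) \<le> sqrt (q (w X) * q (w Z))"
    using hform_orthogonal_cauchy_schwarz[OF assms(2) o o, of X Z]
    by (simp add: q_def real_le_rsqrt)
  also have "q (w X) * q (w Z) = (- q (w X)) * (- q (w Z))" by simp
  also have "\<dots> = (q X * q Z) * (((hcosh X Y)^2 - 1) * ((hcosh Y Z)^2 - 1))"
    unfolding qw[OF assms(1)] qw[OF assms(3)] hcosh_commute[of Z Y] by (simp only: ac_simps)
  finally have 1: "cmod (hform (w X) (w Z)) \<le>
      sqrt (q X * q Z) * (sqrt ((hcosh X Y)^2 - 1) * sqrt ((hcosh Y Z)^2 - 1))"
    by (simp only: real_sqrt_mult)
  have "hform X Z = cnj (hform Y X) * hform Y Z / q Y + hform (w X) (w Z)" by (simp add: f)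
  then have "cmod (hform X Z) \<le> cmod (cnj (hform Y X) * hform Y Z / q Y) + cmod (hform (w X) (w Z))"
    by (metis norm_triangle_ineq)
  also have "cmod (cnj (hform Y X) * hform Y Z / q Y) = cmod (hform X Y) * cmod (hform Y Z) / q Y"
    using p by (simp add: norm_mult norm_divide norm_hform_commute[of X])
  also have "\<dots> = sqrt (q X * q Z) * (hcosh X Y * hcosh Y Z)"
  proof -
    have "sqrt (q Y) * sqrt (q Y) = q Y" using p by simp
    then show ?thesis
      using p by (simp add: hcosh_def q_def[symmetric] real_sqrt_mult field_simps)
  qed
  finally have "cmod (hform X Z) \<le> sqrt (q X * q Z) *
      (hcosh X Y * hcosh Y Z + sqrt ((hcosh X Y)^2 - 1) * sqrt ((hcosh Y Z)^2 - 1))"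
    using 1 by (simp add: algebra_simps)
  moreover have "0 < sqrt (q X * q Z)" using p by simp
  ultimately show ?thesis
    unfolding hcosh_def[of X Z] q_def[symmetric] by (simp add: pos_divide_le_eq mult.commute)
qed


section \<open>Complex hyperbolic space\<close>

definition hline_rel :: "complex \<times> 'h::complex_hilbert \<Rightarrow> complex \<times> 'h \<Rightarrow> bool"
  where "hline_rel X Y \<longleftrightarrow> hpositive X \<and> hpositive Y \<and> (\<exists>c. c \<noteq> 0 \<and> Y = c *\<^sub>C X)"

quotient_type (overloaded) 'h chyp = "complex \<times> 'h::complex_hilbert" / partial: hline_rel
  morphisms rep_chyp chyp_of
proof (rule part_equivpI)
  show "\<exists>X. hline_rel X (X :: complex \<times> 'h)"
    by (intro exI[of _ "(1, 0)"])
      (auto simp: hline_rel_def hpositive_def Re_hform_self intro!: exI[of _ 1])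
  show "symp (hline_rel :: complex \<times> 'h \<Rightarrow> _)"
  proof (rule sympI)
    fix X Y :: "complex \<times> 'h"
    assume "hline_rel X Y"
    then obtain c where c: "c \<noteq> 0" "Y = c *\<^sub>C X" "hpositive X" "hpositive Y"
      by (auto simp: hline_rel_def)
    then have "X = inverse c *\<^sub>C Y" by (simp add: scaleC_scaleC)
    with c show "hline_rel Y X"
      unfolding hline_rel_def using nonzero_imp_inverse_nonzero by blast
  qed
  show "transp (hline_rel :: complex \<times> 'h \<Rightarrow> _)"
  proof (rule transpI)
    fix X Y Z :: "complex \<times> 'h"
    assume "hline_rel X Y" "hline_rel Y Z"
    then obtain c d where "c \<noteq> 0" "Y = c *\<^sub>C X" "hpositive X" "d \<noteq> 0" "Z = d *\<^sub>C Y" "hpositive Z"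
      by (auto simp: hline_rel_def)
    then have "d * c \<noteq> 0" "Z = (d * c) *\<^sub>C X" by (simp_all add: scaleC_scaleC)
    with \<open>hpositive X\<close> \<open>hpositive Z\<close> show "hline_rel X Z" unfolding hline_rel_def by blast
  qed
qed

instantiation chyp :: (complex_hilbert) metric_space
begin

lift_definition dist_chyp :: "'a chyp \<Rightarrow> 'a chyp \<Rightarrow> real"
  is "\<lambda>X Y. arcosh (cmod (hform X Y) / sqrt (Re (hform X X) * Re (hform Y Y)))"
  unfolding hcosh_def[symmetric] by (auto simp: hline_rel_def hcosh_scaleC)

definition uniformity_chyp :: "('a chyp \<times> 'a chyp) filter"
  where "uniformity_chyp = (INF e\<in>{0<..}. principal {(x, y). dist x y < e})"

definition open_chyp :: "'a chyp set \<Rightarrow> bool"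
  where "open_chyp U \<longleftrightarrow> (\<forall>x\<in>U. eventually (\<lambda>(x', y). x' = x \<longrightarrow> y \<in> U) uniformity)"

instance
proof
  fix x y z :: "'a chyp"
  show "dist x y = 0 \<longleftrightarrow> x = y"
  proof transfer
    fix X Y :: "complex \<times> 'a"
    assume "hline_rel X X" "hline_rel Y Y"
    then have p: "hpositive X" "hpositive Y" by (auto simp: hline_rel_def)
    have "Y \<noteq> 0" using p by (auto simp: hpositive_def)
    then have "(\<exists>c. Y = c *\<^sub>C X) \<longleftrightarrow> hline_rel X Y"
      using p by (auto simp: hline_rel_def) (metis scaleC_zero_left)
    then show "(arcosh (cmod (hform X Y) / sqrt (Re (hform X X) * Re (hform Y Y))) = 0)
        = hline_rel X Y"
      unfolding hcosh_def[symmetric]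
      using hcosh_ge_1[OF p] hcosh_eq_1_iff[OF p] by simp
  qed
  show "dist x y \<le> dist x z + dist y z"
  proof transfer
    fix X Y Z :: "complex \<times> 'a"
    assume "hline_rel X X" "hline_rel Y Y" "hline_rel Z Z"
    then have p: "hpositive X" "hpositive Y" "hpositive Z" by (auto simp: hline_rel_def)
    define a where "a = arcosh (hcosh X Z)"
    define b where "b = arcosh (hcosh Y Z)"
    have a: "cosh a = hcosh X Z" "0 \<le> a" using hcosh_ge_1[OF p(1,3)] by (simp_all add: a_def)
    have b: "cosh b = hcosh Y Z" "0 \<le> b" using hcosh_ge_1[OF p(2,3)] by (simp_all add: b_def)
    have s: "sqrt ((cosh t)^2 - 1) = sinh t" if "0 \<le> t" for t :: real
      using that by (simp add: cosh_square_eq)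
    have "hcosh X Y \<le> cosh a * cosh b + sinh a * sinh b"
      using hcosh_triangle[OF p(1,3,2)] s[OF a(2)] s[OF b(2)]
      by (simp add: a b hcosh_commute[of Z])
    also have "\<dots> = cosh (a + b)" by (simp add: cosh_add)
    finally have "cosh (arcosh (hcosh X Y)) \<le> cosh (a + b)"
      using hcosh_ge_1[OF p(1,2)] by simp
    then have "arcosh (hcosh X Y) \<le> a + b"
      using a b hcosh_ge_1[OF p(1,2)] by (subst (asm) cosh_real_nonneg_le_iff) simp_all
    then show "arcosh (cmod (hform X Y) / sqrt (Re (hform X X) * Re (hform Y Y)))
        \<le> arcosh (cmod (hform X Z) / sqrt (Re (hform X X) * Re (hform Z Z)))
        + arcosh (cmod (hform Y Z) / sqrt (Re (hform Y Y) * Re (hform Z Z)))"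
      by (simp add: hcosh_def[symmetric] a_def b_def)
  qed
qed (simp_all add: uniformity_chyp_def open_chyp_def)

end

lemma cosh_dist_chyp_of:
  assumes "hpositive X" "hpositive Y"
  shows "cosh (dist (chyp_of X) (chyp_of Y))
    = cmod (hform X Y) / sqrt (Re (hform X X) * Re (hform Y Y))"
proof -
  have r: "hline_rel X X" "hline_rel Y Y"
    using assms by (auto simp: hline_rel_def intro!: exI[of _ 1])
  then show ?thesis
    using hcosh_ge_1[OF assms] by (simp add: dist_chyp.abs_eq hcosh_def[symmetric])
qed

lift_definition cartan_arg :: "'h::complex_hilbert chyp \<Rightarrow> 'h chyp \<Rightarrow> 'h chyp \<Rightarrow> real"
  is "\<lambda>X Y Z. Arg (hform X Y * hform Y Z * hform Z X)"
proof -
  fix X X' Y Y' Z Z' :: "complex \<times> 'h"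
  assume "hline_rel X X'" "hline_rel Y Y'" "hline_rel Z Z'"
  then obtain a b c where abc: "a \<noteq> 0" "X' = a *\<^sub>C X" "b \<noteq> 0" "Y' = b *\<^sub>C Y" "c \<noteq> 0" "Z' = c *\<^sub>C Z"
    by (auto simp: hline_rel_def)
  have "hform X' Y' * hform Y' Z' * hform Z' X'
      = (a * cnj a) * (b * cnj b) * (c * cnj c) * (hform X Y * hform Y Z * hform Z X)"
    by (simp add: abc hform_scaleC_left hform_scaleC_right algebra_simps)
  also have "(a * cnj a) * (b * cnj b) * (c * cnj c)
      = complex_of_real ((cmod a)^2 * (cmod b)^2 * (cmod c)^2)"
    by (simp only: of_real_mult complex_norm_square)
  finally have "hform X' Y' * hform Y' Z' * hform Z' X'
      = complex_of_real ((cmod a)^2 * (cmod b)^2 * (cmod c)^2) * (hform X Y * hform Y Z * hform Z X)" .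
  moreover have "0 < (cmod a)^2 * (cmod b)^2 * (cmod c)^2" using abc by simp
  ultimately show "Arg (hform X Y * hform Y Z * hform Z X) = Arg (hform X' Y' * hform Y' Z' * hform Z' X')"
    by (simp only: Arg_times_of_real)
qed

definition chyp_subspace :: "'h::complex_hilbert chyp set \<Rightarrow> bool"
  where "chyp_subspace Y \<longleftrightarrow> Y \<noteq> {} \<and>
    (\<exists>W. csubspace W \<and> closed W \<and> Y = chyp_of ` {X \<in> W. hpositive X})"


section \<open>Isometry groups and the boundary at infinity\<close>

definition Isom :: "('a::metric_space \<Rightarrow> 'a) monoid"
  where "Isom = \<lparr>carrier = {g. bij g \<and> (\<forall>x y. dist (g x) (g y) = dist x y)},
    monoid.mult = (\<circ>), one = id\<rparr>"

lemma group_Isom: "group (Isom :: ('a::metric_space \<Rightarrow> 'a) monoid)"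
proof (rule groupI)
  fix g :: "'a \<Rightarrow> 'a"
  assume g: "g \<in> carrier Isom"
  then have "inv_into UNIV g \<in> carrier Isom"
    by (auto simp: Isom_def bij_imp_bij_inv)
      (metis bij_inv_eq_iff)
  moreover have "inv_into UNIV g \<circ> g = id"
    using g by (simp add: Isom_def bij_is_inj)
  ultimately show "\<exists>h\<in>carrier Isom. h \<otimes>\<^bsub>Isom\<^esub> g = \<one>\<^bsub>Isom\<^esub>"
    by (auto simp: Isom_def)
qed (auto simp: Isom_def bij_comp comp_assoc)

text \<open>
  The boundary consists of the geodesic rays modulo finite distance. Rays are encoded as
  functions on all of \<open>\<real>\<close> whose values at negative arguments are irrelevant.
\<close>

definition geodesic_ray :: "(real \<Rightarrow> 'a::metric_space) \<Rightarrow> bool"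
  where "geodesic_ray r \<longleftrightarrow> (\<forall>s\<ge>0. \<forall>t\<ge>0. dist (r s) (r t) = \<bar>s - t\<bar>)"

definition asymptotic_rays :: "((real \<Rightarrow> 'a::metric_space) \<times> (real \<Rightarrow> 'a)) set"
  where "asymptotic_rays = {(r, r'). geodesic_ray r \<and> geodesic_ray r' \<and>
    (\<exists>C. \<forall>t\<ge>0. dist (r t) (r' t) \<le> C)}"

definition ideal_boundary :: "(real \<Rightarrow> 'a::metric_space) set set"
  where "ideal_boundary = {r. geodesic_ray r} // asymptotic_rays"

definition boundary_action :: "('a \<Rightarrow> 'a) \<Rightarrow> (real \<Rightarrow> 'a) set \<Rightarrow> (real \<Rightarrow> 'a::metric_space) set"
  where "boundary_action g \<xi> = (\<lambda>r. g \<circ> r) ` \<xi>"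

text \<open>The disjoint union of the space and its boundary is a subset of a sum type.\<close>

definition nonelementary :: "('a::metric_space \<Rightarrow> 'a) set \<Rightarrow> bool"
  where "nonelementary A \<longleftrightarrow>
    \<not> (\<exists>S \<subseteq> UNIV <+> ideal_boundary. finite S \<and> S \<noteq> {} \<and>
        (\<forall>g\<in>A. map_sum g (boundary_action g) ` S = S))"


section \<open>Irreducibility and canonical orbits\<close>

text \<open>
  For non-elementary \<open>A\<close> there is exactly one such \<open>Y\<close>.
\<close>

definition irreducible_part ::
    "('h::complex_hilbert chyp \<Rightarrow> 'h chyp) set \<Rightarrow> 'h chyp set \<Rightarrow> bool"
  where "irreducible_part A Y \<longleftrightarrow>
    chyp_subspace Y \<and> (\<forall>g\<in>A. g ` Y = Y) \<and>
    (\<forall>Y'. chyp_subspace Y' \<and> Y' \<subseteq> Y \<and> (\<forall>g\<in>A. g ` Y' = Y') \<longrightarrow> Y' = Y)"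

definition irreducible_action :: "('h::complex_hilbert chyp \<Rightarrow> 'h chyp) set \<Rightarrow> bool"
  where "irreducible_action A \<longleftrightarrow> nonelementary A \<and> irreducible_part A UNIV"

text \<open>
  \<open>G\<close> is a group of isometries, \<open>Q\<close> the homogeneous space of \<open>G\<close> whose point stabilisers are
  used, and \<open>\<sigma>\<close> an action of \<open>G\<close>. When \<open>G\<close> is the isometry group of the real or complex
  hyperbolic space \<open>Q\<close> and \<open>\<sigma>\<close> is continuous and non-elementary, there is exactly one such \<open>Orb\<close>
  and every \<open>q \<in> Q\<close> yields it. Continuity is not a part of the definition.
\<close>

definition canonical_orbit ::
    "('a \<Rightarrow> 'a) set \<Rightarrow> 'a set \<Rightarrow> (('a \<Rightarrow> 'a) \<Rightarrow> 'h::complex_hilbert chyp \<Rightarrow> 'h chyp)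
      \<Rightarrow> 'h chyp set \<Rightarrow> bool"
  where "canonical_orbit G Q \<sigma> Orb \<longleftrightarrow>
    (\<exists>Y. irreducible_part (\<sigma> ` G) Y \<and>
      (\<exists>q\<in>Q. \<exists>p. {y \<in> Y. \<forall>g\<in>G. g q = q \<longrightarrow> \<sigma> g y = y} = {p} \<and> Orb = (\<lambda>g. \<sigma> g p) ` G))"


section \<open>Real hyperbolic space\<close>

text \<open>
  A real form is a real subspace \<open>V\<close> with \<open>\<complex> \<oplus> H = V \<oplus> \<i>V\<close> on which the form is
  real-valued. The form then has signature \<open>(1,\<infinity>)\<close> on \<open>V\<close> and \<open>V\<close> is closed.
\<close>

definition real_form :: "(complex \<times> 'h::complex_hilbert) set \<Rightarrow> bool"
  where "real_form V \<longleftrightarrow> subspace V \<and>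
    (\<forall>X. \<exists>!(A, B). A \<in> V \<and> B \<in> V \<and> X = A + \<i> *\<^sub>C B) \<and>
    (\<forall>X\<in>V. \<forall>Y\<in>V. hform X Y \<in> \<real>)"

definition real_hyp :: "(complex \<times> 'h::complex_hilbert) set \<Rightarrow> 'h chyp set"
  where "real_hyp V = chyp_of ` {X \<in> V. hpositive X}"

definition U1_inf :: "(complex \<times> 'h::complex_hilbert \<Rightarrow> complex \<times> 'h) set"
  where "U1_inf = {T. clinear T \<and> bij T \<and> (\<forall>X Y. hform (T X) (T Y) = hform X Y)}"

text \<open>
  The group \<open>O(1,\<infinity>)\<close> of \<open>V\<close> embeds into \<open>U(1,\<infinity>)\<close> by complexification; its image is the
  stabiliser of \<open>V\<close>.
\<close>

definition O1_inf ::
    "(complex \<times> 'h::complex_hilbert) set \<Rightarrow> (complex \<times> 'h \<Rightarrow> complex \<times> 'h) set"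
  where "O1_inf V = {T \<in> U1_inf. T ` V = V}"

definition real_Isom :: "(complex \<times> 'h::complex_hilbert) set \<Rightarrow> ('h chyp \<Rightarrow> 'h chyp) set"
  where "real_Isom V = {g \<in> carrier Isom.
    \<exists>T\<in>O1_inf V. \<forall>X. hpositive X \<longrightarrow> g (chyp_of X) = chyp_of (T X)}"

end

theory Submission
  imports Defs "HOL-Real_Asymp.Real_Asymp"
begin

text \<open>
  The canonical orbit yields an equivariant map \<open>f\<close>, and separability makes \<open>f\<close> continuous, since
  otherwise its image would be uncountable and uniformly discrete. Let \<open>e\<^sub>n\<close> be orthonormal
  directions at a point \<open>q\<close>. The means of lifts of the images of the points at a fixed distance from
  \<open>q\<close> in the directions \<open>e\<^sub>n\<close> converge to a vector fixed by the stabiliser of \<open>q\<close>, hence to a multiple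
  of a lift of \<open>f q\<close>. So the products of lifts of the images \<open>f q\<close>, \<open>f x\<close>, \<open>f y\<close> multiply in a right
  triangle with right angle at \<open>q\<close>. By the hyperbolic theorem of Pythagoras
  \<open>cosh d(f x, f y) = (cosh d(x, y))\<^sup>t\<close>, where \<open>t \<le> 1\<close> by the triangle inequality.

  In the ball model the kernel of \<open>f\<close> is then a function \<open>\<kappa>\<close> of the scalar product of \<open>x\<close> and \<open>y\<close>,
  and right triangles at points near the origin show that
  \<open>\<kappa> s = \<bar>1 - s\<bar>\<^sup>t exp (\<i> \<tau> Arg (1 - s))\<close> for small \<open>s\<close>. The signature of the form, tested on the
  fourth roots of unity in a complex line, forces \<open>\<tau> = \<plusminus> t\<close>; the negative sign is removed by conjugating
  with an anti-holomorphic isometry. The cocycle identity for the Cartan argument extends the formula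
  from triangles with a short side to all triangles. Finally \<open>\<rho>\<close> is continuous because the lifts of the
  image of \<open>f\<close> span a dense subspace.
\<close>

section \<open>Sesquilinear forms and lifts\<close>

text \<open>The obstacle is that \<open>\<rho>\<close> is an abstract homomorphism. Nothing says
  which of its values are holomorphic, so it respects Cartan arguments only up to an uncontrolled
  sign. Hence isometries are first shown to come from unitary or anti-unitary maps, and transitivity
  on triples with a given Gram matrix is then obtained through squares alone. The means settle
  modulus and phase at once. The lifts of the simplex points all have the same complex product with
  a lift of \<open>f y\<close>, and this number must equal the positive product supplied by the
  centre. So a right angle at the origin has Cartan argument zero after \<open>f\<close>, and by
  homogeneity so does every right angle. All further phase information is drawn from right angles.
  At the origin they only say that the kernel is 1 for orthogonal vectors, whereas at a point with
  squared norm 1/100 they make \<open>\<kappa> s\<close> multiplicative in \<open>1 - s\<close>. The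
  four fourth roots of unity have a circulant Gram matrix, and its expansions of first and second
  order at the origin bound \<open>\<tau>\<close> from opposite sides.\<close>

lemma scaleC_zero_right [simp]: "c *\<^sub>C (0::'a::complex_vector) = 0"
  using scaleC_add_right[of c 0 "0::'a"] by simp

lemma scaleC_minus_right: "c *\<^sub>C (- x) = - (c *\<^sub>C (x::'a::complex_vector))"
  using scaleC_add_right[of c "-x" x] by (simp add: eq_neg_iff_add_eq_0)

lemma scaleC_diff_right: "c *\<^sub>C (x - y) = c *\<^sub>C x - c *\<^sub>C (y::'a::complex_vector)"
  using scaleC_add_right[of c x "- y"] by (simp add: scaleC_minus_right)

lemma scaleC_diff_left: "(a - b) *\<^sub>C x = a *\<^sub>C x - b *\<^sub>C (x::'a::complex_vector)"
  using scaleC_add_left[of a "- b" x] by (simp add: scaleC_minus_left)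

lemma scaleC_scaleR_commute: "c *\<^sub>C (r *\<^sub>R x) = r *\<^sub>R (c *\<^sub>C (x::'a::complex_vector))"
  by (simp add: scaleC_of_real[symmetric] scaleC_scaleC mult.commute)

lemma scaleC_eq_0_iff [simp]: "c *\<^sub>C (x::'a::complex_vector) = 0 \<longleftrightarrow> c = 0 \<or> x = 0"
proof
  assume "c *\<^sub>C x = 0"
  then have "c \<noteq> 0 \<Longrightarrow> x = 0"
    using scaleC_scaleC[of "inverse c" c x] by simp
  then show "c = 0 \<or> x = 0" by blast
qed auto

lemma cinner_add_left: "cinner (x + y) z = cinner x z + cinner y (z::'h::complex_hilbert)"
  by (subst (1 2 3) cinner_commute) (simp add: cinner_add_right)

lemma cinner_scaleC_left: "cinner (c *\<^sub>C x) y = cnj c * cinner x (y::'h::complex_hilbert)"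
  by (subst (1 2) cinner_commute) (simp add: cinner_scaleC_right)

lemma cinner_self: "cinner x x = complex_of_real ((norm (x::'h::complex_hilbert))\<^sup>2)"
proof -
  have "Im (cinner x x) = - Im (cinner x x)"
    using arg_cong[OF cinner_commute[of x x], of Im] by simp
  then show ?thesis by (simp add: complex_eq_iff power2_norm_eq_inner inner_eq_Re_cinner)
qed

lemma bounded_bilinear_cinner: "bounded_bilinear (cinner :: 'h::complex_hilbert \<Rightarrow> _)"
proof
  show "\<exists>K. \<forall>a b. cmod (cinner a (b::'h)) \<le> norm a * norm b * K"
    by (rule exI[of _ 1]) (simp add: norm_cinner_le)
qed (simp_all add: cinner_add_left cinner_add_right cinner_scaleC_left cinner_scaleC_right
      scaleC_of_real[symmetric] scaleC_complex_def)

lemmas cinner_diff_left = bounded_bilinear.diff_left[OF bounded_bilinear_cinner]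
  and cinner_diff_right = bounded_bilinear.diff_right[OF bounded_bilinear_cinner]
  and cinner_zero_left [simp] = bounded_bilinear.zero_left[OF bounded_bilinear_cinner]
  and cinner_zero_right [simp] = bounded_bilinear.zero_right[OF bounded_bilinear_cinner]

lemma norm_hform_le: "cmod (hform X Y) \<le> 2 * (norm X * norm Y)"
proof -
  have "cmod (hform X Y) \<le> cmod (fst X) * cmod (fst Y) + norm (snd X) * norm (snd Y)"
    unfolding hform_def
    by (rule order_trans[OF norm_triangle_ineq4]) (simp add: norm_mult norm_cinner_le)
  also have "\<dots> \<le> norm X * norm Y + norm X * norm Y"
    by (intro add_mono mult_mono norm_fst_le norm_snd_le) (cases X, cases Y, auto intro: norm_fst_le norm_snd_le)+
  finally show ?thesis by simp
qed

lemma scaleR_prod_scaleC: "r *\<^sub>R (X::complex \<times> 'h::complex_hilbert) = complex_of_real r *\<^sub>C X"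
  by (simp add: scaleC_of_real)

lemma bounded_bilinear_hform: "bounded_bilinear (hform :: complex \<times> 'h::complex_hilbert \<Rightarrow> _)"
proof
  show "\<exists>K. \<forall>a b. cmod (hform a (b::complex \<times> 'h)) \<le> norm a * norm b * K"
    by (rule exI[of _ 2]) (use norm_hform_le in \<open>auto simp: mult.commute\<close>)
qed (simp_all add: hform_add_left hform_add_right hform_scaleC_left hform_scaleC_right
      scaleR_prod_scaleC scaleR_conv_of_real)

lemmas hform_diff_left = bounded_bilinear.diff_left[OF bounded_bilinear_hform]
  and hform_diff_right = bounded_bilinear.diff_right[OF bounded_bilinear_hform]
  and hform_sum_left = bounded_bilinear.sum_left[OF bounded_bilinear_hform]
  and hform_sum_right = bounded_bilinear.sum_right[OF bounded_bilinear_hform]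
  and tendsto_hform = bounded_bilinear.tendsto[OF bounded_bilinear_hform]

text \<open>The form is negative definite on the orthogonal complement of \<open>X\<close>, so the
  component along \<open>X\<close> and the self-product together control the Hilbert norm. This
  turns estimates for form values into norm convergence of means and of lifts.\<close>

lemma norm_le_hform:
  assumes X: "hpositive (X :: complex \<times> 'h::complex_hilbert)"
  obtains C where "C > 0"
    "\<And>D. (norm D)\<^sup>2 \<le> C * ((cmod (hform X D))\<^sup>2 + \<bar>Re (hform D D)\<bar>)"
proof -
  define a q where "a = cmod (fst X)" and "q = norm (snd X)"
  have qa: "0 \<le> q" "q < a"
    using X by (simp_all add: a_def q_def hpositive_def Re_hform_self power_less_imp_less_base)
  define e where "e = a\<^sup>2 - q\<^sup>2"
  have e: "e > 0" using qa by (simp add: e_def power_strict_mono)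
  have pos: "0 < 4 / e * (1 + 2 * q\<^sup>2 / e) + 4 * a\<^sup>2 / e + 1"
    using e by (intro add_nonneg_pos add_nonneg_nonneg mult_nonneg_nonneg) auto
  show ?thesis
  proof (rule that[OF pos])
    fix D :: "complex \<times> 'h"
    have linear_combination: "d' + n' \<le> (A + E + 1) * (b + M)"
      if "2 * n' \<le> A * b + E * M" "d' \<le> n' + M" "0 \<le> A * M" "0 \<le> (E + 1) * b" for n' A b E M d' :: real
      using that by (simp add: algebra_simps)
    define d n \<beta> N where "d = cmod (fst D)" and "n = norm (snd D)"
      and "\<beta> = cmod (hform X D)" and "N = \<bar>Re (hform D D)\<bar>"
    have nn: "0 \<le> d" "0 \<le> n" "0 \<le> \<beta>" "0 \<le> N" by (simp_all add: d_def n_def \<beta>_def N_def)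
    have "cnj (fst X) * fst D = hform X D + cinner (snd X) (snd D)" by (simp add: hform_def)
    then have "a * d \<le> \<beta> + cmod (cinner (snd X) (snd D))"
      unfolding a_def d_def \<beta>_def by (metis complex_mod_cnj norm_mult norm_triangle_ineq)
    also have "\<dots> \<le> \<beta> + q * n" by (simp add: q_def n_def norm_cinner_le)
    finally have "(a * d)\<^sup>2 \<le> (\<beta> + q * n)\<^sup>2"
      using nn qa by (intro power_mono) auto
    then have 1: "a\<^sup>2 * d\<^sup>2 \<le> \<beta>\<^sup>2 + 2 * \<beta> * (q * n) + q\<^sup>2 * n\<^sup>2"
      by (simp add: power_mult_distrib power2_sum)
    have dn: "n\<^sup>2 \<le> d\<^sup>2 + N" "d\<^sup>2 \<le> n\<^sup>2 + N"
      unfolding N_def Re_hform_self d_def n_def by linarith+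
    \<comment> \<open>Weighted so that the mixed term costs only half of the gap \<open>e\<close>
      between \<open>a\<^sup>2\<close> and \<open>q\<^sup>2\<close>; the other half stays as the
      coefficient of \<open>n\<^sup>2\<close>.\<close>
    have "2 * \<beta> * (q * n) \<le> e / 2 * n\<^sup>2 + 2 * q\<^sup>2 / e * \<beta>\<^sup>2"
    proof -
      have "0 \<le> (e * n - 2 * q * \<beta>)\<^sup>2 / (2 * e)" using e by simp
      also have "\<dots> = e / 2 * n\<^sup>2 + 2 * q\<^sup>2 / e * \<beta>\<^sup>2 - 2 * \<beta> * (q * n)"
        using e by (simp add: power2_eq_square field_simps)
      finally show ?thesis by simp
    qed
    moreover have "a\<^sup>2 * n\<^sup>2 \<le> a\<^sup>2 * d\<^sup>2 + a\<^sup>2 * N"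
      using mult_left_mono[OF dn(1), of "a\<^sup>2"] by (simp add: distrib_left)
    ultimately have "e / 2 * n\<^sup>2 \<le> (1 + 2 * q\<^sup>2 / e) * \<beta>\<^sup>2 + a\<^sup>2 * N"
    proof -
      assume h: "2 * \<beta> * (q * n) \<le> e / 2 * n\<^sup>2 + 2 * q\<^sup>2 / e * \<beta>\<^sup>2" "a\<^sup>2 * n\<^sup>2 \<le> a\<^sup>2 * d\<^sup>2 + a\<^sup>2 * N"
      have "a\<^sup>2 * n\<^sup>2 = e * n\<^sup>2 + q\<^sup>2 * n\<^sup>2" by (simp add: e_def left_diff_distrib)
      with h 1 show ?thesis by (simp add: distrib_right)
    qed
    then have "4 / e * (e / 2 * n\<^sup>2) \<le> 4 / e * ((1 + 2 * q\<^sup>2 / e) * \<beta>\<^sup>2 + a\<^sup>2 * N)"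
      using e by (intro mult_left_mono) auto
    then have "2 * n\<^sup>2 \<le> 4 / e * (1 + 2 * q\<^sup>2 / e) * \<beta>\<^sup>2 + 4 * a\<^sup>2 / e * N"
      using e by (simp add: field_simps)
    moreover have "(norm D)\<^sup>2 = d\<^sup>2 + n\<^sup>2"
      by (simp add: norm_prod_def d_def n_def)
    moreover have "0 \<le> 4 / e * (1 + 2 * q\<^sup>2 / e) * N" "0 \<le> (4 * a\<^sup>2 / e + 1) * \<beta>\<^sup>2"
      using e nn by auto
    ultimately show "(norm D)\<^sup>2 \<le> (4 / e * (1 + 2 * q\<^sup>2 / e) + 4 * a\<^sup>2 / e + 1)
        * ((cmod (hform X D))\<^sup>2 + \<bar>Re (hform D D)\<bar>)"
      using dn(2) unfolding \<beta>_def[symmetric] N_def[symmetric]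
      using linear_combination[of "n\<^sup>2" "4 / e * (1 + 2 * q\<^sup>2 / e)" "\<beta>\<^sup>2" "4 * a\<^sup>2 / e" N "d\<^sup>2"]
      by simp
  qed
qed

section \<open>Points of hyperbolic space and their positive representatives\<close>

lemma hpositive_base: "hpositive (1, 0)"
  by (simp add: hpositive_def hform_def)

lemma hline_rel_refl: "hpositive X \<Longrightarrow> hline_rel X X"
  by (auto simp: hline_rel_def intro!: exI[of _ 1])

lemma chyp_of_eq_iff:
  assumes "hpositive X" "hpositive Y"
  shows "chyp_of X = chyp_of Y \<longleftrightarrow> (\<exists>c. c \<noteq> 0 \<and> Y = c *\<^sub>C X)"
proof -
  have "chyp_of X = chyp_of Y \<longleftrightarrow> hline_rel X Y"
    using Quotient3_rel[OF Quotient3_chyp, of X Y] hline_rel_refl[OF assms(1)] hline_rel_refl[OF assms(2)]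
    by simp
  then show ?thesis using assms by (simp add: hline_rel_def)
qed

lemma Re_hform_scaleC: "Re (hform (c *\<^sub>C X) (c *\<^sub>C X)) = (cmod c)\<^sup>2 * Re (hform X X)"
proof -
  have "hform (c *\<^sub>C X) (c *\<^sub>C X) = complex_of_real ((cmod c)\<^sup>2) * hform X X"
    by (simp add: hform_scaleC_left hform_scaleC_right complex_norm_square algebra_simps
        del: of_real_power)
  then show ?thesis by simp
qed

lemma hpositive_scaleC [simp]: "hpositive (c *\<^sub>C X) \<longleftrightarrow> c \<noteq> 0 \<and> hpositive X"
  by (auto simp: hpositive_def Re_hform_scaleC zero_less_mult_iff)

lemma chyp_of_scaleC:
  assumes "hpositive X" "c \<noteq> 0"
  shows "chyp_of (c *\<^sub>C X) = chyp_of X"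
  using chyp_of_eq_iff[of X "c *\<^sub>C X"] assms by auto

lemma chyp_cases:
  obtains X where "hpositive X" "x = chyp_of X" "hform X X = 1"
proof -
  obtain Y where Y: "hpositive Y" "x = chyp_of Y"
    using chyp.abs_induct[of "\<lambda>x. \<exists>Y. hpositive Y \<and> x = chyp_of Y" x]
    by (auto simp: hline_rel_def)
  define c where "c = complex_of_real (1 / sqrt (Re (hform Y Y)))"
  have p: "Re (hform Y Y) > 0" using Y by (simp add: hpositive_def)
  then have "c \<noteq> 0" by (simp add: c_def)
  moreover have "Re (hform (c *\<^sub>C Y) (c *\<^sub>C Y)) = 1"
    using p by (simp only: Re_hform_scaleC) (simp add: c_def norm_divide power_divide)
  then have "hform (c *\<^sub>C Y) (c *\<^sub>C Y) = 1"
    by (subst hform_self) simp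
  ultimately show thesis
    using that[of "c *\<^sub>C Y"] Y chyp_of_scaleC[of Y c] by simp
qed

lemma dist_chyp_of:
  assumes "hpositive X" "hpositive Y"
  shows "dist (chyp_of X) (chyp_of Y) = arcosh (hcosh X Y)"
  using assms by (simp add: dist_chyp.abs_eq hline_rel_refl hcosh_def)

lemma cosh_dist_eq_hcosh:
  assumes "hpositive X" "hpositive Y"
  shows "cosh (dist (chyp_of X) (chyp_of Y)) = hcosh X Y"
  using cosh_dist_chyp_of[OF assms] by (simp add: hcosh_def)

lemma cosh_eq_iff_nonneg: "0 \<le> x \<Longrightarrow> 0 \<le> y \<Longrightarrow> cosh x = cosh y \<longleftrightarrow> x = (y::real)"
  by (metis cosh_real_nonneg_le_iff dual_order.antisym order_refl)

lemma cartan_arg_chyp_of: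
  assumes "hpositive X" "hpositive Y" "hpositive Z"
  shows "cartan_arg (chyp_of X) (chyp_of Y) (chyp_of Z) = Arg (hform X Y * hform Y Z * hform Z X)"
  using assms by (simp add: cartan_arg.abs_eq hline_rel_refl)

lemma hform_nonzero:
  assumes "hpositive X" "hpositive Y"
  shows "hform X Y \<noteq> 0"
  using hform_reverse_cauchy_schwarz(1)[OF assms] assms
  by (auto simp: hpositive_def mult_le_0_iff)

lemma chyp_of_tendsto:
  assumes "(S \<longlongrightarrow> X) F" "hpositive X"
  shows "((\<lambda>i. chyp_of (S i)) \<longlongrightarrow> chyp_of X) F" and "eventually (\<lambda>i. hpositive (S i)) F"
proof -
  have l: "((\<lambda>i. hform (S i) (S i)) \<longlongrightarrow> hform X X) F" "((\<lambda>i. hform (S i) X) \<longlongrightarrow> hform X X) F"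
    using assms by (auto intro!: tendsto_hform)
  have p: "Re (hform X X) > 0" using assms by (simp add: hpositive_def)
  show ev: "eventually (\<lambda>i. hpositive (S i)) F"
    unfolding hpositive_def using order_tendstoD(1)[OF tendsto_Re[OF l(1)] p] .
  have "((\<lambda>i. hcosh (S i) X) \<longlongrightarrow> cmod (hform X X) / sqrt (Re (hform X X) * Re (hform X X))) F"
    unfolding hcosh_def using l p
    by (intro tendsto_divide tendsto_norm tendsto_real_sqrt tendsto_mult tendsto_Re tendsto_const) auto
  also have "cmod (hform X X) / sqrt (Re (hform X X) * Re (hform X X)) = 1"
    using p hform_self[of X] by (metis abs_of_pos divide_self_if less_numeral_extra(3) norm_of_real
        real_sqrt_abs2)
  finally have "((\<lambda>i. hcosh (S i) X) \<longlongrightarrow> 1) F" .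
  \<comment> \<open>The limit 1 is the endpoint of this domain, so the composition also needs that
    the values eventually lie in \<open>{1..}\<close>.\<close>
  moreover have "continuous_on {1..} (arcosh :: real \<Rightarrow> real)"
    by (intro continuous_intros) auto
  moreover have "\<forall>\<^sub>F i in F. hcosh (S i) X \<in> {1..}"
    using ev by eventually_elim (simp add: assms(2) hcosh_ge_1)
  ultimately have "((\<lambda>i. arcosh (hcosh (S i) X)) \<longlongrightarrow> arcosh 1) F"
    using continuous_on_tendsto_compose[of "{1..}" arcosh "\<lambda>i. hcosh (S i) X" 1 F] by simp
  moreover have "\<forall>\<^sub>F i in F. arcosh (hcosh (S i) X) = dist (chyp_of (S i)) (chyp_of X)"
    using ev by eventually_elim (use assms in \<open>simp add: dist_chyp_of\<close>)
  ultimately have "((\<lambda>i. dist (chyp_of (S i)) (chyp_of X)) \<longlongrightarrow> arcosh 1) F"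
    by (rule Lim_transform_eventually)
  then show "((\<lambda>i. chyp_of (S i)) \<longlongrightarrow> chyp_of X) F"
    by (subst tendsto_dist_iff) simp
qed


section \<open>Semilinear maps and isometries\<close>

text \<open>The companion \<open>s\<close> covers unitary and anti-unitary maps together. Both kinds
  induce isometries, and by \<open>Isom_hsemilinear\<close> there are no others.\<close>

definition hsemilinear ::
    "(complex \<Rightarrow> complex) \<Rightarrow> (complex \<times> 'h::complex_hilbert \<Rightarrow> complex \<times> 'h) \<Rightarrow> bool"
  where "hsemilinear s T \<longleftrightarrow> (s = id \<or> s = cnj) \<and> (\<forall>X Y. T (X + Y) = T X + T Y) \<and>
    (\<forall>c X. T (c *\<^sub>C X) = s c *\<^sub>C T X) \<and> (\<forall>X Y. hform (T X) (T Y) = s (hform X Y)) \<and> bij T"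

lemma hsemilinearD:
  assumes "hsemilinear s T"
  shows "s = id \<or> s = cnj" "T (X + Y) = T X + T Y" "T (c *\<^sub>C X) = s c *\<^sub>C T X"
    "hform (T X) (T Y) = s (hform X Y)" "bij T" "Re (s c) = Re c" "cmod (s c) = cmod c" "s (s c) = c"
    "s c = 0 \<longleftrightarrow> c = 0"
  using assms unfolding hsemilinear_def by (auto simp del: split_paired_All)

lemma hsemilinear_compose:
  assumes "hsemilinear s T" "hsemilinear s' T'"
  shows "hsemilinear (s \<circ> s') (T \<circ> T')"
proof -
  have "s \<circ> s' = id \<or> s \<circ> s' = cnj"
    using hsemilinearD(1)[OF assms(1)] hsemilinearD(1)[OF assms(2)] by (auto simp: fun_eq_iff)
  then show ?thesis
    using assms by (simp add: hsemilinear_def bij_comp del: split_paired_All)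
qed

lemma hsemilinear_inv:
  assumes T: "hsemilinear s T"
  shows "hsemilinear s (inv_into UNIV T)"
proof -
  note D = hsemilinearD[OF T]
  have 1: "T (inv_into UNIV T X) = X" for X using D(5) by (simp add: bij_is_surj surj_f_inv_f)
  have i: "X = Y" if "T X = T Y" for X Y using that D(5) by (simp add: bij_is_inj inj_eq)
  have "inv_into UNIV T (X + Y) = inv_into UNIV T X + inv_into UNIV T Y" for X Y
    by (rule i) (simp add: 1 D(2))
  moreover have "inv_into UNIV T (c *\<^sub>C X) = s c *\<^sub>C inv_into UNIV T X" for c X
    by (rule i) (simp add: 1 D(3) D(8))
  moreover have "hform (inv_into UNIV T X) (inv_into UNIV T Y) = s (hform X Y)" for X Y
    using D(4)[of "inv_into UNIV T X" "inv_into UNIV T Y"] 1 D(8) by metis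
  ultimately show ?thesis
    using D(1,5) by (simp add: hsemilinear_def bij_imp_bij_inv)
qed

lemma hsemilinear_hpositive:
  assumes "hsemilinear s T"
  shows "hpositive (T X) \<longleftrightarrow> hpositive X"
  using hsemilinearD(4,6)[OF assms] by (simp add: hpositive_def)

text \<open>Boundedness comes from the form alone: \<open>norm_le_hform\<close> at the positive
  vector \<open>T (1, 0)\<close> bounds \<open>T X\<close> by form values whose moduli are those of
  \<open>X\<close> and \<open>(1, 0)\<close>.\<close>

lemma hsemilinear_bounded:
  assumes T: "hsemilinear s (T :: complex \<times> 'h::complex_hilbert \<Rightarrow> complex \<times> 'h)"
  shows "bounded_linear T"
proof -
  note D = hsemilinearD[OF T]
  have r: "s (complex_of_real r) = complex_of_real r" for r using D(1) by auto
  obtain C where C: "C > 0"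
    "\<And>X. (norm X)\<^sup>2 \<le> C * ((cmod (hform (T (1, 0)) X))\<^sup>2 + \<bar>Re (hform X X)\<bar>)"
    using norm_le_hform[of "T (1, 0)"] hsemilinear_hpositive[OF T] hpositive_base by metis
  have "norm (T X) \<le> norm X * sqrt (C * 6)" for X
  proof -
    have "norm ((1::complex), (0::'h)) = 1" by (simp add: norm_prod_def)
    then have "cmod (hform (1, 0) X) \<le> 2 * norm X"
      using norm_hform_le[of "(1, 0)" X] by simp
    then have "(cmod (hform (1, 0) X))\<^sup>2 \<le> (2 * norm X)\<^sup>2"
      by (intro power_mono) auto
    moreover have "\<bar>Re (hform X X)\<bar> \<le> 2 * (norm X * norm X)"
      using abs_Re_le_cmod norm_hform_le order_trans by blast
    ultimately have "(cmod (hform (1, 0) X))\<^sup>2 + \<bar>Re (hform X X)\<bar> \<le> 6 * (norm X)\<^sup>2"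
      by (simp add: power2_eq_square)
    then have "C * ((cmod (hform (1, 0) X))\<^sup>2 + \<bar>Re (hform X X)\<bar>) \<le> C * (6 * (norm X)\<^sup>2)"
      using C(1) by (intro mult_left_mono) auto
    then have "(norm (T X))\<^sup>2 \<le> C * 6 * (norm X)\<^sup>2"
      using C(2)[of "T X"] by (simp add: D(4,6,7))
    then have "(norm (T X))\<^sup>2 \<le> (norm X * sqrt (C * 6))\<^sup>2"
      using C(1) by (simp add: power_mult_distrib mult.commute)
    then show ?thesis by (rule power2_le_imp_le) (use C(1) in auto)
  qed
  then show ?thesis
    by (intro bounded_linear_intro[where K = "sqrt (C * 6)"])
      (simp_all add: D(2) scaleR_prod_scaleC D(3) r)
qed

text \<open>The choice of a representative is harmless for semilinear \<open>T\<close>, see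
  \<open>act_chyp_of\<close>.\<close>

definition act :: "(complex \<times> 'h::complex_hilbert \<Rightarrow> complex \<times> 'h) \<Rightarrow> 'h chyp \<Rightarrow> 'h chyp"
  where "act T x = chyp_of (T (SOME X. hpositive X \<and> chyp_of X = x))"

lemma act_chyp_of:
  assumes T: "hsemilinear s T" and X: "hpositive X"
  shows "act T (chyp_of X) = chyp_of (T X)"
proof -
  define Y where "Y = (SOME Y. hpositive Y \<and> chyp_of Y = chyp_of X)"
  have "hpositive Y \<and> chyp_of Y = chyp_of X"
    unfolding Y_def by (rule someI[of _ X]) (use X in simp)
  then obtain c where "c \<noteq> 0" "Y = c *\<^sub>C X" "hpositive Y"
    using chyp_of_eq_iff[of X Y] X by auto
  then have "chyp_of (T Y) = chyp_of (T X)"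
    using hsemilinearD[OF T] hsemilinear_hpositive[OF T] X by (simp add: chyp_of_scaleC)
  then show ?thesis by (simp add: act_def Y_def)
qed

lemma hcosh_hsemilinear:
  assumes T: "hsemilinear s T"
  shows "hcosh (T X) (T Y) = hcosh X Y"
  using hsemilinearD[OF T] by (simp add: hcosh_def)

lemma in_Isom_iff: "g \<in> carrier Isom \<longleftrightarrow> bij g \<and> (\<forall>x y. dist (g x) (g y) = dist x y)"
  by (simp add: Isom_def)

lemma Isom_mult [simp]: "g \<otimes>\<^bsub>Isom\<^esub> h = g \<circ> h"
  by (simp add: Isom_def)

lemma Isom_one [simp]: "\<one>\<^bsub>Isom\<^esub> = id"
  by (simp add: Isom_def)

lemma Isom_compose: "g \<in> carrier Isom \<Longrightarrow> h \<in> carrier Isom \<Longrightarrow> g \<circ> h \<in> carrier Isom"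
  by (simp add: in_Isom_iff bij_comp)

lemma Isom_inv_into:
  assumes "g \<in> carrier Isom"
  shows "inv_into UNIV g \<in> carrier Isom"
    and "g (inv_into UNIV g x) = x" and "inv_into UNIV g (g x) = x"
proof -
  have b: "bij g" and d: "dist (g x) (g y) = dist x y" for x y
    using assms by (simp_all add: in_Isom_iff)
  show 1: "g (inv_into UNIV g x) = x" for x using b by (simp add: bij_is_surj surj_f_inv_f)
  show "inv_into UNIV g (g x) = x" using b by (simp add: bij_is_inj)
  show "inv_into UNIV g \<in> carrier Isom"
    using b d[of "inv_into UNIV g _" "inv_into UNIV g _"] 1 by (simp add: in_Isom_iff bij_imp_bij_inv)
qed

lemma act_in_Isom:
  assumes T: "hsemilinear s T"
  shows "act T \<in> carrier Isom"
proof -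
  have d: "dist (act T x) (act T y) = dist x y" for x y
    by (rule chyp_cases[of x], rule chyp_cases[of y])
      (simp add: act_chyp_of[OF T] dist_chyp_of hsemilinear_hpositive[OF T] hcosh_hsemilinear[OF T])
  have "inj (act T)" by (rule injI) (metis d dist_eq_0_iff)
  moreover have "surj (act T)"
  proof (rule surjI)
    fix x
    note T' = hsemilinear_inv[OF T]
    show "act T (act (inv_into UNIV T) x) = x"
      by (rule chyp_cases[of x])
        (simp add: act_chyp_of[OF T] act_chyp_of[OF T'] hsemilinear_hpositive[OF T']
          surj_f_inv_f[OF bij_is_surj[OF hsemilinearD(5)[OF T]]])
  qed
  ultimately show ?thesis using d by (simp add: in_Isom_iff bij_def)
qed

lemma act_compose:
  assumes T: "hsemilinear s T" and T': "hsemilinear s' T'"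
  shows "act (T \<circ> T') = act T \<circ> act T'"
proof
  fix x
  show "act (T \<circ> T') x = (act T \<circ> act T') x"
    by (rule chyp_cases[of x])
      (simp add: act_chyp_of[OF T] act_chyp_of[OF T'] act_chyp_of[OF hsemilinear_compose[OF T T']]
        hsemilinear_hpositive[OF T'])
qed

text \<open>After projection along \<open>Y\<close> the triple product is a positive number plus an
  error. Cauchy-Schwarz on the negative definite complement of \<open>Y\<close> makes the error
  strictly smaller. This is why Cartan arguments stay inside the open interval from
  \<open>- pi / 2\<close> to \<open>pi / 2\<close>.\<close>

lemma Re_triple_pos:
  assumes X: "hpositive X" and Y: "hpositive Y" and Z: "hpositive Z"
  shows "Re (hform X Y * hform Y Z * hform Z X) > 0"
proof -
  define q where "q V = Re (hform V V)" for V :: "complex \<times> 'a"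
  define w where "w V = V + (- (hform Y V / hform Y Y)) *\<^sub>C Y" for V
  have p: "q X > 0" "q Y > 0" "q Z > 0" using assms by (simp_all add: q_def hpositive_def)
  have o: "hform Y (w V) = 0" for V
    unfolding w_def using hform_projection(1)[of Y V] p by (simp add: q_def)
  have f: "hform (w V) (w W) = hform V W - cnj (hform Y V) * hform Y W / q Y" for V W
    unfolding w_def using hform_projection(2)[of Y V W] p by (simp add: q_def)
  have n0: "hform X Y \<noteq> 0" "hform Y Z \<noteq> 0" using hform_nonzero assms by blast+
  have sq: "cnj z * z = complex_of_real ((cmod z)\<^sup>2)" for z
    by (simp add: complex_norm_square mult.commute del: of_real_power)
  have qw: "- q (w V) < (cmod (hform Y V))\<^sup>2 / q Y" "q (w V) \<le> 0" if "q V > 0" for V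
  proof -
    have "hform (w V) (w V) = hform V V - complex_of_real ((cmod (hform Y V))\<^sup>2 / q Y)"
      by (simp add: f sq)
    then have "q (w V) = q V - (cmod (hform Y V))\<^sup>2 / q Y" by (simp add: q_def)
    then show "- q (w V) < (cmod (hform Y V))\<^sup>2 / q Y" using that by simp
    show "q (w V) \<le> 0" using hform_orthogonal_neg[OF Y o, of V] by (cases "w V = 0") (auto simp: q_def)
  qed
  have "(cmod (hform (w Z) (w X)))\<^sup>2 \<le> (- q (w Z)) * (- q (w X))"
    using hform_orthogonal_cauchy_schwarz[OF Y o o] by (simp add: q_def)
  also have "\<dots> < (cmod (hform Y Z))\<^sup>2 / q Y * ((cmod (hform Y X))\<^sup>2 / q Y)"
    using qw[OF p(3)] qw[OF p(1)] by (intro mult_strict_mono) (auto intro: mult_strict_mono)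
  also have "\<dots> = (cmod (hform Y Z) * cmod (hform X Y) / q Y)\<^sup>2"
    by (simp add: power2_eq_square norm_hform_commute[of Y X])
  finally have lt: "cmod (hform (w Z) (w X)) < cmod (hform Y Z) * cmod (hform X Y) / q Y"
    by (rule power_less_imp_less_base) (use p in auto)
  have "hform X Y * hform Y Z * hform Z X
      = complex_of_real ((cmod (hform X Y))\<^sup>2 * (cmod (hform Y Z))\<^sup>2 / q Y)
        + hform X Y * hform Y Z * hform (w Z) (w X)"
  proof -
    have "hform Z X = cnj (hform Y Z) * cnj (hform X Y) / q Y + hform (w Z) (w X)"
      using f[of Z X] hform_commute[of Y X] by simp
    then show ?thesis
      by (simp add: distrib_left complex_norm_square mult_ac del: of_real_power)
  qed
  moreover have "cmod (hform X Y * hform Y Z * hform (w Z) (w X))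
      < (cmod (hform X Y))\<^sup>2 * (cmod (hform Y Z))\<^sup>2 / q Y"
    using mult_strict_left_mono[OF lt, of "cmod (hform X Y) * cmod (hform Y Z)"] n0
    by (simp add: norm_mult power2_eq_square mult_ac)
  ultimately show ?thesis
    using abs_Re_le_cmod[of "hform X Y * hform Y Z * hform (w Z) (w X)"] by simp
qed

lemma abs_Arg_less_pi_half: "Re z > 0 \<Longrightarrow> \<bar>Arg z\<bar> < pi / 2"
  using Arg_Re_pos[of z] by (simp add: abs_less_iff)


section \<open>Complex reflections and midpoints\<close>

text \<open>For non-isotropic \<open>w\<close> this multiplies \<open>w\<close> by \<open>a\<close>
  and fixes its orthogonal complement pointwise.\<close>

definition crefl :: "complex \<times> 'h::complex_hilbert \<Rightarrow> complex \<Rightarrow> complex \<times> 'h \<Rightarrow> complex \<times> 'h"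
  where "crefl w a X = X + ((a - 1) * hform w X / hform w w) *\<^sub>C w"

lemma crefl_crefl:
  assumes "hform w w \<noteq> 0"
  shows "crefl w a (crefl w b X) = crefl w (a * b) X"
proof -
  have "hform w (crefl w b X) = b * hform w X"
    using assms by (simp add: crefl_def hform_add_right hform_scaleC_right field_simps)
  then have "crefl w a (crefl w b X)
      = X + (((b - 1) * hform w X / hform w w) *\<^sub>C w + ((a - 1) * (b * hform w X) / hform w w) *\<^sub>C w)"
    by (simp add: crefl_def[of w a] crefl_def[of w b] add.assoc)
  also have "\<dots> = crefl w (a * b) X"
    using assms by (simp add: crefl_def scaleC_add_left[symmetric] add_divide_distrib[symmetric] algebra_simps)
  finally show ?thesis .
qed

lemma hsemilinear_crefl:
  assumes w: "hform w w \<noteq> 0" and a: "cmod a = 1"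
  shows "hsemilinear id (crefl w a)"
proof -
  have aa: "cnj a * a = 1" using a complex_norm_square[of a] by (simp add: mult.commute)
  have real: "cnj (hform w w) = hform w w" using hform_commute[of w w] by simp
  have "crefl w a \<circ> crefl w (cnj a) = id" "crefl w (cnj a) \<circ> crefl w a = id"
    using aa by (auto simp: fun_eq_iff crefl_crefl[OF w] mult.commute[of a]) (simp_all add: crefl_def)
  then have "bij (crefl w a)" using o_bij by blast
  moreover have "crefl w a (X + Y) = crefl w a X + crefl w a Y" for X Y
    by (simp add: crefl_def hform_add_right scaleC_add_left add_divide_distrib distrib_left)
  moreover have "crefl w a (c *\<^sub>C X) = c *\<^sub>C crefl w a X" for c X
    by (simp add: crefl_def hform_scaleC_right scaleC_add_right scaleC_scaleC mult_ac)
  moreover have "hform (crefl w a X) (crefl w a Y) = hform X Y" for X Y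
  proof -
    define p r q where "p = hform w X" and "r = hform w Y" and "q = hform w w"
    have "hform X w = cnj p" using hform_commute[of X w] by (simp add: p_def)
    then have "hform (X + \<alpha> *\<^sub>C w) (Y + \<beta> *\<^sub>C w)
        = hform X Y + \<beta> * cnj p + cnj \<alpha> * r + cnj \<alpha> * \<beta> * q" for \<alpha> \<beta>
      by (simp add: hform_add_right hform_add_left hform_scaleC_left hform_scaleC_right
        p_def r_def q_def algebra_simps)
    then have "hform (crefl w a X) (crefl w a Y) = hform X Y + (a - 1) * r / q * cnj p
        + cnj ((a - 1) * p / q) * r + cnj ((a - 1) * p / q) * ((a - 1) * r / q) * q"
      unfolding crefl_def p_def[symmetric] r_def[symmetric] q_def[symmetric] .
    also have "cnj ((a - 1) * p / q) = (cnj a - 1) * cnj p / q"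
      using real by (simp add: q_def)
    also have "hform X Y + (a - 1) * r / q * cnj p + (cnj a - 1) * cnj p / q * r
        + (cnj a - 1) * cnj p / q * ((a - 1) * r / q) * q = hform X Y + (cnj a * a - 1) * r * cnj p / q"
      using w unfolding q_def[symmetric] by (simp add: field_simps)
    finally show ?thesis using aa by simp
  qed
  ultimately show ?thesis by (simp add: hsemilinear_def del: split_paired_All)
qed

lemma hsemilinear_id: "hsemilinear id id"
  by (simp add: hsemilinear_def)

text \<open>
  Squares of semilinear maps suffice for transitivity. This is why representations can be used
  without knowing which of their values are holomorphic: the square of any isometry is.
\<close>
lemma square_maps_to:
  assumes n: "hform X X = hform X' X'" and ne: "X \<noteq> X' \<Longrightarrow> hform (X - X') (X - X') \<noteq> 0"
  obtains S where "hsemilinear id S" "S (S X) = X'"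
    "\<And>Z. hform (X - X') Z = 0 \<Longrightarrow> S (S Z) = Z"
proof (cases "X = X'")
  case True
  then show ?thesis using that[of id] hsemilinear_id by simp
next
  case False
  define w where "w = X - X'"
  define p where "p = hform w X"
  \<comment> \<open>This is the solution of \<open>crefl w a X = X'\<close>, which asks for
    \<open>(a - 1) * p / hform w w = - 1\<close>. It has modulus one because \<open>X\<close> and
    \<open>X'\<close> have equal self-products; a square root of it gives the map
    \<open>S\<close>.\<close>
  define a where "a = 1 - hform w w / p"
  have ww: "hform w w \<noteq> 0" using False ne by (simp add: w_def)
  have wX': "hform w X' = - cnj p"
    using n hform_commute[of X X'] hform_commute[of X X] hform_commute[of X' X']
    by (simp add: w_def p_def hform_diff_left)
  have e: "hform w w = p + cnj p"
    using wX' hform_diff_right[of w X X'] by (simp add: p_def w_def)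
  then have p: "p \<noteq> 0" using ww by auto
  have a: "a = - cnj p / p" using p by (simp add: a_def e add_divide_distrib)
  then have "cmod a = 1" using p by (simp add: norm_divide)
  then have s: "cmod (csqrt a) = 1" by simp
  show ?thesis
  proof (rule that[of "crefl w (csqrt a)"])
    show "hsemilinear id (crefl w (csqrt a))" by (rule hsemilinear_crefl[OF ww s])
    have sq: "csqrt a * csqrt a = a" by (simp add: power2_eq_square[symmetric])
    have "(a - 1) * p / hform w w = - 1" using p ww by (simp add: a_def)
    then show "crefl w (csqrt a) (crefl w (csqrt a) X) = X'"
      by (simp add: crefl_crefl[OF ww] sq) (simp add: crefl_def p_def[symmetric] scaleC_minus_left, simp add: w_def)
    show "crefl w (csqrt a) (crefl w (csqrt a) Z) = Z" if "hform (X - X') Z = 0" for Z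
      using that by (simp add: crefl_crefl[OF ww] sq) (simp add: crefl_def w_def)
  qed
qed

text \<open>The vectors are put in place one at a time. Each new difference is orthogonal to the
  vectors already placed, so the reflection along it fixes them; being orthogonal to a positive
  vector, it is non-isotropic unless it vanishes.\<close>

lemma gram_transitive_vectors:
  assumes pos: "hpositive X" and Y: "hpositive Y" and Z: "hpositive Z"
    and g: "hform X' X' = hform X X" "hform Y' Y' = hform Y Y" "hform Z' Z' = hform Z Z"
      "hform X' Y' = hform X Y" "hform X' Z' = hform X Z" "hform Y' Z' = hform Y Z"
  obtains A B C \<omega> where "hsemilinear id A" "hsemilinear id B" "hsemilinear id C" "cmod \<omega> = 1"
    "C (C (B (B (A (A X))))) = \<omega> *\<^sub>C X'" "C (C (B (B (A (A Y))))) = \<omega> *\<^sub>C Y'"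
    "C (C (B (B (A (A Z))))) = \<omega> *\<^sub>C Z'"
proof -
  have pos': "hpositive X'" using pos g by (simp add: hpositive_def)
  \<comment> \<open>Nothing is placed yet at the first move, so \<open>X - X'\<close> may be
    isotropic. Turning the target by \<open>\<omega>\<close> makes the product with \<open>X\<close>
    positive; if the new difference were isotropic, it would be orthogonal to \<open>X\<close> and
    hence zero.\<close>
  define \<omega> where "\<omega> = cmod (hform X X') / hform X X'"
  have nz: "hform X X' \<noteq> 0" using hform_nonzero[OF pos pos'] .
  have \<omega>: "cmod \<omega> = 1" "cnj \<omega> * \<omega> = 1" "\<omega> \<noteq> 0"
    using nz complex_norm_square[of \<omega>] by (auto simp: \<omega>_def norm_divide mult.commute)
  define X1 Y1 Z1 where "X1 = \<omega> *\<^sub>C X'" and "Y1 = \<omega> *\<^sub>C Y'" and "Z1 = \<omega> *\<^sub>C Z'"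
  have h1: "hform (\<omega> *\<^sub>C U) (\<omega> *\<^sub>C V) = hform U V" for U V
    using \<omega>(2) by (simp add: hform_scaleC_left hform_scaleC_right mult.assoc[symmetric] mult.commute[of \<omega> "cnj \<omega>"])
  have g1: "hform X1 X1 = hform X X" "hform Y1 Y1 = hform Y Y" "hform Z1 Z1 = hform Z Z"
      "hform X1 Y1 = hform X Y" "hform X1 Z1 = hform X Z" "hform Y1 Z1 = hform Y Z"
    by (simp_all only: X1_def Y1_def Z1_def h1 g)
  have X1pos: "hpositive X1" using g1(1) pos by (simp add: hpositive_def)
  have XX1: "hform X X1 = cmod (hform X X')"
    using nz by (simp add: X1_def hform_scaleC_right \<omega>_def)
  obtain A where A: "hsemilinear id A" "A (A X) = X1"
  proof (rule square_maps_to[of X X1])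
    show "hform X X = hform X1 X1" using g1 by simp
    show "hform (X - X1) (X - X1) \<noteq> 0" if "X \<noteq> X1"
    proof
      assume 0: "hform (X - X1) (X - X1) = 0"
      have sym: "hform X1 X = hform X X1" using hform_commute[of X1 X] XX1 by simp
      have "2 * hform X X = 2 * hform X X1"
        using 0 g1(1) by (simp add: hform_diff_left hform_diff_right sym)
      then have e: "hform X X = hform X X1" by simp
      have "hform X (X - X1) = 0" by (simp add: hform_diff_right e)
      then have "Re (hform (X - X1) (X - X1)) < 0"
        using hform_orthogonal_neg[OF pos] that by simp
      with 0 show False by simp
    qed
  qed blast
  define Y2 Z2 where "Y2 = A (A Y)" and "Z2 = A (A Z)"
  have fA: "hform (A (A U)) (A (A V)) = hform U V" for U V using hsemilinearD(4)[OF A(1)] by simp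
  have g2: "hform Y2 Y2 = hform Y Y" "hform Z2 Z2 = hform Z Z"
      "hform X1 Y2 = hform X Y" "hform X1 Z2 = hform X Z" "hform Y2 Z2 = hform Y Z"
    using fA by (simp_all add: Y2_def Z2_def A(2)[symmetric])
  have oY: "hform X1 (Y2 - Y1) = 0" using g1 g2 by (simp add: hform_diff_right)
  obtain B where B: "hsemilinear id B" "B (B Y2) = Y1" "B (B X1) = X1"
  proof (rule square_maps_to[of Y2 Y1])
    show "hform Y2 Y2 = hform Y1 Y1" using g1 g2 by simp
    show "hform (Y2 - Y1) (Y2 - Y1) \<noteq> 0" if "Y2 \<noteq> Y1"
      using hform_orthogonal_neg[OF X1pos oY] that by auto
    have "hform (Y2 - Y1) X1 = 0" using oY hform_commute[of "Y2 - Y1" X1] by simp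
    then show thesis if "hsemilinear id S" "S (S Y2) = Y1" "\<And>Z. hform (Y2 - Y1) Z = 0 \<Longrightarrow> S (S Z) = Z" for S
      using that \<open>\<And>B. \<lbrakk>hsemilinear id B; B (B Y2) = Y1; B (B X1) = X1\<rbrakk> \<Longrightarrow> thesis\<close> by blast
  qed
  define Z3 where "Z3 = B (B Z2)"
  have fB: "hform (B (B U)) (B (B V)) = hform U V" for U V using hsemilinearD(4)[OF B(1)] by simp
  have g3: "hform Z3 Z3 = hform Z Z" "hform X1 Z3 = hform X Z" "hform Y1 Z3 = hform Y Z"
    using fB[of Z2 Z2] fB[of X1 Z2] fB[of Y2 Z2] g2 B by (simp_all add: Z3_def)
  have oX: "hform X1 (Z3 - Z1) = 0" and oY1: "hform Y1 (Z3 - Z1) = 0"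
    using g1 g3 by (simp_all add: hform_diff_right)
  obtain C where C: "hsemilinear id C" "C (C Z3) = Z1" "C (C X1) = X1" "C (C Y1) = Y1"
  proof (rule square_maps_to[of Z3 Z1])
    show "hform Z3 Z3 = hform Z1 Z1" using g1 g3 by simp
    show "hform (Z3 - Z1) (Z3 - Z1) \<noteq> 0" if "Z3 \<noteq> Z1"
      using hform_orthogonal_neg[OF X1pos oX] that by auto
    have "hform (Z3 - Z1) X1 = 0" "hform (Z3 - Z1) Y1 = 0"
      using oX oY1 hform_commute[of "Z3 - Z1" X1] hform_commute[of "Z3 - Z1" Y1] by simp_all
    then show thesis if "hsemilinear id S" "S (S Z3) = Z1" "\<And>Z. hform (Z3 - Z1) Z = 0 \<Longrightarrow> S (S Z) = Z" for S
      using that \<open>\<And>B. \<lbrakk>hsemilinear id B; B (B Z3) = Z1; B (B X1) = X1; B (B Y1) = Y1\<rbrakk> \<Longrightarrow> thesis\<close> by blast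
  qed
  show ?thesis
    by (rule that[OF A(1) B(1) C(1) \<omega>(1)])
      (use A B C in \<open>simp_all add: X1_def[symmetric] Y1_def[symmetric] Z1_def[symmetric]
        Y2_def[symmetric] Z2_def[symmetric] Z3_def[symmetric]\<close>)
qed

lemma gram_transitive:
  assumes pos: "hpositive X" "hpositive Y" "hpositive Z"
    and g: "hform X' X' = hform X X" "hform Y' Y' = hform Y Y" "hform Z' Z' = hform Z Z"
      "hform X' Y' = hform X Y" "hform X' Z' = hform X Z" "hform Y' Z' = hform Y Z"
  obtains a b c where "a \<in> carrier Isom" "b \<in> carrier Isom" "c \<in> carrier Isom"
    "(c \<circ> c \<circ> b \<circ> b \<circ> a \<circ> a) (chyp_of X) = chyp_of X'"
    "(c \<circ> c \<circ> b \<circ> b \<circ> a \<circ> a) (chyp_of Y) = chyp_of Y'"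
    "(c \<circ> c \<circ> b \<circ> b \<circ> a \<circ> a) (chyp_of Z) = chyp_of Z'"
proof -
  obtain A B C \<omega> where 1: "hsemilinear id A" "hsemilinear id B" "hsemilinear id C" "cmod \<omega> = 1"
    "C (C (B (B (A (A X))))) = \<omega> *\<^sub>C X'" "C (C (B (B (A (A Y))))) = \<omega> *\<^sub>C Y'"
    "C (C (B (B (A (A Z))))) = \<omega> *\<^sub>C Z'"
    using gram_transitive_vectors[OF assms] by metis
  have pos': "hpositive X'" "hpositive Y'" "hpositive Z'" using pos g by (simp_all add: hpositive_def)
  have \<omega>: "\<omega> \<noteq> 0" using 1(4) by auto
  have "(act C \<circ> act C \<circ> act B \<circ> act B \<circ> act A \<circ> act A) (chyp_of V)
      = chyp_of (C (C (B (B (A (A V))))))" if "hpositive V" for V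
    using that by (simp add: act_chyp_of[OF 1(1)] act_chyp_of[OF 1(2)] act_chyp_of[OF 1(3)]
        hsemilinear_hpositive[OF 1(1)] hsemilinear_hpositive[OF 1(2)] hsemilinear_hpositive[OF 1(3)])
  then show ?thesis
    using that[of "act A" "act B" "act C"] 1 pos pos' \<omega> act_in_Isom[OF 1(1)] act_in_Isom[OF 1(2)]
      act_in_Isom[OF 1(3)] by (simp add: chyp_of_scaleC)
qed

section \<open>Triple products and midpoints\<close>

definition triple :: "complex \<times> 'h::complex_hilbert \<Rightarrow> complex \<times> 'h \<Rightarrow> complex \<times> 'h \<Rightarrow> complex"
  where "triple X Y Z = hform X Y * hform Y Z * hform Z X"

text \<open>For unit vectors this represents the midpoint; the phase makes the products with both ends align.\<close>
definition mid :: "complex \<times> 'h::complex_hilbert \<Rightarrow> complex \<times> 'h \<Rightarrow> complex \<times> 'h"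
  where "mid X Y = X + (cmod (hform X Y) / hform X Y) *\<^sub>C Y"

text \<open>The fourth formula is the purpose: the distance from the midpoint to \<open>Z\<close>
  depends on the mutual distances and on the real part of the triple product, so that this real part
  becomes a metric quantity.\<close>

lemma hform_mid:
  assumes X: "hform X X = 1" and Y: "hform Y Y = 1"
  defines "C \<equiv> cmod (hform X Y)"
  shows "hform (mid X Y) (mid X Y) = complex_of_real (2 + 2 * C)"
    and "cmod (hform X (mid X Y)) = 1 + C" and "cmod (hform Y (mid X Y)) = 1 + C"
    and "(cmod (hform (mid X Y) Z))\<^sup>2
      = (cmod (hform X Z))\<^sup>2 + (cmod (hform Y Z))\<^sup>2 + 2 * Re (triple X Y Z) / C"
    and "hpositive (mid X Y)" and "C \<ge> 1"
proof -
  have p: "hpositive X" "hpositive Y" using X Y by (simp_all add: hpositive_def)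
  then have nz: "hform X Y \<noteq> 0" using hform_nonzero by blast
  define \<omega> where "\<omega> = C / hform X Y"
  have C: "C > 0" "\<omega> * hform X Y = C" using nz by (simp_all add: C_def \<omega>_def)
  have "cmod \<omega> = 1" using nz by (simp add: \<omega>_def C_def norm_divide)
  then have \<omega>: "cmod \<omega> = 1" "cnj \<omega> * \<omega> = 1"
    using complex_norm_square[of \<omega>] by (auto simp: mult.commute)
  have m: "mid X Y = X + \<omega> *\<^sub>C Y" by (simp add: mid_def \<omega>_def C_def)
  have XY: "hform X Y = C * cnj \<omega>"
    using C(2) \<omega>(2) by (metis mult.assoc mult.commute mult_1)
  then have YX: "hform Y X = C * \<omega>" using hform_commute[of Y X] by simp
  show 1: "hform (mid X Y) (mid X Y) = complex_of_real (2 + 2 * C)"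
    using \<omega>(2) by (simp add: m hform_add_left hform_add_right hform_scaleC_left hform_scaleC_right
      X Y XY YX algebra_simps)
  then show "hpositive (mid X Y)" using C(1) by (simp add: hpositive_def)
  have "hform X (mid X Y) = complex_of_real (1 + C)"
    using \<omega>(2) by (simp add: m hform_add_right hform_scaleC_right X XY algebra_simps)
  then show "cmod (hform X (mid X Y)) = 1 + C" using C(1) by (simp del: of_real_add)
  have "hform Y (mid X Y) = \<omega> * complex_of_real (1 + C)"
    by (simp add: m hform_add_right hform_scaleC_right Y YX algebra_simps)
  then show "cmod (hform Y (mid X Y)) = 1 + C" using C(1) \<omega>(1) by (simp add: norm_mult del: of_real_add)
  have "1 \<le> hcosh X Y" using hcosh_ge_1 p by blast
  then show "C \<ge> 1" by (simp add: hcosh_def X Y C_def)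
  have "(cmod (u + cnj \<omega> * v))\<^sup>2 = (cmod u)\<^sup>2 + (cmod v)\<^sup>2 + 2 * Re (cnj u * (cnj \<omega> * v))" for u v
  proof -
    have "(cmod (u + cnj \<omega> * v))\<^sup>2 = (cmod u)\<^sup>2 + (cmod (cnj \<omega> * v))\<^sup>2 + 2 * Re (cnj u * (cnj \<omega> * v))"
      unfolding cmod_power2 by (simp add: algebra_simps power2_eq_square)
    then show ?thesis using \<omega>(1) by (simp add: norm_mult)
  qed
  note this[of "hform X Z" "hform Y Z"]
  moreover have "cnj (hform X Z) * (cnj \<omega> * hform Y Z) = triple X Y Z / C"
    using C(1) hform_commute[of Z X] by (simp add: triple_def XY mult_ac)
  ultimately show "(cmod (hform (mid X Y) Z))\<^sup>2
      = (cmod (hform X Z))\<^sup>2 + (cmod (hform Y Z))\<^sup>2 + 2 * Re (triple X Y Z) / C"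
    by (simp add: m hform_add_left hform_scaleC_left)
qed

text \<open>The triangle inequality in the complex plane, applied to \<open>hform N M\<close> with
  \<open>M\<close> expanded in \<open>X\<close> and \<open>Y\<close>, gives
  \<open>hcosh N M \<le> 1\<close>. So midpoints are determined by distances and every isometry
  preserves them.\<close>

lemma chyp_of_mid_unique:
  assumes X: "hform X X = 1" and Y: "hform Y Y = 1" and N: "hpositive N"
    and "hcosh N X = hcosh (mid X Y) X" and "hcosh N Y = hcosh (mid X Y) Y"
  shows "chyp_of N = chyp_of (mid X Y)"
proof -
  define C where "C = cmod (hform X Y)"
  define M where "M = mid X Y"
  define n where "n = sqrt (Re (hform N N))"
  have n: "n > 0" using N by (simp add: n_def hpositive_def)
  note m = hform_mid[OF X Y, folded C_def M_def]
  have mX: "hcosh M X = (1 + C) / sqrt (2 + 2 * C)" "hcosh M Y = (1 + C) / sqrt (2 + 2 * C)"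
    using m by (simp_all add: hcosh_def X Y norm_hform_commute[of M])
  have NX: "cmod (hform N X) = n * ((1 + C) / sqrt (2 + 2 * C))"
    "cmod (hform N Y) = n * ((1 + C) / sqrt (2 + 2 * C))"
    using assms(4,5) mX n by (simp_all add: M_def[symmetric]) (simp_all add: hcosh_def X Y n_def field_simps)
  have "M = X + (C / hform X Y) *\<^sub>C Y" by (simp add: M_def mid_def C_def)
  then have "hform N M = hform N X + (C / hform X Y) * hform N Y"
    by (simp add: hform_add_right hform_scaleC_right)
  then have "cmod (hform N M) \<le> cmod (hform N X) + cmod (C / hform X Y) * cmod (hform N Y)"
    by (metis norm_mult norm_triangle_ineq)
  also have "cmod (C / hform X Y) = 1" using m(6) by (auto simp: C_def norm_divide)
  finally have "cmod (hform N M) \<le> n * ((2 + 2 * C) / sqrt (2 + 2 * C))"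
    by (simp add: NX add_divide_distrib[symmetric] algebra_simps)
  also have "(2 + 2 * C) / sqrt (2 + 2 * C) = sqrt (2 + 2 * C)" using m(6) by (simp add: real_div_sqrt)
  finally have "hcosh N M \<le> 1"
    using n m(1,6) by (simp add: hcosh_def real_sqrt_mult n_def)
  then have "hcosh N M = 1" using hcosh_ge_1[OF N m(5)] by simp
  then have "dist (chyp_of N) (chyp_of M) = 0"
    using dist_chyp_of[OF N m(5)] by simp
  then show ?thesis by (simp add: M_def)
qed

text \<open>The real part is the most that can be invariant, since an anti-holomorphic isometry
  conjugates the triple product.\<close>

lemma Re_triple_isometry_unit:
  assumes g: "g \<in> carrier Isom"
    and u: "hform X X = 1" "hform Y Y = 1" "hform Z Z = 1" "hform X' X' = 1" "hform Y' Y' = 1" "hform Z' Z' = 1"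
    and gX: "g (chyp_of X) = chyp_of X'" "g (chyp_of Y) = chyp_of Y'" "g (chyp_of Z) = chyp_of Z'"
  shows "Re (triple X' Y' Z') = Re (triple X Y Z)"
proof -
  have p: "hpositive X" "hpositive Y" "hpositive Z" "hpositive X'" "hpositive Y'" "hpositive Z'"
    using u by (simp_all add: hpositive_def)
  have gd: "dist (g x) (g y) = dist x y" for x y using g by (simp add: in_Isom_iff)
  have hc: "hcosh V' W' = hcosh V W" if "hpositive V" "hpositive W" "hpositive V'" "hpositive W'"
    "g (chyp_of V) = chyp_of V'" "g (chyp_of W) = chyp_of W'" for V W V' W'
    using gd[of "chyp_of V" "chyp_of W"] that by (metis cosh_dist_eq_hcosh)
  have hf: "cmod (hform X Y) = cmod (hform X' Y')" "cmod (hform X Z) = cmod (hform X' Z')"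
    "cmod (hform Y Z) = cmod (hform Y' Z')"
    using hc[of X Y X' Y'] hc[of X Z X' Z'] hc[of Y Z Y' Z'] p gX u by (simp_all add: hcosh_def)
  note m = hform_mid[OF u(1,2)] and m' = hform_mid[OF u(4,5)]
  obtain N where N: "hpositive N" "g (chyp_of (mid X Y)) = chyp_of N" by (metis chyp_cases)
  have "hcosh N X' = hcosh (mid X' Y') X'" "hcosh N Y' = hcosh (mid X' Y') Y'"
    using hc[of "mid X Y" X N X'] hc[of "mid X Y" Y N Y'] N p gX m m' u hf
    by (simp_all add: hcosh_def norm_hform_commute[of "mid _ _"])
  then have "g (chyp_of (mid X Y)) = chyp_of (mid X' Y')"
    using chyp_of_mid_unique[OF u(4,5) N(1)] N(2) by simp
  then have "hcosh (mid X' Y') Z' = hcosh (mid X Y) Z"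
    using hc[of "mid X Y" Z "mid X' Y'" Z'] p gX m m' by simp
  then have "cmod (hform (mid X' Y') Z') = cmod (hform (mid X Y) Z)"
    using m(1,6) m'(1,6) u hf by (simp add: hcosh_def)
  then have "(cmod (hform (mid X' Y') Z'))\<^sup>2 = (cmod (hform (mid X Y) Z))\<^sup>2" by simp
  then show ?thesis using m(4,6) m'(4,6) hf by auto
qed

lemma triple_scaleC:
  "triple (a *\<^sub>C X) (b *\<^sub>C Y) (c *\<^sub>C Z)
    = complex_of_real ((cmod a)\<^sup>2 * (cmod b)\<^sup>2 * (cmod c)\<^sup>2) * triple X Y Z"
proof -
  have "triple (a *\<^sub>C X) (b *\<^sub>C Y) (c *\<^sub>C Z) = (a * cnj a) * (b * cnj b) * (c * cnj c) * triple X Y Z"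
    by (simp add: triple_def hform_scaleC_left hform_scaleC_right mult_ac)
  then show ?thesis by (simp only: of_real_mult complex_norm_square)
qed

text \<open>The division by the self-products makes the quantity independent of the chosen lifts, as
  \<open>triple_scaleC\<close> shows.\<close>

lemma Re_triple_isometry:
  assumes g: "g \<in> carrier Isom"
    and p: "hpositive X" "hpositive Y" "hpositive Z" "hpositive X'" "hpositive Y'" "hpositive Z'"
    and gX: "g (chyp_of X) = chyp_of X'" "g (chyp_of Y) = chyp_of Y'" "g (chyp_of Z) = chyp_of Z'"
  shows "Re (triple X' Y' Z') / (Re (hform X' X') * Re (hform Y' Y') * Re (hform Z' Z'))
    = Re (triple X Y Z) / (Re (hform X X) * Re (hform Y Y) * Re (hform Z Z))"
proof -
  define n where "n V = complex_of_real (1 / sqrt (Re (hform V V))) *\<^sub>C V" for V :: "complex \<times> 'a"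
  have n: "hform (n V) (n V) = 1" "chyp_of (n V) = chyp_of V" if "hpositive V" for V
  proof -
    have r: "Re (hform V V) > 0" using that by (simp add: hpositive_def)
    then have "Re (hform (n V) (n V)) = 1"
      by (simp only: n_def Re_hform_scaleC) (simp add: norm_divide power_divide)
    then show "hform (n V) (n V) = 1" by (subst hform_self) simp
    show "chyp_of (n V) = chyp_of V" using r that by (simp add: n_def chyp_of_scaleC)
  qed
  have t: "Re (triple (n X) (n Y) (n Z)) = Re (triple X Y Z) / (Re (hform X X) * Re (hform Y Y) * Re (hform Z Z))"
    if "hpositive X" "hpositive Y" "hpositive Z" for X Y Z
  proof -
    have "(cmod (complex_of_real (1 / sqrt (Re (hform V V)))))\<^sup>2 = 1 / Re (hform V V)" if "hpositive V" for V :: "complex \<times> 'a"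
      using that by (simp add: norm_divide power_divide hpositive_def)
    then show ?thesis using that by (simp only: n_def triple_scaleC) simp
  qed
  have "Re (triple (n X') (n Y') (n Z')) = Re (triple (n X) (n Y) (n Z))"
    by (rule Re_triple_isometry_unit[OF g]) (simp_all add: n p gX)
  then show ?thesis using t p by simp
qed


section \<open>Isometries are induced by semilinear maps\<close>

text \<open>The ball model: every positive line contains exactly one vector with first coordinate 1,
  and its second coordinate lies in the open unit ball.\<close>

definition pt :: "'h::complex_hilbert \<Rightarrow> 'h chyp"
  where "pt u = chyp_of (1, u)"

lemma hform_pt: "hform (1, u) (1, v) = 1 - cinner u v"
  by (simp add: hform_def)

lemma norm_less_1_iff: "norm (u::'h::complex_hilbert) < 1 \<longleftrightarrow> (norm u)\<^sup>2 < 1"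
  using abs_square_less_1[of "norm u"] by simp

lemma hpositive_pt: "hpositive (1, u) \<longleftrightarrow> norm u < 1"
  by (simp add: hpositive_def hform_pt cinner_self norm_less_1_iff)

lemma Re_hform_pt: "Re (hform (1, u) (1, u)) = 1 - (norm u)\<^sup>2"
  by (simp add: hform_pt cinner_self)

lemma pt_cases: obtains u where "norm u < 1" "x = pt u"
proof -
  obtain X where X: "hpositive X" "x = chyp_of X" by (metis chyp_cases)
  have n: "norm (snd X) < cmod (fst X)"
    using X by (simp add: hpositive_def Re_hform_self power_less_imp_less_base)
  then have f: "fst X \<noteq> 0" by auto
  define u where "u = inverse (fst X) *\<^sub>C snd X"
  have "inverse (fst X) *\<^sub>C X = (1, u)" using f by (simp add: scaleC_prod_def u_def scaleC_complex_def)
  moreover have "hpositive (inverse (fst X) *\<^sub>C X)" "chyp_of (inverse (fst X) *\<^sub>C X) = chyp_of X"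
    using X f by (simp_all add: chyp_of_scaleC)
  ultimately show ?thesis using that[of u] X by (simp add: pt_def hpositive_pt)
qed

lemma pt_inject: "norm u < 1 \<Longrightarrow> norm v < 1 \<Longrightarrow> pt u = pt v \<Longrightarrow> u = v"
  using chyp_of_eq_iff[of "(1, u)" "(1, v)"]
  by (auto simp: pt_def hpositive_pt scaleC_prod_def scaleC_complex_def)

lemma in_ball_scale: "norm ((1 / (1 + norm u)) *\<^sub>R u) < 1"
  by (simp add: add_pos_nonneg)

lemma scaleC_complex_cases: "c *\<^sub>C u = Re c *\<^sub>R u + \<i> *\<^sub>C (Im c *\<^sub>R (u::'a::complex_vector))"
  by (subst complex_eq[of c]) (simp add: scaleC_add_left scaleC_of_real[symmetric] scaleC_scaleC)

lemma inner_preserving_linear: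
  fixes R :: "'h::real_inner \<Rightarrow> 'h"
  assumes "\<And>u v. R u \<bullet> R v = u \<bullet> v"
  shows "R (u + v) = R u + R v" and "R (r *\<^sub>R u) = r *\<^sub>R R u"
proof -
  have "(R (u + v) - (R u + R v)) \<bullet> (R (u + v) - (R u + R v)) = 0"
    by (simp add: inner_diff_left inner_diff_right inner_add_left inner_add_right assms)
  then show "R (u + v) = R u + R v" by simp
  have "(R (r *\<^sub>R u) - r *\<^sub>R R u) \<bullet> (R (r *\<^sub>R u) - r *\<^sub>R R u) = 0"
    by (simp add: inner_diff_left inner_diff_right assms)
  then show "R (r *\<^sub>R u) = r *\<^sub>R R u" by simp
qed

text \<open>
  An isometry preserves midpoints and hence the real parts of the triple products. In the ball
  model it is therefore the restriction of a real-linear isometry \<open>R\<close>, and \<open>R (\<i> u) = \<plusminus> \<i> R u\<close> with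
  the same sign for all \<open>u\<close>, as a vector space is not the union of two proper subspaces.
\<close>
lemma fixing_isometry_hsemilinear:
  assumes g: "g \<in> carrier Isom" and g0: "g (pt 0) = pt (0::'h::complex_hilbert)"
  obtains s T where "hsemilinear s T" "g = act T"
proof -
  have "\<exists>v. norm v < 1 \<and> g (pt u) = pt v" for u by (metis pt_cases)
  then obtain S where S: "norm (S u) < 1" "g (pt u) = pt (S u)" for u by metis
  have t: "triple (1, 0) (1, u) (1, v) = 1 - cinner u v" for u v :: 'h
    by (simp add: triple_def hform_pt)
  have "Re (triple (1, 0) (1, S u) (1, S v)) / (Re (hform (1, 0::'h) (1, 0)) * Re (hform (1, S u) (1, S u)) * Re (hform (1, S v) (1, S v)))
      = Re (triple (1, 0) (1, u) (1, v)) / (Re (hform (1, 0::'h) (1, 0)) * Re (hform (1, u) (1, u)) * Re (hform (1, v) (1, v)))"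
    if "norm u < 1" "norm v < 1" for u v
    by (rule Re_triple_isometry[OF g]) (use that S g0 in \<open>simp_all add: hpositive_pt pt_def[symmetric]\<close>)
  then have r: "(1 - S u \<bullet> S v) / ((1 - (norm (S u))\<^sup>2) * (1 - (norm (S v))\<^sup>2))
      = (1 - u \<bullet> v) / ((1 - (norm u)\<^sup>2) * (1 - (norm v)\<^sup>2))" if "norm u < 1" "norm v < 1" for u v
    using that by (simp add: t hform_pt inner_eq_Re_cinner cinner_self)
  \<comment> \<open>For \<open>v = u\<close> both quotients in \<open>r\<close> collapse to the
    reciprocals of \<open>1 - (norm (S u))\<^sup>2\<close> and
    \<open>1 - (norm u)\<^sup>2\<close>.\<close>
  have nS: "norm (S u) = norm u" if "norm u < 1" for u
  proof -
    have "1 - (norm (S u))\<^sup>2 > 0" "1 - (norm u)\<^sup>2 > 0"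
      using that S(1)[of u] norm_less_1_iff[of u] norm_less_1_iff[of "S u"] by simp_all
    then have "(norm (S u))\<^sup>2 = (norm u)\<^sup>2"
      using r[OF that that] by (simp add: power2_norm_eq_inner)
    then show ?thesis by simp
  qed
  have iS: "S u \<bullet> S v = u \<bullet> v" if "norm u < 1" "norm v < 1" for u v
  proof -
    have "(1 - (norm u)\<^sup>2) * (1 - (norm v)\<^sup>2) \<noteq> 0" using that norm_less_1_iff[of u] norm_less_1_iff[of v] by simp
    then show ?thesis using r[OF that] by (simp add: nS that divide_cancel_right)
  qed
  \<comment> \<open>\<open>S\<close> is controlled only on the unit ball; \<open>R\<close> is its
    extension to the whole space, each vector being shrunk into the ball and stretched back
    afterwards.\<close>
  define R where "R u = (1 + norm u) *\<^sub>R S ((1 / (1 + norm u)) *\<^sub>R u)" for u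
  have n0: "1 + norm u \<noteq> 0" for u :: 'h using norm_ge_zero[of u] by linarith
  have iR: "R u \<bullet> R v = u \<bullet> v" for u v
    using in_ball_scale[of u] in_ball_scale[of v] n0[of u] n0[of v] by (simp add: R_def iS)
  note linR = inner_preserving_linear[of R, OF iR]
  have RS: "R u = S u" if "norm u < 1" for u
  proof -
    have 1: "R u \<bullet> S u = u \<bullet> u"
      using in_ball_scale[of u] n0[of u] that by (simp add: R_def iS)
    have "(R u - S u) \<bullet> (R u - S u) = 0"
      using 1 iS[OF that that] iR[of u u] by (simp add: inner_diff_left inner_diff_right inner_commute)
    then show ?thesis by simp
  qed
  have nR: "norm (R u) = norm u" for u using iR[of u u] by (simp add: norm_eq)
  have "\<exists>u. R u = v" for v
  proof -
    obtain x where x: "g x = pt ((1 / (1 + norm v)) *\<^sub>R v)"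
      using g by (metis in_Isom_iff bij_pointE)
    obtain u where u: "norm u < 1" "x = pt u" by (rule pt_cases)
    have "S u = (1 / (1 + norm v)) *\<^sub>R v"
      using pt_inject[OF S(1)[of u] in_ball_scale[of v]] x u S(2)[of u] by simp
    then have "R ((1 + norm v) *\<^sub>R u) = v" using u n0[of v] by (simp add: linR RS)
    then show "\<exists>u. R u = v" by blast
  qed
  then have "surj R" by (metis surjI)
  moreover have "inj R"
  proof (rule injI)
    fix u v assume "R u = R v"
    then have "R (u - v) = 0" using linR(1)[of "u - v" v] by simp
    then show "u = v" using nR[of "u - v"] by simp
  qed
  ultimately have bR: "bij R" by (simp add: bij_def)
  have Im_cinner: "Im (cinner u v) = - (u \<bullet> (\<i> *\<^sub>C v))" for u v :: 'h
    by (simp add: inner_eq_Re_cinner cinner_scaleC_right)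
  have modS: "cmod (1 - cinner (S u) (S v)) = cmod (1 - cinner u v)" if "norm u < 1" "norm v < 1" for u v
  proof -
    have "dist (pt (S u)) (pt (S v)) = dist (pt u) (pt v)"
      using g S by (metis in_Isom_iff)
    then have "hcosh (1, S u) (1, S v) = hcosh (1, u) (1, v)"
      unfolding pt_def using that S(1) by (metis cosh_dist_eq_hcosh hpositive_pt)
    moreover have "1 - (norm u)\<^sup>2 > 0" "1 - (norm v)\<^sup>2 > 0"
      using that norm_less_1_iff[of u] norm_less_1_iff[of v] by simp_all
    ultimately show ?thesis by (simp add: hcosh_def Re_hform_pt nS that) (simp add: hform_pt)
  qed
  \<comment> \<open>Distances give the modulus of \<open>1 - cinner u v\<close> and triple products
    give the real part of \<open>cinner u v\<close>. Together they leave only the sign of the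
    imaginary part open.\<close>
  have Im_abs: "\<bar>Im (cinner (R u) (R v))\<bar> = \<bar>Im (cinner u v)\<bar>" for u v
  proof -
    define a b where "a = 1 / (1 + norm u)" and "b = 1 / (1 + norm v)"
    have ab: "norm (a *\<^sub>R u) < 1" "norm (b *\<^sub>R v) < 1" "a > 0" "b > 0"
      using in_ball_scale[of u] in_ball_scale[of v] by (simp_all add: a_def b_def add_pos_nonneg)
    have "(cmod (1 - cinner (S (a *\<^sub>R u)) (S (b *\<^sub>R v))))\<^sup>2 = (cmod (1 - cinner (a *\<^sub>R u) (b *\<^sub>R v)))\<^sup>2"
      using modS ab by simp
    moreover have "Re (cinner (S (a *\<^sub>R u)) (S (b *\<^sub>R v))) = Re (cinner (a *\<^sub>R u) (b *\<^sub>R v))"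
      using iS ab by (simp add: inner_eq_Re_cinner[symmetric])
    ultimately have "(Im (cinner (S (a *\<^sub>R u)) (S (b *\<^sub>R v))))\<^sup>2 = (Im (cinner (a *\<^sub>R u) (b *\<^sub>R v)))\<^sup>2"
      by (simp add: cmod_power2)
    then have "\<bar>Im (cinner (R (a *\<^sub>R u)) (R (b *\<^sub>R v)))\<bar> = \<bar>Im (cinner (a *\<^sub>R u) (b *\<^sub>R v))\<bar>"
      using ab by (simp add: RS power2_eq_iff abs_eq_iff)
    then show ?thesis
      using ab by (simp add: linR Im_cinner scaleC_scaleR_commute abs_mult)
  qed
  \<comment> \<open>The equality case of Cauchy-Schwarz: \<open>R (\<i> *\<^sub>C u)\<close> and
    \<open>\<i> *\<^sub>C R u\<close> have the same norm, and their scalar product is plus or minus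
    its square.\<close>
  have alt: "R (\<i> *\<^sub>C u) = \<i> *\<^sub>C R u \<or> R (\<i> *\<^sub>C u) = - (\<i> *\<^sub>C R u)" for u
  proof -
    have "norm (\<i> *\<^sub>C R u) = norm u" "norm (R (\<i> *\<^sub>C u)) = norm u" by (simp_all add: norm_scaleC nR)
    then have n: "(\<i> *\<^sub>C R u) \<bullet> (\<i> *\<^sub>C R u) = u \<bullet> u" "R (\<i> *\<^sub>C u) \<bullet> R (\<i> *\<^sub>C u) = u \<bullet> u"
      by (simp_all add: dot_square_norm)
    have "Im (cinner u (\<i> *\<^sub>C u)) = u \<bullet> u"
      by (simp add: cinner_scaleC_right cinner_self power2_norm_eq_inner)
    then have "\<bar>Im (cinner (R u) (R (\<i> *\<^sub>C u)))\<bar> = u \<bullet> u" using Im_abs[of u "\<i> *\<^sub>C u"] by simp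
    moreover have "Im (cinner (R u) (R (\<i> *\<^sub>C u))) = (\<i> *\<^sub>C R u) \<bullet> R (\<i> *\<^sub>C u)"
      by (simp add: inner_eq_Re_cinner cinner_scaleC_left)
    ultimately have "(\<i> *\<^sub>C R u) \<bullet> R (\<i> *\<^sub>C u) = u \<bullet> u \<or> (\<i> *\<^sub>C R u) \<bullet> R (\<i> *\<^sub>C u) = - (u \<bullet> u)"
      by linarith
    then have "(R (\<i> *\<^sub>C u) - \<i> *\<^sub>C R u) \<bullet> (R (\<i> *\<^sub>C u) - \<i> *\<^sub>C R u) = 0
        \<or> (R (\<i> *\<^sub>C u) + \<i> *\<^sub>C R u) \<bullet> (R (\<i> *\<^sub>C u) + \<i> *\<^sub>C R u) = 0"
      using n by (auto simp: inner_diff_left inner_diff_right inner_add_left inner_add_right inner_commute)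
    then show ?thesis by (auto simp: eq_neg_iff_add_eq_0)
  qed
  have "(\<forall>u. R (\<i> *\<^sub>C u) = \<i> *\<^sub>C R u) \<or> (\<forall>u. R (\<i> *\<^sub>C u) = - (\<i> *\<^sub>C R u))"
  proof (rule ccontr)
    assume "\<not> ?thesis"
    then obtain u v where u: "R (\<i> *\<^sub>C u) \<noteq> \<i> *\<^sub>C R u" and v: "R (\<i> *\<^sub>C v) \<noteq> - (\<i> *\<^sub>C R v)" by blast
    have "R (\<i> *\<^sub>C u) = - (\<i> *\<^sub>C R u)" "R (\<i> *\<^sub>C v) = \<i> *\<^sub>C R v" using alt u v by blast+
    then have 1: "R (\<i> *\<^sub>C (u + v)) = - (\<i> *\<^sub>C R u) + \<i> *\<^sub>C R v"
      "\<i> *\<^sub>C R (u + v) = \<i> *\<^sub>C R u + \<i> *\<^sub>C R v"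
      by (simp_all add: scaleC_add_right linR)
    have "- (\<i> *\<^sub>C R u) = \<i> *\<^sub>C R u \<or> \<i> *\<^sub>C R v = - (\<i> *\<^sub>C R v)"
      using alt[of "u + v"] unfolding 1 by auto
    then show False
      using u v \<open>R (\<i> *\<^sub>C u) = - (\<i> *\<^sub>C R u)\<close> \<open>R (\<i> *\<^sub>C v) = \<i> *\<^sub>C R v\<close> by auto
  qed
  then obtain s where s: "s = id \<or> s = cnj" "\<And>u. R (\<i> *\<^sub>C u) = s \<i> *\<^sub>C R u"
    by (metis complex_cnj_i id_apply scaleC_minus_left)
  have Rc: "R (c *\<^sub>C u) = s c *\<^sub>C R u" for c u
  proof -
    have "R (c *\<^sub>C u) = Re c *\<^sub>R R u + s \<i> *\<^sub>C (Im c *\<^sub>R R u)"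
      unfolding scaleC_complex_cases[of c u] by (simp only: linR s(2))
    also have "\<dots> = s c *\<^sub>C R u"
      using s(1) scaleC_complex_cases[of "s c" "R u"]
      by (auto simp: scaleC_minus_left scaleC_minus_right)
    finally show ?thesis .
  qed
  have cR: "cinner (R u) (R v) = s (cinner u v)" for u v
  proof (rule complex_eqI)
    show "Re (cinner (R u) (R v)) = Re (s (cinner u v))"
      using iR[of u v] s(1) by (auto simp: inner_eq_Re_cinner)
    have "R u \<bullet> (s \<i> *\<^sub>C R v) = u \<bullet> (\<i> *\<^sub>C v)" using iR[of u "\<i> *\<^sub>C v"] by (simp add: Rc)
    then show "Im (cinner (R u) (R v)) = Im (s (cinner u v))"
      unfolding Im_cinner using s(1)
      by (auto simp: inner_eq_Re_cinner cinner_scaleC_right)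
  qed
  define T where "T X = (s (fst X), R (snd X))" for X
  have "hsemilinear s T"
  proof -
    have "s \<circ> s = id" using s(1) by (auto simp: fun_eq_iff)
    then have "bij s" using o_bij by blast
    then have "bij T"
      using bR bij_betw_map_prod[of s UNIV UNIV R UNIV UNIV]
      by (simp add: T_def[abs_def] map_prod_def case_prod_unfold)
    moreover have "T (X + Y) = T X + T Y" for X Y using s(1) by (auto simp: T_def linR)
    moreover have "T (c *\<^sub>C X) = s c *\<^sub>C T X" for c X
      using s(1) by (auto simp: T_def scaleC_prod_def scaleC_complex_def Rc)
    moreover have "hform (T X) (T Y) = s (hform X Y)" for X Y
      using s(1) by (auto simp: T_def hform_def cR)
    ultimately show ?thesis using s(1) by (simp add: hsemilinear_def del: split_paired_All)
  qed
  moreover have "g x = act T x" for x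
  proof -
    obtain u where u: "norm u < 1" "x = pt u" by (rule pt_cases)
    have "act T (chyp_of (1, u)) = chyp_of (T (1, u))"
      using act_chyp_of[OF \<open>hsemilinear s T\<close>] u by (simp add: hpositive_pt)
    moreover have "T (1, u) = (1, S u)" using s(1) u by (auto simp: T_def RS)
    ultimately show ?thesis using u S(2)[of u] by (simp add: pt_def)
  qed
  then have "g = act T" by auto
  ultimately show thesis using that by blast
qed

lemma Isom_transitive:
  obtains T where "hsemilinear id T" "act T x = y"
proof -
  obtain X Y where X: "hpositive X" "x = chyp_of X" "hform X X = 1"
    and Y: "hpositive Y" "y = chyp_of Y" "hform Y Y = 1" by (metis chyp_cases)
  obtain A B C \<omega> where 1: "hsemilinear id A" "hsemilinear id B" "hsemilinear id C" "cmod \<omega> = 1"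
    "C (C (B (B (A (A X))))) = \<omega> *\<^sub>C Y"
    using gram_transitive_vectors[OF X(1) X(1) X(1), of Y Y Y] X Y by metis
  note c = hsemilinear_compose[of id _ id, unfolded id_o]
  have "hsemilinear id (C \<circ> C \<circ> B \<circ> B \<circ> A \<circ> A)"
    by (intro c 1)
  moreover from this have "act (C \<circ> C \<circ> B \<circ> B \<circ> A \<circ> A) x = y"
    using 1 X Y act_chyp_of[of id "C \<circ> C \<circ> B \<circ> B \<circ> A \<circ> A" X] chyp_of_scaleC[of Y \<omega>] by force
  ultimately show ?thesis using that by blast
qed

text \<open>A holomorphic isometry first brings the image of \<open>pt 0\<close> back, which reduces
  the claim to \<open>fixing_isometry_hsemilinear\<close>.\<close>

lemma Isom_hsemilinear:
  assumes g: "g \<in> carrier (Isom :: ('h::complex_hilbert chyp \<Rightarrow> 'h chyp) monoid)"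
  obtains s T where "hsemilinear s T" "g = act T"
proof -
  obtain A where A: "hsemilinear id A" "act A (g (pt 0)) = pt 0" by (rule Isom_transitive)
  obtain s T where T: "hsemilinear s T" "act A \<circ> g = act T"
    using fixing_isometry_hsemilinear[of "act A \<circ> g"] A g act_in_Isom Isom_compose by (metis comp_apply)
  define B where "B = inv_into UNIV A"
  have B: "hsemilinear id B" unfolding B_def by (rule hsemilinear_inv[OF A(1)])
  have "act B \<circ> act A = id"
  proof -
    have "B \<circ> A = id" using hsemilinearD(5)[OF A(1)] by (simp add: B_def bij_is_inj fun_eq_iff)
    then have "act B \<circ> act A = act id" using act_compose[OF B A(1)] by simp
    also have "\<dots> = id"
    proof
      fix x :: "'h chyp"
      show "act id x = id x"
        by (rule chyp_cases[of x]) (simp add: act_chyp_of[OF hsemilinear_id])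
    qed
    finally show ?thesis .
  qed
  then have "g = act B \<circ> act T" by (metis T(2) comp_assoc id_comp)
  also have "\<dots> = act (B \<circ> T)" using act_compose[OF B T(1)] by simp
  finally show ?thesis using that hsemilinear_compose[OF B T(1)] by blast
qed

section \<open>Cartan arguments under isometries\<close>

lemma cartan_arg_bound: "\<bar>cartan_arg x y z\<bar> < pi / 2"
proof -
  obtain X Y Z where "hpositive X" "x = chyp_of X" "hpositive Y" "y = chyp_of Y"
    "hpositive Z" "z = chyp_of Z" by (metis chyp_cases)
  then show ?thesis using abs_Arg_less_pi_half[OF Re_triple_pos[of X Y Z]] by (simp only: cartan_arg_chyp_of)
qed

lemma cartan_arg_act:
  assumes T: "hsemilinear s T"
  shows "cartan_arg (act T x) (act T y) (act T z) = (if s = id then 1 else -1) * cartan_arg x y z"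
proof -
  obtain X Y Z where X: "hpositive X" "x = chyp_of X" "hpositive Y" "y = chyp_of Y"
    "hpositive Z" "z = chyp_of Z" by (metis chyp_cases)
  have "cartan_arg (act T x) (act T y) (act T z) = Arg (s (hform X Y * hform Y Z * hform Z X))"
    using X hsemilinearD(1,4)[OF T]
    by (auto simp: act_chyp_of[OF T] cartan_arg_chyp_of hsemilinear_hpositive[OF T])
  moreover have "Re (hform X Y * hform Y Z * hform Z X) > 0" using Re_triple_pos X by blast
  then have "Arg (cnj (hform X Y * hform Y Z * hform Z X)) = - Arg (hform X Y * hform Y Z * hform Z X)"
    by (subst Arg_cnj) (auto simp: Arg_eq_0)
  ultimately show ?thesis using X hsemilinearD(1)[OF T]
    by (auto simp: cartan_arg_chyp_of)
qed

lemma cartan_arg_square: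
  assumes "g \<in> carrier (Isom :: ('h::complex_hilbert chyp \<Rightarrow> 'h chyp) monoid)"
  shows "cartan_arg (g (g x)) (g (g y)) (g (g z)) = cartan_arg x y z"
proof -
  obtain s T where "hsemilinear s T" "g = act T" using Isom_hsemilinear[OF assms] .
  then show ?thesis by (simp add: cartan_arg_act)
qed


section \<open>Orthonormal sequences and means\<close>

lemma cesaro_mean_tendsto:
  fixes a :: "nat \<Rightarrow> real"
  assumes "a \<longlonglongrightarrow> c"
  shows "(\<lambda>N. (\<Sum>n<N. a n) / real N) \<longlonglongrightarrow> c"
proof -
  obtain K where K: "\<And>n. \<bar>a n\<bar> \<le> K"
    using Bseq_def[of a] convergent_imp_Bseq[of a] assms by (auto simp: convergent_def)
  show ?thesis
  proof (rule LIMSEQ_I)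
    fix e :: real assume e: "e > 0"
    obtain n0 where n0: "\<And>n. n \<ge> n0 \<Longrightarrow> \<bar>a n - c\<bar> < e / 2"
      using LIMSEQ_D[OF assms, of "e / 2"] e by auto
    define M where "M = real n0 * (K + \<bar>c\<bar>)"
    have b: "\<bar>a n - c\<bar> \<le> K + \<bar>c\<bar>" for n using K[of n] by linarith
    obtain N0 :: nat where N0: "real N0 > 2 * M / e" using reals_Archimedean2 by blast
    have "norm ((\<Sum>n<N. a n) / real N - c) < e" if N: "N \<ge> max (max n0 N0) 1" for N
    proof -
      have split: "{..<N} = {..<n0} \<union> {n0..<N}" using N by auto
      have "\<bar>\<Sum>n<N. a n - c\<bar> \<le> (\<Sum>n<N. \<bar>a n - c\<bar>)" by (rule sum_abs)
      also have "\<dots> = (\<Sum>n<n0. \<bar>a n - c\<bar>) + (\<Sum>n=n0..<N. \<bar>a n - c\<bar>)"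
        unfolding split by (rule sum.union_disjoint) auto
      also have "(\<Sum>n<n0. \<bar>a n - c\<bar>) \<le> M"
        using sum_bounded_above[of "{..<n0}" "\<lambda>n. \<bar>a n - c\<bar>" "K + \<bar>c\<bar>"] b by (simp add: M_def)
      also have "(\<Sum>n=n0..<N. \<bar>a n - c\<bar>) \<le> real (N - n0) * (e / 2)"
        using sum_bounded_above[of "{n0..<N}" "\<lambda>n. \<bar>a n - c\<bar>" "e / 2"] n0 less_imp_le by fastforce
      also have "\<dots> \<le> real N * (e / 2)" using e by (intro mult_right_mono) auto
      also have "M < real N * (e / 2)"
      proof -
        have "2 * M / e < real N" using N0 N by linarith
        then show ?thesis using e by (simp add: field_simps)
      qed
      finally have "\<bar>\<Sum>n<N. a n - c\<bar> < real N * e" by (simp add: field_simps)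
      moreover have "(\<Sum>n<N. a n) / real N - c = (\<Sum>n<N. a n - c) / real N"
        using N by (simp add: sum_subtractf field_simps)
      ultimately show ?thesis using N by (simp add: field_simps)
    qed
    then show "\<exists>no. \<forall>n\<ge>no. norm ((\<Sum>n<n. a n) / real n - c) < e" by blast
  qed
qed

text \<open>Boundedness replaces continuity in Cauchy's functional equation on an interval.
  Subtracting the linear function through \<open>g d\<close> gives an additive \<open>h\<close> with
  \<open>h d = 0\<close>. If \<open>h x\<close> were non-zero, all its multiples would be values of
  \<open>h\<close>, against boundedness.\<close>

lemma additive_bounded_linear:
  fixes g :: "real \<Rightarrow> real"
  assumes d: "d > 0"
    and add: "\<And>x y. 0 \<le> x \<Longrightarrow> 0 \<le> y \<Longrightarrow> x + y \<le> d \<Longrightarrow> g (x + y) = g x + g y"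
    and bnd: "\<And>x. 0 \<le> x \<Longrightarrow> x \<le> d \<Longrightarrow> \<bar>g x\<bar> \<le> M"
    and x: "0 \<le> x" "x \<le> d"
  shows "g x = x * (g d / d)"
proof -
  define h where "h x = g x - x * (g d / d)" for x
  have h_add: "h (x + y) = h x + h y" if "0 \<le> x" "0 \<le> y" "x + y \<le> d" for x y
    using add[OF that] d by (simp add: h_def field_simps)
  have hd: "h d = 0" using d by (simp add: h_def)
  have h_bnd: "\<bar>h y\<bar> \<le> 2 * M" if "0 \<le> y" "y \<le> d" for y
  proof -
    have "\<bar>y * (g d / d)\<bar> = (y / d) * \<bar>g d\<bar>" using that d by (simp add: abs_mult)
    also have "\<dots> \<le> 1 * \<bar>g d\<bar>" using that d by (intro mult_right_mono) auto
    finally have "\<bar>y * (g d / d)\<bar> \<le> M" using bnd[of d] d by simp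
    moreover have "\<bar>h y\<bar> \<le> \<bar>g y\<bar> + \<bar>y * (g d / d)\<bar>" unfolding h_def by (rule abs_triangle_ineq4)
    ultimately show ?thesis using bnd[OF that] by linarith
  qed
  have multiple: "\<exists>y. 0 \<le> y \<and> y \<le> d \<and> h y = real n * h x" for n
  proof (induction n)
    case 0
    then show ?case using h_add[of 0 0] d by (intro exI[of _ 0]) auto
  next
    case (Suc n)
    then obtain y where y: "0 \<le> y" "y \<le> d" "h y = real n * h x" by blast
    show ?case
    proof (cases "y + x \<le> d")
      case True
      then show ?thesis using y x h_add[of y x] by (intro exI[of _ "y + x"]) (auto simp: algebra_simps)
    next
      case False
      \<comment> \<open>Because \<open>h d = 0\<close>, an argument that leaves the interval can be
        moved back by \<open>d\<close> without changing the value.\<close>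
      have "h (d - x) + h x = 0" using h_add[of "d - x" x] x hd by simp
      moreover have "h y = h (d - x) + h (y + x - d)"
        using h_add[of "d - x" "y + x - d"] x y False by simp
      ultimately have "h (y + x - d) = real (Suc n) * h x" using y(3) by (simp add: algebra_simps)
      then show ?thesis using False x y by (intro exI[of _ "y + x - d"]) auto
    qed
  qed
  have "h x = 0"
  proof (rule ccontr)
    assume nz: "h x \<noteq> 0"
    obtain n :: nat where "real n > 2 * M / \<bar>h x\<bar>" using reals_Archimedean2 by blast
    then have "2 * M < \<bar>real n * h x\<bar>" using nz by (simp add: field_simps abs_mult)
    moreover obtain y where "0 \<le> y" "y \<le> d" "h y = real n * h x" using multiple by blast
    ultimately show False using h_bnd[of y] by simp
  qed
  then show ?thesis by (simp add: h_def)
qed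

text \<open>\<open>span\<close> is the real span. Adding the multiples of \<open>A\<close> by
  \<open>\<i>\<close> to the generators turns it into the complex span.\<close>

lemma complex_span_scaleC:
  fixes A :: "'h::complex_vector set"
  assumes "v \<in> span (A \<union> (\<lambda>a. \<i> *\<^sub>C a) ` A)"
  shows "c *\<^sub>C v \<in> span (A \<union> (\<lambda>a. \<i> *\<^sub>C a) ` A)"
proof -
  define S where "S = A \<union> (\<lambda>a. \<i> *\<^sub>C a) ` A"
  have i: "\<i> *\<^sub>C v \<in> span S" if "v \<in> span S" for v
    using that
  proof (induction rule: span_induct_alt)
    case base
    then show ?case by (simp add: span_zero)
  next
    case (step r x y)
    have "\<i> *\<^sub>C x \<in> span S"
    proof (cases "x \<in> A")
      case True
      then show ?thesis by (auto simp: S_def intro: span_base)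
    next
      case False
      then obtain a where "a \<in> A" "x = \<i> *\<^sub>C a" using step by (auto simp: S_def)
      then have "\<i> *\<^sub>C x = - a" "a \<in> S"
        by (simp_all add: scaleC_scaleC scaleC_minus_left S_def)
      then show ?thesis by (simp add: span_base span_neg)
    qed
    then show ?case using step
      by (simp add: scaleC_add_right scaleC_scaleR_commute span_add span_scale)
  qed
  then show ?thesis
    using assms unfolding scaleC_complex_cases[of c v] S_def[symmetric]
    by (intro span_add i span_scale)
qed

text \<open>Gram-Schmidt by induction: the old span is removed from both \<open>x\<close> and the
  new vector \<open>a\<close>, and then the remainder \<open>a'\<close> from \<open>x'\<close>. If
  \<open>a'\<close> is zero, \<open>a\<close> lies in the old span and \<open>x'\<close> is already
  orthogonal to it.\<close>

lemma orthogonal_projection_finite: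
  fixes A :: "'h::complex_hilbert set"
  assumes "finite A"
  shows "\<exists>y. x - y \<in> span (A \<union> (\<lambda>a. \<i> *\<^sub>C a) ` A) \<and> (\<forall>a\<in>A. cinner y a = 0)"
  using assms
proof (induction A arbitrary: x)
  case empty
  then show ?case by (intro exI[of _ x]) (simp add: span_zero)
next
  case (insert a A)
  define S where "S A = A \<union> (\<lambda>a. \<i> *\<^sub>C a) ` A" for A :: "'h set"
  have mono: "span (S A) \<subseteq> span (S (insert a A))" by (intro span_mono) (auto simp: S_def)
  have orth_span: "cinner y v = 0" if "\<forall>a\<in>A. cinner y a = 0" "v \<in> span (S A)" for y v
    using that(2)
  proof (induction rule: span_induct_alt)
    case (step r x z)
    have "cinner y x = 0" using step(1) that(1) by (auto simp: S_def cinner_scaleC_right)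
    then show ?case using step
      by (simp add: cinner_add_right scaleC_of_real[symmetric] cinner_scaleC_right)
  qed simp
  obtain a' where a': "a - a' \<in> span (S A)" "\<forall>b\<in>A. cinner a' b = 0"
    using insert.IH[of a] unfolding S_def by blast
  obtain x' where x': "x - x' \<in> span (S A)" "\<forall>b\<in>A. cinner x' b = 0"
    using insert.IH[of x] unfolding S_def by blast
  show ?case
  proof (cases "a' = 0")
    case True
    then have "cinner x' a = 0" using orth_span[OF x'(2), of a] a'(1) by simp
    then show ?thesis using x' mono unfolding S_def by (intro exI[of _ x']) auto
  next
    case False
    define y where "y = x' - (cinner a' x' / cinner a' a') *\<^sub>C a'"
    have n: "cinner a' a' \<noteq> 0" using False by (simp add: cinner_self)
    have real: "cnj (cinner a' a') = cinner a' a'" by (simp add: cinner_self)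
    have "cinner y b = 0" if "b \<in> A" for b
      using that a'(2) x'(2) by (simp add: y_def cinner_diff_left cinner_scaleC_left)
    then have yA: "\<forall>b\<in>A. cinner y b = 0" by blast
    have "cinner y a' = 0"
      using n real cinner_commute[of x' a'] by (simp add: y_def cinner_diff_left cinner_scaleC_left)
    then have "cinner y a = 0"
      using orth_span[OF yA a'(1)] by (simp add: cinner_diff_right)
    moreover have "x - y \<in> span (S (insert a A))"
    proof -
      have "a \<in> span (S (insert a A))" by (rule span_base) (simp add: S_def)
      then have "a - (a - a') \<in> span (S (insert a A))" by (rule span_diff) (rule subsetD[OF mono a'(1)])
      then have "(cinner a' x' / cinner a' a') *\<^sub>C a' \<in> span (S (insert a A))"
        unfolding S_def by (intro complex_span_scaleC) simp
      moreover have "x - x' \<in> span (S (insert a A))" using x' mono by auto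
      ultimately have "(x - x') + (cinner a' x' / cinner a' a') *\<^sub>C a' \<in> span (S (insert a A))"
        by (rule span_add[rotated])
      then show ?thesis by (simp add: y_def algebra_simps)
    qed
    ultimately show ?thesis using yA unfolding S_def by (intro exI[of _ y]) auto
  qed
qed

lemma orthogonal_unit_exists:
  fixes A :: "'h::complex_hilbert set"
  assumes "\<nexists>S::'h set. finite S \<and> span S = UNIV" and "finite A"
  obtains e where "norm e = 1" "\<And>a. a \<in> A \<Longrightarrow> cinner e a = 0" "\<And>a. a \<in> A \<Longrightarrow> cinner a e = 0"
proof -
  obtain x where x: "x \<notin> span (A \<union> (\<lambda>a. \<i> *\<^sub>C a) ` A)"
    using assms by (metis UNIV_eq_I finite_UnI finite_imageI)
  obtain y where y: "x - y \<in> span (A \<union> (\<lambda>a. \<i> *\<^sub>C a) ` A)" "\<forall>a\<in>A. cinner y a = 0"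
    using orthogonal_projection_finite[OF assms(2)] by blast
  have "y \<noteq> 0" using x y by auto
  define e where "e = complex_of_real (1 / norm y) *\<^sub>C y"
  have "norm e = 1" using \<open>y \<noteq> 0\<close> by (simp add: e_def norm_scaleC norm_divide)
  moreover have "cinner e a = 0" if "a \<in> A" for a
    using y that by (simp add: e_def cinner_scaleC_left)
  moreover from this have "cinner a e = 0" if "a \<in> A" for a
    using that cinner_commute[of a e] by simp
  ultimately show ?thesis using that by blast
qed

lemma orthonormal_sequence_exists:
  fixes A :: "'h::complex_hilbert set"
  assumes "\<nexists>S::'h set. finite S \<and> span S = UNIV" and "finite A"
  obtains e where "\<And>m n. cinner (e m) (e (n::nat)) = (if m = n then 1 else 0)"
    "\<And>a n. a \<in> A \<Longrightarrow> cinner (e n) a = 0" "\<And>a n. a \<in> A \<Longrightarrow> cinner a (e n) = 0"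
proof -
  define P where "P f n r \<longleftrightarrow> norm r = 1 \<and> (\<forall>a \<in> A \<union> f ` {..<n}. cinner r a = 0 \<and> cinner a r = 0)"
    for f :: "nat \<Rightarrow> 'h" and n r
  have "\<exists>f. \<forall>n. P f n (f n)"
  proof (rule dependent_wellorder_choice)
    show "\<exists>r. P f n r" for f n
      unfolding P_def using orthogonal_unit_exists[of "A \<union> f ` {..<n}"] assms
      by (metis finite_UnI finite_imageI finite_lessThan)
  qed (auto simp: P_def)
  then obtain e where e: "\<And>n. P e n (e n)" by blast
  have "cinner (e m) (e n) = (if m = n then 1 else 0)" for m n
  proof (cases m n rule: linorder_cases)
    case equal
    then show ?thesis using e[of n] by (simp add: P_def cinner_self)
  qed (use e[of m] e[of n] in \<open>auto simp: P_def\<close>)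
  then show ?thesis using that e unfolding P_def by blast
qed

text \<open>By Bessel's inequality the squared coefficients of \<open>w\<close> are summable, so
  they tend to zero.\<close>

lemma orthonormal_weakly_null:
  fixes e :: "nat \<Rightarrow> 'h::complex_hilbert"
  assumes e: "\<And>m n. cinner (e m) (e n) = (if m = n then 1 else 0)"
  shows "(\<lambda>n. cinner (e n) w) \<longlonglongrightarrow> 0"
proof -
  define c where "c n = cinner (e n) w" for n
  have sq: "cnj z * z = complex_of_real ((cmod z)\<^sup>2)" for z
    by (simp add: complex_norm_square mult.commute del: of_real_power)
  have bessel: "(\<Sum>n<N. (cmod (c n))\<^sup>2) \<le> (norm w)\<^sup>2" for N
  proof -
    define p where "p = (\<Sum>n<N. c n *\<^sub>C e n)"
    have "cinner p w = (\<Sum>n<N. cnj (c n) * c n)"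
      by (simp add: p_def bounded_bilinear.sum_left[OF bounded_bilinear_cinner] cinner_scaleC_left c_def)
    then have pw: "cinner p w = complex_of_real (\<Sum>n<N. (cmod (c n))\<^sup>2)" by (simp add: sq)
    have "cinner p (e m) = cnj (c m)" if "m < N" for m
      using that by (simp add: p_def bounded_bilinear.sum_left[OF bounded_bilinear_cinner]
        cinner_scaleC_left e if_distrib sum.delta cong: if_cong)
    then have "cinner p p = (\<Sum>n<N. c n * cnj (c n))"
      by (subst (2) p_def) (simp add: bounded_bilinear.sum_right[OF bounded_bilinear_cinner] cinner_scaleC_right)
    then have pp: "cinner p p = complex_of_real (\<Sum>n<N. (cmod (c n))\<^sup>2)" by (simp add: mult.commute[of "c _"] sq)
    have "0 \<le> (norm (w - p))\<^sup>2" by simp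
    also have "\<dots> = Re (cinner (w - p) (w - p))" by (simp add: cinner_self)
    also have "\<dots> = (norm w)\<^sup>2 - (\<Sum>n<N. (cmod (c n))\<^sup>2)"
      using cinner_commute[of w p] by (simp add: cinner_diff_left cinner_diff_right pw pp cinner_self[of w])
    finally show ?thesis by simp
  qed
  have "summable (\<lambda>n. (cmod (c n))\<^sup>2)"
    by (rule summableI_nonneg_bounded[OF _ bessel]) simp
  then have "(\<lambda>n. (cmod (c n))\<^sup>2) \<longlonglongrightarrow> 0" by (rule summable_LIMSEQ_zero)
  then have "(\<lambda>n. sqrt ((cmod (c n))\<^sup>2)) \<longlonglongrightarrow> sqrt 0" by (rule tendsto_real_sqrt)
  then show ?thesis unfolding c_def by (simp add: tendsto_norm_zero_iff)
qed

text \<open>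
  Means of vectors with constant mutual products converge, since the form is negative definite
  on the orthogonal complement of the positive vector \<open>P\<close>.
\<close>
lemma equiangular_mean_converges:
  fixes F :: "nat \<Rightarrow> complex \<times> 'h::complex_hilbert"
  assumes P: "hpositive P" and PF: "\<And>n. hform P (F n) = b"
    and FF: "\<And>m n. hform (F m) (F n) = (if m = n then 1 else complex_of_real c)"
  defines "A N \<equiv> complex_of_real (1 / real N) *\<^sub>C (\<Sum>n<N. F n)"
  obtains L where "A \<longlonglongrightarrow> L" "\<And>n. hform (F n) L = complex_of_real c" "hform L L = complex_of_real c" "hform P L = b"
proof -
  \<comment> \<open>The term of index \<open>m\<close> is 1 instead of \<open>c\<close>; after
    division by \<open>N\<close> it leaves the vanishing excess
    \<open>(1 - c) / real N\<close>.\<close>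
  have FA: "hform (F m) (A N) = complex_of_real (c + (1 - c) / real N)" if "m < N" for m N
  proof -
    have "(\<Sum>n<N. hform (F m) (F n)) = (\<Sum>n<N. complex_of_real c + (if m = n then complex_of_real (1 - c) else 0))"
      by (intro sum.cong) (auto simp: FF)
    also have "\<dots> = complex_of_real (real N * c + (1 - c))"
      using that by (simp add: sum.distrib)
    finally show ?thesis using that
      by (simp add: A_def hform_scaleC_right hform_sum_right add_divide_distrib distrib_left flip: of_real_mult of_real_add of_real_divide)
  qed
  have PA: "hform P (A N) = b" if "N > 0" for N
    using that by (simp add: A_def hform_scaleC_right hform_sum_right PF)
  have AA: "hform (A M) (A N) = complex_of_real (c + (1 - c) / real N)" if "M \<le> N" "M > 0" for M N
  proof -
    have "hform (A M) (A N) = complex_of_real (1 / real M) * (\<Sum>n<M. hform (F n) (A N))"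
      by (simp add: A_def[of M] hform_scaleC_left hform_sum_left)
    also have "(\<Sum>n<M. hform (F n) (A N)) = (\<Sum>n<M. complex_of_real (c + (1 - c) / real N))"
      using that by (intro sum.cong) (auto simp: FA)
    also have "\<dots> = complex_of_real (real M) * complex_of_real (c + (1 - c) / real N)"
      by (simp del: of_real_add of_real_divide of_real_diff)
    finally show ?thesis
      using that by (simp only:) (simp add: mult.assoc[symmetric] del: of_real_add of_real_diff)
  qed
  have AA': "hform (A M) (A N) = complex_of_real (c + (1 - c) / real M)" if "N \<le> M" "N > 0" for M N
    using AA[OF that] hform_commute[of "A M" "A N"] by simp
  obtain C where C: "C > 0" "\<And>D. (norm D)\<^sup>2 \<le> C * ((cmod (hform P D))\<^sup>2 + \<bar>Re (hform D D)\<bar>)"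
    using norm_le_hform[OF P] by metis
  \<comment> \<open>All means have the same product with \<open>P\<close>, so in
    \<open>norm_le_hform\<close> only the self-product of the difference survives, which is
    \<open>1 - c\<close> times a difference of reciprocals.\<close>
  have bound: "(norm (A M - A N))\<^sup>2 \<le> C * \<bar>1 - c\<bar> * (1 / real M)" if "M \<le> N" "M > 0" for M N
  proof -
    have "hform P (A M - A N) = 0" using PA that by (simp add: hform_diff_right)
    moreover have "hform (A M - A N) (A M - A N) = complex_of_real ((1 - c) * (1 / real M - 1 / real N))"
      using that by (simp add: hform_diff_right hform_diff_left AA AA' algebra_simps)
    ultimately have "(norm (A M - A N))\<^sup>2 \<le> C * (\<bar>1 - c\<bar> * \<bar>1 / real M - 1 / real N\<bar>)"
      using C(2)[of "A M - A N"] by (simp add: abs_mult)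
    moreover have "\<bar>1 / real M - 1 / real N\<bar> \<le> 1 / real M" using that by (simp add: frac_le abs_le_iff)
    ultimately show ?thesis
      using C(1) by (smt (verit, best) abs_ge_zero mult.assoc mult_left_mono)
  qed
  have "Cauchy A"
  proof (rule CauchyI')
    fix e :: real assume e: "e > 0"
    obtain M :: nat where M: "real M > C * \<bar>1 - c\<bar> / e\<^sup>2" using reals_Archimedean2 by blast
    have "norm (A m - A n) < e" if "m \<ge> Suc M" "n > m" for m n
    proof -
      have "C * \<bar>1 - c\<bar> * (1 / real m) < e\<^sup>2"
      proof -
        have "C * \<bar>1 - c\<bar> / e\<^sup>2 < real m" using M that by linarith
        then show ?thesis using that e by (simp add: field_simps)
      qed
      then have "(norm (A m - A n))\<^sup>2 < e\<^sup>2" using bound[of m n] that by simp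
      then show ?thesis using e by (simp add: power_less_imp_less_base)
    qed
    then show "\<exists>M. \<forall>m\<ge>M. \<forall>n>m. dist (A m) (A n) < e" by (auto simp: dist_norm)
  qed
  then obtain L where L: "A \<longlonglongrightarrow> L" using Cauchy_convergent convergent_def by blast
  have lim: "(\<lambda>N. complex_of_real (c + (1 - c) / real N)) \<longlonglongrightarrow> complex_of_real c"
  proof -
    have "(\<lambda>N. c + (1 - c) * (1 / real N)) \<longlonglongrightarrow> c + (1 - c) * 0"
      by (intro tendsto_intros lim_1_over_n)
    then show ?thesis by (intro tendsto_of_real) simp
  qed
  have "hform (F n) L = complex_of_real c" for n
  proof (rule LIMSEQ_unique)
    show "(\<lambda>N. hform (F n) (A N)) \<longlonglongrightarrow> hform (F n) L" by (intro tendsto_hform L tendsto_const)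
    show "(\<lambda>N. hform (F n) (A N)) \<longlonglongrightarrow> complex_of_real c"
      by (rule Lim_transform_eventually[OF lim])
        (use eventually_gt_at_top[of n] in eventually_elim, simp only: FA)
  qed
  moreover have "hform L L = complex_of_real c"
  proof (rule LIMSEQ_unique)
    show "(\<lambda>N. hform (A N) (A N)) \<longlonglongrightarrow> hform L L" by (intro tendsto_hform L)
    show "(\<lambda>N. hform (A N) (A N)) \<longlonglongrightarrow> complex_of_real c"
      by (rule Lim_transform_eventually[OF lim])
        (use eventually_gt_at_top[of 0] in eventually_elim, simp only: AA order_refl)
  qed
  moreover have "hform P L = b"
  proof (rule LIMSEQ_unique)
    show "(\<lambda>N. hform P (A N)) \<longlonglongrightarrow> hform P L" by (intro tendsto_hform L tendsto_const)
    show "(\<lambda>N. hform P (A N)) \<longlonglongrightarrow> b"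
      by (rule Lim_transform_eventually[OF tendsto_const[of b]])
        (use eventually_gt_at_top[of 0] in eventually_elim, simp only: PA)
  qed
  ultimately show ?thesis using that L by blast
qed


section \<open>Maps equivariant along a self-representation\<close>

text \<open>A unit lift is unique up to a phase. A positive product with the reference vector
  \<open>P\<close> fixes this phase, which makes lifts of different points comparable.\<close>

lemma unit_lift:
  assumes P: "hpositive P" "hform P P = 1"
  obtains X where "hpositive X" "chyp_of X = x" "hform X X = 1"
    "hform P X = complex_of_real (cosh (dist (chyp_of P) x))"
proof -
  obtain Y where Y: "hpositive Y" "x = chyp_of Y" "hform Y Y = 1" by (rule chyp_cases)
  have nz: "hform P Y \<noteq> 0" using hform_nonzero P Y by blast
  define w where "w = cmod (hform P Y) / hform P Y"
  have w: "cmod w = 1" "w \<noteq> 0" "w * hform P Y = cmod (hform P Y)"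
    using nz by (simp_all add: w_def norm_divide)
  have "Re (hform (w *\<^sub>C Y) (w *\<^sub>C Y)) = 1" using w Y by (simp add: Re_hform_scaleC)
  then have "hform (w *\<^sub>C Y) (w *\<^sub>C Y) = 1" by (subst hform_self) simp
  moreover have "cosh (dist (chyp_of P) x) = cmod (hform P Y)"
    using P Y by (simp add: cosh_dist_eq_hcosh hcosh_def)
  ultimately show ?thesis
    using that[of "w *\<^sub>C Y"] Y w chyp_of_scaleC[of Y w] by (simp add: hform_scaleC_right)
qed

lemma cosh_dist_pt:
  assumes "norm u < 1" "norm v < 1"
  shows "cosh (dist (pt u) (pt v)) = cmod (1 - cinner u v) / sqrt ((1 - (norm u)\<^sup>2) * (1 - (norm v)\<^sup>2))"
  unfolding pt_def
  by (subst cosh_dist_eq_hcosh) (use assms in \<open>simp_all add: hpositive_pt hcosh_def Re_hform_pt, simp add: hform_pt\<close>)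

lemma cosh_dist_origin:
  assumes "norm u < 1"
  shows "cosh (dist (pt 0) (pt u)) = 1 / sqrt (1 - (norm u)\<^sup>2)"
  using cosh_dist_pt[of 0 u] assms by simp

lemma tendsto_pt:
  assumes "(u \<longlongrightarrow> v) F" "norm v < 1"
  shows "((\<lambda>i. pt (u i)) \<longlongrightarrow> pt v) F"
  unfolding pt_def by (rule chyp_of_tendsto(1)) (use assms in \<open>auto simp: hpositive_pt intro!: tendsto_intros\<close>)

lemma cartan_arg_cyclic: "cartan_arg x y z = cartan_arg y z x"
proof -
  obtain X Y Z where "hpositive X" "x = chyp_of X" "hpositive Y" "y = chyp_of Y"
    "hpositive Z" "z = chyp_of Z" by (metis chyp_cases)
  then show ?thesis by (simp add: cartan_arg_chyp_of mult_ac)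
qed

lemma cartan_arg_swap: "cartan_arg x z y = - cartan_arg x y z"
proof -
  obtain X Y Z where X: "hpositive X" "x = chyp_of X" "hpositive Y" "y = chyp_of Y"
    "hpositive Z" "z = chyp_of Z" by (metis chyp_cases)
  have "hform X Z * hform Z Y * hform Y X = cnj (hform X Y * hform Y Z * hform Z X)"
    by (simp add: hform_commute[of X Z] hform_commute[of Z Y] hform_commute[of Y X])
  moreover have "Re (hform X Y * hform Y Z * hform Z X) > 0" using Re_triple_pos X by blast
  then have "Arg (cnj (hform X Y * hform Y Z * hform Z X)) = - Arg (hform X Y * hform Y Z * hform Z X)"
    by (subst Arg_cnj) (auto simp: Arg_eq_0)
  ultimately show ?thesis using X by (simp only: cartan_arg_chyp_of)
qed

lemma chyp_of_eqI_hcosh: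
  assumes "hpositive X" "hpositive Y" "hcosh X Y \<le> 1"
  shows "chyp_of X = chyp_of Y"
proof -
  have "hcosh X Y = 1" using assms hcosh_ge_1[of X Y] by simp
  then have "dist (chyp_of X) (chyp_of Y) = 0" using dist_chyp_of[OF assms(1,2)] by simp
  then show ?thesis by simp
qed

lemma Arg_eq_0_imp: "Arg z = 0 \<Longrightarrow> z = complex_of_real (cmod z)"
  using Arg_eq_0[of z] by (auto simp: complex_eq_iff complex_is_Real_iff cmod_eq_Re)

text \<open>\<open>fixed_point\<close> is the uniqueness clause of the canonical orbit, moved to the
  origin of the ball: it identifies a geometrically constructed point as \<open>f (pt 0)\<close>.
  \<open>nonconstant\<close> excludes the exponent zero.\<close>

locale equivariant_map =
  fixes \<rho> :: "('h::complex_hilbert chyp \<Rightarrow> 'h chyp) \<Rightarrow> 'h chyp \<Rightarrow> 'h chyp"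
    and f :: "'h chyp \<Rightarrow> 'h chyp"
  assumes separable: "\<exists>D::'h set. countable D \<and> closure D = UNIV"
    and infinite_dimensional: "\<nexists>S::'h set. finite S \<and> span S = UNIV"
    and hom: "\<rho> \<in> hom Isom Isom"
    and equivariant: "\<And>g x. g \<in> carrier Isom \<Longrightarrow> f (g x) = \<rho> g (f x)"
    and fixed_point: "\<And>y. (\<And>g. g \<in> carrier Isom \<Longrightarrow> g (pt 0) = pt 0 \<Longrightarrow> \<rho> g y = y) \<Longrightarrow> y = f (pt 0)"
    and nonconstant: "\<exists>x y. f x \<noteq> f y"
begin

lemma rho_Isom: "g \<in> carrier Isom \<Longrightarrow> \<rho> g \<in> carrier Isom"
  using hom by (simp add: hom_def Pi_iff)

lemma rho_compose: "g \<in> carrier Isom \<Longrightarrow> h \<in> carrier Isom \<Longrightarrow> \<rho> (g \<circ> h) = \<rho> g \<circ> \<rho> h"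
  using hom by (simp add: hom_def)

text \<open>Triples with equal Gram matrices are related by a product of squares. Its image under
  \<open>\<rho>\<close> is again a product of squares and therefore preserves Cartan arguments as
  well as distances.\<close>

lemma f_gram:
  assumes pos: "hpositive X" "hpositive Y" "hpositive Z"
    and g: "hform X' X' = hform X X" "hform Y' Y' = hform Y Y" "hform Z' Z' = hform Z Z"
      "hform X' Y' = hform X Y" "hform X' Z' = hform X Z" "hform Y' Z' = hform Y Z"
  shows "cartan_arg (f (chyp_of X')) (f (chyp_of Y')) (f (chyp_of Z'))
      = cartan_arg (f (chyp_of X)) (f (chyp_of Y)) (f (chyp_of Z))"
    and "dist (f (chyp_of X')) (f (chyp_of Y')) = dist (f (chyp_of X)) (f (chyp_of Y))"
proof -
  obtain a b c where abc: "a \<in> carrier Isom" "b \<in> carrier Isom" "c \<in> carrier Isom"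
    "(c \<circ> c \<circ> b \<circ> b \<circ> a \<circ> a) (chyp_of X) = chyp_of X'"
    "(c \<circ> c \<circ> b \<circ> b \<circ> a \<circ> a) (chyp_of Y) = chyp_of Y'"
    "(c \<circ> c \<circ> b \<circ> b \<circ> a \<circ> a) (chyp_of Z) = chyp_of Z'"
    by (rule gram_transitive[OF assms])
  have e: "f ((c \<circ> c \<circ> b \<circ> b \<circ> a \<circ> a) x) = \<rho> c (\<rho> c (\<rho> b (\<rho> b (\<rho> a (\<rho> a (f x))))))" for x
    using abc by (simp add: equivariant)
  show "cartan_arg (f (chyp_of X')) (f (chyp_of Y')) (f (chyp_of Z'))
      = cartan_arg (f (chyp_of X)) (f (chyp_of Y)) (f (chyp_of Z))"
    unfolding abc(4-6)[symmetric] e using abc(1-3) by (simp add: cartan_arg_square rho_Isom)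
  have d: "dist (\<rho> k x) (\<rho> k y) = dist x y" if "k \<in> carrier Isom" for k x y
    using rho_Isom[OF that] by (simp add: in_Isom_iff)
  show "dist (f (chyp_of X')) (f (chyp_of Y')) = dist (f (chyp_of X)) (f (chyp_of Y))"
    unfolding abc(4-5)[symmetric] e using abc(1-3) by (simp add: d)
qed

section \<open>The distance transform and the continuity of the orbit map\<close>

lemma dist_f_cong:
  assumes "dist x y = dist x' y'"
  shows "dist (f x) (f y) = dist (f x') (f y')"
proof -
  obtain X where X: "hpositive X" "x = chyp_of X" "hform X X = 1" by (rule chyp_cases)
  obtain Y where Y: "hpositive Y" "chyp_of Y = y" "hform Y Y = 1"
    "hform X Y = complex_of_real (cosh (dist (chyp_of X) y))" by (rule unit_lift[OF X(1,3)])
  obtain X' where X': "hpositive X'" "x' = chyp_of X'" "hform X' X' = 1" by (rule chyp_cases)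
  obtain Y' where Y': "hpositive Y'" "chyp_of Y' = y'" "hform Y' Y' = 1"
    "hform X' Y' = complex_of_real (cosh (dist (chyp_of X') y'))" by (rule unit_lift[OF X'(1,3)])
  show ?thesis
    using f_gram(2)[of X' Y' Y' X Y Y] X Y X' Y' assms by simp
qed

text \<open>The function that expresses \<open>cosh (dist (f x) (f y))\<close> through
  \<open>cosh (dist x y)\<close>. \<open>dist_f_cong\<close> makes it independent of the chosen
  points; arguments below 1 are not attained and get an arbitrary value.\<close>

definition \<Phi> :: "real \<Rightarrow> real"
  where "\<Phi> c = (SOME v. \<exists>x y. cosh (dist x y) = c \<and> v = cosh (dist (f x) (f y)))"

lemma Phi: "cosh (dist (f x) (f y)) = \<Phi> (cosh (dist x y))"
proof -
  have "\<exists>x' y'. cosh (dist x' y') = cosh (dist x y) \<and> \<Phi> (cosh (dist x y)) = cosh (dist (f x') (f y'))"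
    unfolding \<Phi>_def by (rule someI) blast
  then show ?thesis using dist_f_cong by (metis cosh_eq_iff_nonneg zero_le_dist)
qed

lemma unit_vector: obtains e :: 'h where "norm e = 1"
  using orthogonal_unit_exists[OF infinite_dimensional, of "{}"] by auto

text \<open>\<open>r\<close> is the norm, in the ball model, of a point at distance
  \<open>arcosh c\<close> from the origin.\<close>

lemma cosh_attained:
  assumes "c \<ge> 1"
  obtains r where "0 \<le> r" "r < 1" "c = 1 / sqrt (1 - r\<^sup>2)"
proof -
  have "1 / c\<^sup>2 \<le> 1" "1 / c\<^sup>2 > 0" using assms by (simp_all add: power2_eq_square mult_ge1_I)
  then have "0 \<le> sqrt (1 - 1 / c\<^sup>2)" "sqrt (1 - 1 / c\<^sup>2) < 1" "(sqrt (1 - 1 / c\<^sup>2))\<^sup>2 = 1 - 1 / c\<^sup>2" by simp_all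
  then show ?thesis using that[of "sqrt (1 - 1 / c\<^sup>2)"] assms by (simp add: real_sqrt_divide)
qed

text \<open>A close pair whose images are \<open>\<epsilon>\<close> apart serves as the base of an
  isosceles triangle with apex \<open>pt 0\<close> and legs of length \<open>dist x y\<close>. After
  \<open>f\<close> the base is at most twice a leg, so the legs have images at least
  \<open>\<epsilon> / 2\<close> apart.\<close>

lemma f_separation:
  assumes eps: "\<And>\<delta>. \<delta> > 0 \<Longrightarrow> \<exists>x y. dist x y < \<delta> \<and> \<epsilon> \<le> dist (f x) (f y)" and "x \<noteq> y"
  shows "\<epsilon> / 2 \<le> dist (f x) (f y)"
proof -
  define D where "D = dist x y"
  have "D > 0" using assms by (simp add: D_def)
  obtain x0 y0 where xy0: "dist x0 y0 < D" "\<epsilon> \<le> dist (f x0) (f y0)" using eps \<open>D > 0\<close> by blast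
  define a C where "a = cosh D" and "C = cosh (dist x0 y0)"
  have C: "1 \<le> C" "C \<le> a" using xy0(1) \<open>D > 0\<close> by (simp_all add: a_def C_def cosh_real_ge_1 cosh_real_nonneg_le_iff)
  have "a > 1" using \<open>D > 0\<close> cosh_real_nonneg_less_iff[of 0 D] by (simp add: a_def)
  then obtain r where r: "0 \<le> r" "r < 1" "a = 1 / sqrt (1 - r\<^sup>2)" using cosh_attained[of a] by auto
  have "r \<noteq> 0" using r(3) \<open>a > 1\<close> by auto
  then have r2: "0 < r\<^sup>2" "r\<^sup>2 < 1" using r by (auto simp: abs_square_less_1)
  \<comment> \<open>The cosine of the angle at the apex: two points of norm \<open>r\<close> with
    scalar product \<open>r\<^sup>2 * s\<close> have hyperbolic cosine
    \<open>(1 - r\<^sup>2 * s) / (1 - r\<^sup>2)\<close> of their distance, which must be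
    \<open>C\<close>.\<close>
  define s where "s = (1 - C * (1 - r\<^sup>2)) / r\<^sup>2"
  have "C * (1 - r\<^sup>2) \<le> 1"
  proof -
    have "C * (1 - r\<^sup>2) \<le> a * (1 - r\<^sup>2)" using C r2 by (intro mult_right_mono) auto
    also have "\<dots> = sqrt (1 - r\<^sup>2)" using r2 real_div_sqrt[of "1 - r\<^sup>2"] by (simp add: r(3))
    also have "\<dots> \<le> 1" by simp
    finally show ?thesis .
  qed
  then have "0 \<le> 1 - C * (1 - r\<^sup>2)" by simp
  moreover have "1 - C * (1 - r\<^sup>2) \<le> r\<^sup>2"
  proof -
    have "1 * (1 - r\<^sup>2) \<le> C * (1 - r\<^sup>2)" using C r2 by (intro mult_right_mono) auto
    moreover define t where "t = C * (1 - r\<^sup>2)"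
    ultimately have "1 - r\<^sup>2 \<le> t" by (simp only: mult_1_left)
    then show ?thesis unfolding t_def[symmetric] by linarith
  qed
  ultimately have s: "0 \<le> s" "s \<le> 1" unfolding s_def using r2 divide_le_eq_1_pos by (auto intro: divide_nonneg_pos)
  obtain e1 :: 'h where e1: "norm e1 = 1" by (rule unit_vector)
  obtain e2 where e2: "norm e2 = 1" "cinner e1 e2 = 0"
    using orthogonal_unit_exists[OF infinite_dimensional, of "{e1}"] by (metis finite.emptyI finite_insert insertI1)
  have e21: "cinner e2 e1 = 0" using e2 cinner_commute[of e2 e1] by simp
  define u where "u = complex_of_real r *\<^sub>C e1"
  define v where "v = complex_of_real (r * s) *\<^sub>C e1 + complex_of_real (r * sqrt (1 - s\<^sup>2)) *\<^sub>C e2"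
  have nu: "norm u = r" using e1 r by (simp add: u_def norm_scaleC)
  have s2: "s\<^sup>2 \<le> 1" using s by (simp add: power_le_one)
  have "cinner v v = complex_of_real (r * s) * complex_of_real (r * s)
      + complex_of_real (r * sqrt (1 - s\<^sup>2)) * complex_of_real (r * sqrt (1 - s\<^sup>2))"
    using e1 e2 e21 by (simp add: v_def cinner_add_left cinner_add_right cinner_scaleC_left cinner_scaleC_right cinner_self[of e1] cinner_self[of e2])
  also have "\<dots> = complex_of_real (r\<^sup>2)"
  proof -
    have "(r * s) * (r * s) + (r * sqrt (1 - s\<^sup>2)) * (r * sqrt (1 - s\<^sup>2)) = r\<^sup>2 * (s\<^sup>2 + (sqrt (1 - s\<^sup>2))\<^sup>2)"
      by (simp add: power2_eq_square algebra_simps)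
    also have "\<dots> = r\<^sup>2" using s2 by simp
    finally show ?thesis by (simp only: of_real_mult[symmetric] of_real_add[symmetric])
  qed
  finally have "(norm v)\<^sup>2 = r\<^sup>2" by (simp add: cinner_self flip: of_real_power)
  then have nv: "norm v = r" using r by (simp add: power2_eq_iff_nonneg)
  have uv: "cinner u v = complex_of_real (r\<^sup>2 * s)"
    using e1 e2 by (simp add: u_def v_def cinner_add_right cinner_scaleC_left cinner_scaleC_right cinner_self[of e1] power2_eq_square)
  have "cosh (dist (pt u) (pt v)) = C"
  proof -
    have "1 - r\<^sup>2 * s = C * (1 - r\<^sup>2)" using r2 by (simp add: s_def)
    then have "1 - complex_of_real (r\<^sup>2 * s) = complex_of_real (C * (1 - r\<^sup>2))"
      by (metis of_real_1 of_real_diff)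
    then have "cmod (1 - complex_of_real (r\<^sup>2 * s)) = C * (1 - r\<^sup>2)"
      using C r2 by (simp only: norm_of_real) simp
    then show ?thesis using r r2 by (simp add: cosh_dist_pt nu nv uv)
  qed
  then have d0: "dist (pt u) (pt v) = dist x0 y0" by (simp add: C_def cosh_eq_iff_nonneg)
  have "dist (pt 0) (pt u) = D" "dist (pt 0) (pt v) = D"
  proof -
    have "cosh (dist (pt 0) (pt u)) = cosh D" "cosh (dist (pt 0) (pt v)) = cosh D"
      unfolding a_def[symmetric] r(3) by (rule cosh_dist_origin[of u, unfolded nu, OF r(2)]
        cosh_dist_origin[of v, unfolded nv, OF r(2)])+
    then show "dist (pt 0) (pt u) = D" "dist (pt 0) (pt v) = D"
      using \<open>D > 0\<close> cosh_eq_iff_nonneg[of "dist (pt 0) (pt u)" D]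
        cosh_eq_iff_nonneg[of "dist (pt 0) (pt v)" D] by simp_all
  qed
  then have fD: "dist (f (pt 0)) (f (pt u)) = dist (f x) (f y)" "dist (f (pt 0)) (f (pt v)) = dist (f x) (f y)"
    unfolding D_def by - (rule dist_f_cong, assumption)+
  have "\<epsilon> \<le> dist (f (pt u)) (f (pt v))" using dist_f_cong[OF d0] xy0(2) by simp
  also have "\<dots> \<le> dist (f (pt 0)) (f (pt u)) + dist (f (pt 0)) (f (pt v))" by (metis dist_commute dist_triangle)
  also have "\<dots> = dist (f x) (f y) + dist (f x) (f y)" by (simp only: fD)
  finally show ?thesis by simp
qed

text \<open>Otherwise \<^term>\<open>f\<close> would have an uncountable uniformly discrete image in a separable space.\<close>
lemma f_uniformly_continuous:
  assumes "\<epsilon> > 0"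
  shows "\<exists>\<delta>>0. \<forall>x y. dist x y < \<delta> \<longrightarrow> dist (f x) (f y) < \<epsilon>"
proof (rule ccontr)
  assume "\<not> ?thesis"
  then have "\<exists>x y. dist x y < \<delta> \<and> \<epsilon> \<le> dist (f x) (f y)" if "\<delta> > 0" for \<delta>
    using that by (meson not_le)
  then have sep: "\<epsilon> / 2 \<le> dist (f x) (f y)" if "x \<noteq> y" for x y using f_separation that by blast
  obtain D :: "'h set" where D: "countable D" "closure D = UNIV" using separable by blast
  obtain Q :: "complex set" where Q: "countable Q" "\<And>X. open X \<Longrightarrow> X \<noteq> {} \<Longrightarrow> \<exists>d\<in>Q. d \<in> X"
    using countable_dense_exists by blast
  obtain e :: 'h where e: "norm e = 1" by (rule unit_vector)
  \<comment> \<open>Vectors with coordinates in the countable dense sets \<open>Q\<close> and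
    \<open>D\<close> approximate every lift, hence every point.\<close>
  have near: "\<exists>d\<in>Q \<times> D. hpositive d \<and> dist (chyp_of d) x < \<epsilon> / 4" for x
  proof (rule ccontr)
    assume far: "\<not> ?thesis"
    obtain X where X: "hpositive X" "x = chyp_of X" by (metis chyp_cases)
    have "\<exists>d\<in>Q \<times> D. dist d X < 1 / real (Suc n)" for n
    proof -
      obtain q where q: "q \<in> Q" "dist q (fst X) < 1 / (2 * real (Suc n))"
        using Q(2)[of "ball (fst X) (1 / (2 * real (Suc n)))"] by (auto simp: dist_commute)
      obtain d where d: "d \<in> D" "dist d (snd X) < 1 / (2 * real (Suc n))"
        using D(2) closure_approachable[of "snd X" D] by (metis UNIV_I divide_pos_pos less_numeral_extra(1) mult_pos_pos of_nat_0_less_iff zero_less_Suc zero_less_numeral)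
      have "dist (q, d) X \<le> dist q (fst X) + dist d (snd X)"
        unfolding dist_prod_def by (simp add: sqrt_sum_squares_le_sum)
      also have "\<dots> < 1 / real (Suc n)" using q(2) d(2) by (simp add: field_simps)
      finally show ?thesis using q d by blast
    qed
    then obtain d where d: "\<And>n. d n \<in> Q \<times> D" "\<And>n. dist (d n) X < 1 / real (Suc n)" by metis
    have "(\<lambda>n. dist (d n) X) \<longlonglongrightarrow> 0"
      by (rule tendsto_sandwich[OF _ _ tendsto_const LIMSEQ_inverse_real_of_nat])
        (use d(2) in \<open>auto simp: inverse_eq_divide intro!: always_eventually less_imp_le\<close>)
    then have "d \<longlonglongrightarrow> X" using tendsto_dist_iff by blast
    note t = chyp_of_tendsto[OF this X(1)]
    have "\<forall>\<^sub>F n in sequentially. hpositive (d n) \<and> dist (chyp_of (d n)) x < \<epsilon> / 4"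
      using t(2) tendstoD[OF t(1), of "\<epsilon> / 4"] assms X(2) by (intro eventually_conj) auto
    then obtain n where "hpositive (d n) \<and> dist (chyp_of (d n)) x < \<epsilon> / 4"
      by (auto simp: eventually_sequentially)
    then show False using far d(1) by blast
  qed
  \<comment> \<open>A radius of the ball has uncountably many points. Their images are at least
    \<open>\<epsilon> / 2\<close> apart, so approximants within \<open>\<epsilon> / 4\<close> are
    pairwise different, although only countably many are available.\<close>
  define p where "p s = f (pt (complex_of_real s *\<^sub>C e))" for s
  have "\<exists>d. \<forall>s. d s \<in> Q \<times> D \<and> dist (chyp_of (d s)) (p s) < \<epsilon> / 4"
    by (rule choice) (use near in blast)
  then obtain d where d: "\<And>s. d s \<in> Q \<times> D" "\<And>s. dist (chyp_of (d s)) (p s) < \<epsilon> / 4" by blast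
  have "inj_on d {0..<1}"
  proof (rule inj_onI)
    fix s s' assume s: "s \<in> {0..<1}" "s' \<in> {0..<1}" "d s = d s'"
    have "dist (p s) (p s') < \<epsilon> / 4 + \<epsilon> / 4"
      using d(2)[of s] d(2)[of s'] s(3) by (metis add_strict_mono dist_commute dist_triangle le_less_trans)
    then have "pt (complex_of_real s *\<^sub>C e) = pt (complex_of_real s' *\<^sub>C e)"
      unfolding p_def using sep by (metis add_divide_distrib field_sum_of_halves less_le_not_le mult_2 not_le_imp_less numeral_Bit0 divide_divide_eq_left)
    then have "complex_of_real s *\<^sub>C e = complex_of_real s' *\<^sub>C e"
      using s by (intro pt_inject) (auto simp: norm_scaleC e)
    then have "complex_of_real (s - s') *\<^sub>C e = 0" by (simp add: scaleC_diff_left)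
    then show "s = s'" using e by auto
  qed
  moreover have "countable (d ` {0..<1})"
    by (rule countable_subset[of _ "Q \<times> D"]) (use d(1) D(1) Q(1) in \<open>blast, intro countable_SIGMA\<close>)
  ultimately have "countable {0..<1::real}" by (metis countable_image_inj_on)
  then show False using uncountable_half_open_interval_1[of 0 1] by simp
qed

lemma f_tendsto:
  assumes "(x \<longlongrightarrow> y) F"
  shows "((\<lambda>i. f (x i)) \<longlongrightarrow> f y) F"
proof (rule tendstoI)
  fix \<epsilon> :: real assume "\<epsilon> > 0"
  then obtain \<delta> where "\<delta> > 0" "\<And>x y. dist x y < \<delta> \<Longrightarrow> dist (f x) (f y) < \<epsilon>"
    using f_uniformly_continuous by blast
  then show "\<forall>\<^sub>F i in F. dist (f (x i)) (f y) < \<epsilon>"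
    using tendstoD[OF assms, of \<delta>] by (auto elim: eventually_mono)
qed

lemma Phi_tendsto:
  assumes c: "(c \<longlongrightarrow> c0) F" and ge: "\<And>i. c i \<ge> 1" "c0 \<ge> 1"
  shows "((\<lambda>i. \<Phi> (c i)) \<longlongrightarrow> \<Phi> c0) F"
proof -
  obtain e :: 'h where e: "norm e = 1" by (rule unit_vector)
  define u where "u c = sqrt (1 - 1 / c\<^sup>2) *\<^sub>R e" for c
  have nu: "norm (u c) < 1" "(norm (u c))\<^sup>2 = 1 - 1 / c\<^sup>2" if "c \<ge> 1" for c
  proof -
    have "1 / c\<^sup>2 \<le> 1" "1 / c\<^sup>2 > 0" using that by (simp_all add: power2_eq_square mult_ge1_I)
    then show "(norm (u c))\<^sup>2 = 1 - 1 / c\<^sup>2" "norm (u c) < 1" by (simp_all add: u_def e)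
  qed
  have P: "\<Phi> c = cosh (dist (f (pt 0)) (f (pt (u c))))" if "c \<ge> 1" for c
    using that nu[OF that] Phi[of "pt 0" "pt (u c)"] by (simp add: cosh_dist_origin real_sqrt_divide)
  have "((\<lambda>i. u (c i)) \<longlongrightarrow> u c0) F"
    unfolding u_def using c ge by (intro tendsto_intros) auto
  then have "((\<lambda>i. cosh (dist (f (pt 0)) (f (pt (u (c i)))))) \<longlongrightarrow> cosh (dist (f (pt 0)) (f (pt (u c0))))) F"
    using nu ge by (intro tendsto_cosh tendsto_dist tendsto_const f_tendsto tendsto_pt) auto
  then show ?thesis using P ge by simp
qed

end


section \<open>The distance of image points\<close>

context equivariant_map
begin

lemma f_pt_gram:
  assumes "norm u < 1" "norm v < 1" "norm u' = norm u" "norm v' = norm v" "cinner u' v' = cinner u v"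
  shows "cartan_arg (f (pt 0)) (f (pt u')) (f (pt v')) = cartan_arg (f (pt 0)) (f (pt u)) (f (pt v))"
  unfolding pt_def
  by (rule f_gram(1)) (use assms in \<open>simp_all add: hpositive_pt hform_pt cinner_self\<close>)

text \<open>
  The mean of the points of an infinite orthonormal simplex centred at the origin is the centre of
  the smallest ball containing the image of a sphere, so it is fixed by the stabiliser of the
  origin.
\<close>
lemma simplex_centre:
  assumes r: "0 \<le> r" "r < 1" and e: "\<And>m n. cinner (e m) (e n) = (if m = n then 1 else 0)"
    and P: "hpositive P" "hform P P = 1" "chyp_of P = f (pt 0)"
    and b0: "b > 0" and F: "\<And>n. hpositive (F n)" "\<And>n. chyp_of (F n) = f (pt (r *\<^sub>R e n))" "\<And>n. hform (F n) (F n) = 1"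
      "\<And>n. hform P (F n) = complex_of_real b"
  shows "(\<lambda>N. complex_of_real (1 / real N) *\<^sub>C (\<Sum>n<N. F n)) \<longlonglongrightarrow> complex_of_real b *\<^sub>C P"
    and "b\<^sup>2 = \<Phi> (1 / (1 - r\<^sup>2))"
proof -
  have ne: "norm (e n) = 1" for n
    using e[of n n] norm_ge_zero[of "e n"] unfolding cinner_self by (auto simp: power2_eq_1_iff simp flip: of_real_power)
  have nre: "norm (r *\<^sub>R e n) = r" for n using r by (simp add: ne)
  have r2: "r\<^sup>2 < 1" using r by (simp add: abs_square_less_1)
  have cre: "cinner (r *\<^sub>R e m) (r *\<^sub>R e n) = 0" if "m \<noteq> n" for m n
    using that by (simp add: scaleC_of_real[symmetric] cinner_scaleC_left cinner_scaleC_right e)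
  define c where "c = \<Phi> (1 / (1 - r\<^sup>2))"
  have cosh_f: "cosh (dist (f (pt u)) (f (pt v))) = \<Phi> (cmod (1 - cinner u v) / (1 - r\<^sup>2))"
    if "norm u = r" "norm v = r" for u v
    using that r r2 by (simp add: Phi cosh_dist_pt)
  have FF: "hform (F m) (F n) = (if m = n then 1 else complex_of_real c)" for m n
  proof (cases "m = n")
    case False
    \<comment> \<open>Exchanging two vertices of the simplex keeps the Gram matrix but negates the
      Cartan argument, which is therefore zero. With the phases fixed by \<open>P\<close>, the
      product of the two lifts is then positive.\<close>
    have "cartan_arg (f (pt 0)) (f (pt (r *\<^sub>R e m))) (f (pt (r *\<^sub>R e n)))
        = cartan_arg (f (pt 0)) (f (pt (r *\<^sub>R e n))) (f (pt (r *\<^sub>R e m)))"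
      by (rule f_pt_gram) (use r False in \<open>simp_all only: nre cre[OF False] cre[OF False[symmetric]]\<close>)
    then have "cartan_arg (f (pt 0)) (f (pt (r *\<^sub>R e m))) (f (pt (r *\<^sub>R e n))) = 0"
      by (simp add: cartan_arg_swap[of "f (pt 0)" "f (pt (r *\<^sub>R e n))"])
    then have "Arg (hform P (F m) * hform (F m) (F n) * hform (F n) P) = 0"
      using cartan_arg_chyp_of[OF P(1) F(1)[of m] F(1)[of n]] unfolding P(3) F(2) by simp
    moreover have "hform (F n) P = complex_of_real b" using F(4)[of n] hform_commute[of "F n" P] by simp
    ultimately have "Arg (complex_of_real b * hform (F m) (F n) * complex_of_real b) = 0" by (simp add: F(4))
    then have "Arg (hform (F m) (F n)) = 0" using b0 by simp
    then have "hform (F m) (F n) = complex_of_real (cmod (hform (F m) (F n)))" by (rule Arg_eq_0_imp)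
    also have "cmod (hform (F m) (F n)) = cosh (dist (chyp_of (F m)) (chyp_of (F n)))"
      by (simp add: cosh_dist_eq_hcosh F(1,3) hcosh_def)
    also have "\<dots> = c" using cosh_f[OF nre nre] cre[OF False] by (simp add: F(2) c_def)
    finally show ?thesis using False by simp
  qed (simp add: F)
  obtain L where L: "(\<lambda>N. complex_of_real (1 / real N) *\<^sub>C (\<Sum>n<N. F n)) \<longlonglongrightarrow> L"
    "\<And>n. hform (F n) L = complex_of_real c" "hform L L = complex_of_real c" "hform P L = complex_of_real b"
    using equiangular_mean_converges[OF P(1) F(4) FF] by metis
  have "c = cosh (dist (f (pt (r *\<^sub>R e 0))) (f (pt (r *\<^sub>R e 1))))"
    using cosh_f[OF nre nre] cre[of 0 1] by (simp add: c_def)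
  then have c: "c \<ge> 1" by (simp add: cosh_real_ge_1)
  then have Lp: "hpositive L" by (simp add: L hpositive_def)
  \<comment> \<open>The vectors \<open>e n\<close> become orthogonal to any fixed \<open>w\<close>,
    so the products of \<open>F n\<close> with a lift of \<open>f (pt w)\<close> tend to
    \<open>c\<close> in modulus. Their Cesaro means bound \<open>cmod (hform L W)\<close> by
    \<open>c\<close>, and dividing by the length \<open>sqrt c\<close> of \<open>L\<close> gives the
    radius.\<close>
  have near: "cosh (dist (chyp_of L) (f (pt w))) \<le> sqrt c" if w: "norm w = r" for w
  proof -
    obtain W where W: "hpositive W" "f (pt w) = chyp_of W" "hform W W = 1" by (rule chyp_cases)
    define a where "a n = \<Phi> (cmod (1 - cinner (r *\<^sub>R e n) w) / (1 - r\<^sup>2))" for n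
    have FW: "cmod (hform (F n) W) = a n" for n
    proof -
      have "cmod (hform (F n) W) = cosh (dist (chyp_of (F n)) (chyp_of W))"
        by (simp add: cosh_dist_eq_hcosh F(1,3) W(1,3) hcosh_def)
      then show ?thesis using cosh_f[OF nre w] by (simp add: F(2) W(2)[symmetric] a_def)
    qed
    have "(\<lambda>n. cinner (e n) w) \<longlonglongrightarrow> 0" by (rule orthonormal_weakly_null[OF e])
    then have "(\<lambda>n. complex_of_real r * cinner (e n) w) \<longlonglongrightarrow> complex_of_real r * 0" by (intro tendsto_intros)
    then have "(\<lambda>n. cinner (r *\<^sub>R e n) w) \<longlonglongrightarrow> 0"
      by (simp add: scaleC_of_real[symmetric] cinner_scaleC_left)
    then have "(\<lambda>n. cmod (1 - cinner (r *\<^sub>R e n) w) / (1 - r\<^sup>2)) \<longlonglongrightarrow> cmod (1 - 0) / (1 - r\<^sup>2)"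
      using r2 by (intro tendsto_intros) auto
    moreover have "1 \<le> cmod (1 - cinner (r *\<^sub>R e n) w) / (1 - r\<^sup>2)" for n
      using cosh_real_ge_1[of "dist (pt (r *\<^sub>R e n)) (pt w)"] cosh_dist_pt[of "r *\<^sub>R e n" w] r r2
      by (simp add: nre w del: norm_scaleR)
    moreover have "1 \<le> 1 / (1 - r\<^sup>2)" using r2 by simp
    ultimately have "a \<longlonglongrightarrow> c"
      unfolding a_def c_def using Phi_tendsto[of "\<lambda>n. cmod (1 - cinner (r *\<^sub>R e n) w) / (1 - r\<^sup>2)" "1 / (1 - r\<^sup>2)"]
      by simp
    then have mean: "(\<lambda>N. (\<Sum>n<N. a n) / real N) \<longlonglongrightarrow> c" by (rule cesaro_mean_tendsto)
    have lim: "(\<lambda>N. cmod (hform (complex_of_real (1 / real N) *\<^sub>C (\<Sum>n<N. F n)) W)) \<longlonglongrightarrow> cmod (hform L W)"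
      by (intro tendsto_norm tendsto_hform L(1) tendsto_const)
    have "cmod (hform L W) \<le> c"
    proof (rule LIMSEQ_le[OF lim mean], intro exI allI impI)
      fix N :: nat
      have "cmod (\<Sum>n<N. hform (F n) W) \<le> (\<Sum>n<N. a n)"
        by (rule order_trans[OF norm_sum]) (simp add: FW)
      then show "cmod (hform (complex_of_real (1 / real N) *\<^sub>C (\<Sum>n<N. F n)) W) \<le> (\<Sum>n<N. a n) / real N"
        by (simp add: hform_scaleC_left hform_sum_left norm_mult norm_divide divide_right_mono)
    qed
    then have "cmod (hform L W) / sqrt c \<le> c / sqrt c" using c by (intro divide_right_mono) auto
    also have "\<dots> = sqrt c" using c by (simp add: real_div_sqrt)
    finally show ?thesis using c by (simp add: W cosh_dist_eq_hcosh Lp hcosh_def L)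
  qed
  \<comment> \<open>A point this close to all vertices has a unit lift \<open>Z\<close> with
    \<open>cmod (hform Z L) \<le> sqrt c\<close>, since \<open>L\<close> is the limit of means. As
    \<open>hform L L = c\<close>, this says \<open>hcosh Z L \<le> 1\<close>.\<close>
  have unique: "z = chyp_of L" if z: "\<And>n. cosh (dist z (f (pt (r *\<^sub>R e n)))) \<le> sqrt c" for z
  proof -
    obtain Z where Z: "hpositive Z" "z = chyp_of Z" "hform Z Z = 1" by (rule chyp_cases)
    have ZF: "cmod (hform Z (F n)) \<le> sqrt c" for n
      using z[of n] by (simp add: Z F(2)[symmetric] cosh_dist_eq_hcosh F(1,3) hcosh_def)
    have lim: "(\<lambda>N. cmod (hform Z (complex_of_real (1 / real N) *\<^sub>C (\<Sum>n<N. F n)))) \<longlonglongrightarrow> cmod (hform Z L)"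
      by (intro tendsto_norm tendsto_hform L(1) tendsto_const)
    have "cmod (hform Z L) \<le> sqrt c"
    proof (rule LIMSEQ_le_const2[OF lim], intro exI allI impI)
      fix N :: nat assume "1 \<le> N"
      have "cmod (\<Sum>n<N. hform Z (F n)) \<le> (\<Sum>n<N. cmod (hform Z (F n)))" by (rule norm_sum)
      also have "\<dots> \<le> real N * sqrt c" using sum_bounded_above[of "{..<N}" _ "sqrt c"] ZF by simp
      finally show "cmod (hform Z (complex_of_real (1 / real N) *\<^sub>C (\<Sum>n<N. F n))) \<le> sqrt c"
        using \<open>1 \<le> N\<close> by (simp add: hform_scaleC_right hform_sum_right norm_mult norm_divide field_simps)
    qed
    then have "hcosh Z L \<le> 1" using c by (simp add: hcosh_def Z L)
    then show ?thesis using chyp_of_eqI_hcosh Z Lp by blast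
  qed
  have "chyp_of L = f (pt 0)"
  proof (rule fixed_point)
    fix g :: "'h chyp \<Rightarrow> 'h chyp" assume g: "g \<in> carrier Isom" "g (pt 0) = pt 0"
    define h where "h = inv_into UNIV g"
    have h: "h \<in> carrier Isom" "\<And>x. g (h x) = x" "h (pt 0) = pt 0"
      using Isom_inv_into[OF g(1)] g(2) unfolding h_def by metis+
    show "\<rho> g (chyp_of L) = chyp_of L"
    proof (rule unique)
      fix n
      \<comment> \<open>The inverse \<open>h\<close> of \<open>g\<close> moves a vertex to another
        point of the same sphere. There the bound \<open>near\<close> applies, whether or not the
        point is a vertex.\<close>
      obtain w where w: "norm w < 1" "h (pt (r *\<^sub>R e n)) = pt w" by (rule pt_cases)
      have "dist (pt 0) (pt w) = dist (pt 0) (pt (r *\<^sub>R e n))"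
        using h(1,3) w(2) by (metis in_Isom_iff)
      then have "sqrt (1 - (norm w)\<^sup>2) = sqrt (1 - r\<^sup>2)"
        using cosh_dist_origin[of w] cosh_dist_origin[of "r *\<^sub>R e n"] w r by (simp add: nre del: norm_scaleR)
      then have "norm w = r" using r by (simp add: power2_eq_iff_nonneg)
      have "dist (\<rho> g (chyp_of L)) (f (pt (r *\<^sub>R e n))) = dist (\<rho> g (chyp_of L)) (\<rho> g (f (pt w)))"
        using equivariant[OF g(1), of "pt w"] h(2) w(2) by metis
      also have "\<dots> = dist (chyp_of L) (f (pt w))" using rho_Isom[OF g(1)] by (simp add: in_Isom_iff)
      finally show "cosh (dist (\<rho> g (chyp_of L)) (f (pt (r *\<^sub>R e n)))) \<le> sqrt c"
        using near[OF \<open>norm w = r\<close>] by simp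
    qed
  qed
  then obtain k where k: "k \<noteq> 0" "L = k *\<^sub>C P" using chyp_of_eq_iff[OF P(1) Lp] P(3) by auto
  then have "k = complex_of_real b" using L(4) P(2) by (simp add: hform_scaleC_right)
  then have LbP: "L = complex_of_real b *\<^sub>C P" using k by simp
  then show "(\<lambda>N. complex_of_real (1 / real N) *\<^sub>C (\<Sum>n<N. F n)) \<longlonglongrightarrow> complex_of_real b *\<^sub>C P"
    using L(1) by simp
  have "hform L L = complex_of_real (b\<^sup>2)"
    by (simp add: LbP hform_scaleC_left hform_scaleC_right P power2_eq_square)
  then show "b\<^sup>2 = \<Phi> (1 / (1 - r\<^sup>2))" unfolding L(3) c_def of_real_eq_iff by simp
qed

text \<open>Replacing \<open>u\<close> by vectors of the same norm orthogonal to \<open>w\<close>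
  does not change the Gram matrix, so all \<open>F n\<close> have the same product with
  \<open>W\<close>. The means tend to \<open>b\<close> times \<open>P\<close>, hence this product is
  the positive number \<open>b * b'\<close>: its modulus is the first claim and its argument the
  second.\<close>

lemma orthogonal_points:
  assumes "norm u < 1" "norm w < 1" "cinner u w = 0"
  shows "cosh (dist (f (pt u)) (f (pt w))) = cosh (dist (f (pt 0)) (f (pt u))) * cosh (dist (f (pt 0)) (f (pt w)))"
    and "cartan_arg (f (pt 0)) (f (pt u)) (f (pt w)) = 0"
proof -
  define r where "r = norm u"
  have r: "0 \<le> r" "r < 1" using assms by (simp_all add: r_def)
  \<comment> \<open>Orthogonality to \<open>w\<close> gives every triple of \<open>pt 0\<close>,
    \<open>pt (r *\<^sub>R e n)\<close> and \<open>pt w\<close> the Gram matrix of the original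
    one.\<close>
  obtain e where e: "\<And>m n. cinner (e m) (e (n::nat)) = (if m = n then 1 else 0)"
    and ew: "\<And>n. cinner (e n) w = 0"
    using orthonormal_sequence_exists[OF infinite_dimensional, of "{w}"] by (metis finite.emptyI finite_insert insertI1)
  obtain P where P: "hpositive P" "f (pt 0) = chyp_of P" "hform P P = 1" by (rule chyp_cases)
  define b where "b = cosh (dist (f (pt 0)) (f (pt u)))"
  define b' where "b' = cosh (dist (f (pt 0)) (f (pt w)))"
  have ne: "norm (e n) = 1" for n
    using e[of n n] norm_ge_zero[of "e n"] unfolding cinner_self by (auto simp: power2_eq_1_iff simp flip: of_real_power)
  have nre: "norm (r *\<^sub>R e n) = r" for n using r by (simp add: ne)
  have cre: "cinner (r *\<^sub>R e n) w = 0" for n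
    by (simp add: scaleC_of_real[symmetric] cinner_scaleC_left ew)
  have b_eq: "cosh (dist (chyp_of P) (f (pt (r *\<^sub>R e n)))) = b" for n
    unfolding b_def P(2)[symmetric] Phi using cosh_dist_origin[of u] cosh_dist_origin[of "r *\<^sub>R e n"] r
    by (simp add: nre r_def[symmetric] del: norm_scaleR)
  have "\<exists>X. hpositive X \<and> chyp_of X = f (pt (r *\<^sub>R e n)) \<and> hform X X = 1 \<and> hform P X = complex_of_real b" for n
    using unit_lift[OF P(1,3), of "f (pt (r *\<^sub>R e n))"] b_eq by metis
  then obtain F where F: "\<And>n. hpositive (F n)" "\<And>n. chyp_of (F n) = f (pt (r *\<^sub>R e n))"
    "\<And>n. hform (F n) (F n) = 1" "\<And>n. hform P (F n) = complex_of_real b" by metis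
  obtain W where W: "hpositive W" "chyp_of W = f (pt w)" "hform W W = 1" "hform P W = complex_of_real b'"
    using unit_lift[OF P(1,3), of "f (pt w)"] unfolding P(2)[symmetric] b'_def by metis
  have bpos: "b > 0" "b' > 0" by (simp_all add: b_def b'_def)
  have WP: "hform W P = complex_of_real b'" using W(4) hform_commute[of W P] by simp
  define \<theta> where "\<theta> = cartan_arg (f (pt 0)) (f (pt u)) (f (pt w))"
  have "hform (F n) W = complex_of_real (cosh (dist (f (pt u)) (f (pt w)))) * cis \<theta>" for n
  proof -
    have "cmod (hform (F n) W) = cosh (dist (chyp_of (F n)) (chyp_of W))"
      by (simp add: cosh_dist_eq_hcosh F(1,3) W(1,3) hcosh_def)
    also have "\<dots> = cosh (dist (f (pt u)) (f (pt w)))"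
      unfolding F(2) W(2) Phi using cosh_dist_pt[of u w] cosh_dist_pt[of "r *\<^sub>R e n" w] assms r
      by (simp add: cre nre r_def[symmetric] del: norm_scaleR)
    finally have m: "cmod (hform (F n) W) = cosh (dist (f (pt u)) (f (pt w)))" .
    have "\<theta> = cartan_arg (f (pt 0)) (f (pt (r *\<^sub>R e n))) (f (pt w))"
      unfolding \<theta>_def by (rule f_pt_gram) (use assms r in \<open>simp_all add: nre cre r_def[symmetric] del: norm_scaleR\<close>)
    also have "\<dots> = Arg (complex_of_real b * hform (F n) W * complex_of_real b')"
      using cartan_arg_chyp_of[OF P(1) F(1)[of n] W(1)] unfolding F(2) W(2) P(2)[symmetric]
      by (simp add: F(4) WP)
    also have "\<dots> = Arg (hform (F n) W)" using bpos by simp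
    finally show ?thesis
      using m rcis_cmod_Arg[of "hform (F n) W"] by (simp add: rcis_def)
  qed
  then have FW: "hform (F n) W = complex_of_real (cosh (dist (f (pt u)) (f (pt w)))) * cis \<theta>" for n .
  note sc = simplex_centre[OF r e P(1,3) P(2)[symmetric] bpos(1) F]
  have lim: "(\<lambda>N. hform (complex_of_real (1 / real N) *\<^sub>C (\<Sum>n<N. F n)) W) \<longlonglongrightarrow> hform (complex_of_real b *\<^sub>C P) W"
    by (intro tendsto_hform sc tendsto_const)
  have ev: "\<forall>\<^sub>F N in sequentially. hform (complex_of_real (1 / real N) *\<^sub>C (\<Sum>n<N. F n)) W
      = complex_of_real (cosh (dist (f (pt u)) (f (pt w)))) * cis \<theta>"
    using eventually_gt_at_top[of 0]
    by eventually_elim (simp add: hform_scaleC_left hform_sum_left FW)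
  have "hform (complex_of_real b *\<^sub>C P) W = complex_of_real (cosh (dist (f (pt u)) (f (pt w)))) * cis \<theta>"
    by (rule LIMSEQ_unique[OF lim tendsto_eventually[OF ev]])
  then have eq: "complex_of_real (b * b') = complex_of_real (cosh (dist (f (pt u)) (f (pt w)))) * cis \<theta>"
    by (simp add: hform_scaleC_left W(4))
  then have "cmod (complex_of_real (b * b')) = cosh (dist (f (pt u)) (f (pt w)))"
    by (simp add: norm_mult)
  then have "b * b' = cosh (dist (f (pt u)) (f (pt w)))"
    using bpos by (simp only: norm_of_real) simp
  then show "cosh (dist (f (pt u)) (f (pt w))) = cosh (dist (f (pt 0)) (f (pt u))) * cosh (dist (f (pt 0)) (f (pt w)))"
    by (simp add: b_def b'_def)
  have "Arg (complex_of_real (b * b')) = Arg (cis \<theta>)" unfolding eq by simp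
  moreover have "Arg (complex_of_real (b * b')) = 0" using bpos by (subst Arg_eq_0) (simp add: zero_le_mult_iff)
  moreover have "Arg (cis \<theta>) = \<theta>"
    using cartan_arg_bound[of "f (pt 0)" "f (pt u)" "f (pt w)"] pi_gt_zero by (intro Arg_cis) (auto simp: \<theta>_def)
  ultimately show "cartan_arg (f (pt 0)) (f (pt u)) (f (pt w)) = 0" by (simp add: \<theta>_def)
qed

section \<open>The exponent of the distance transform\<close>

lemma Phi_mult:
  assumes "a \<ge> 1" "b \<ge> 1"
  shows "\<Phi> (a * b) = \<Phi> a * \<Phi> b"
proof -
  obtain r where r: "0 \<le> r" "r < 1" "a = 1 / sqrt (1 - r\<^sup>2)" using cosh_attained[OF assms(1)] .
  obtain s where s: "0 \<le> s" "s < 1" "b = 1 / sqrt (1 - s\<^sup>2)" using cosh_attained[OF assms(2)] .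
  obtain e1 :: 'h where e1: "norm e1 = 1" by (rule unit_vector)
  obtain e2 where e2: "norm e2 = 1" "cinner e1 e2 = 0"
    using orthogonal_unit_exists[OF infinite_dimensional, of "{e1}"] by (metis finite.emptyI finite_insert insertI1)
  have n: "norm (r *\<^sub>R e1) = r" "norm (s *\<^sub>R e2) = s" using e1 e2 r s by simp_all
  have o: "cinner (r *\<^sub>R e1) (s *\<^sub>R e2) = 0"
    by (simp add: scaleC_of_real[symmetric] cinner_scaleC_left cinner_scaleC_right e2)
  have "cosh (dist (f (pt (r *\<^sub>R e1))) (f (pt (s *\<^sub>R e2)))) = \<Phi> (a * b)"
    unfolding Phi using cosh_dist_pt[of "r *\<^sub>R e1" "s *\<^sub>R e2"] r s
    by (simp add: n o real_sqrt_mult del: norm_scaleR)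
  moreover have "cosh (dist (f (pt 0)) (f (pt (r *\<^sub>R e1)))) = \<Phi> a" "cosh (dist (f (pt 0)) (f (pt (s *\<^sub>R e2)))) = \<Phi> b"
    unfolding Phi using cosh_dist_origin[of "r *\<^sub>R e1"] cosh_dist_origin[of "s *\<^sub>R e2"] r s
    by (simp_all add: n del: norm_scaleR)
  moreover have "norm (r *\<^sub>R e1) < 1" "norm (s *\<^sub>R e2) < 1" unfolding n by (rule r s)+
  note orthogonal_points(1)[OF this o]
  ultimately show ?thesis by simp
qed

lemma Phi_ge_1:
  assumes "c \<ge> 1"
  shows "\<Phi> c \<ge> 1"
proof -
  obtain r where r: "0 \<le> r" "r < 1" "c = 1 / sqrt (1 - r\<^sup>2)" using cosh_attained[OF assms] .
  obtain e :: 'h where e: "norm e = 1" by (rule unit_vector)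
  have "norm (r *\<^sub>R e) = r" using r e by simp
  then have "\<Phi> c = cosh (dist (f (pt 0)) (f (pt (r *\<^sub>R e))))"
    unfolding Phi using cosh_dist_origin[of "r *\<^sub>R e"] r by (simp del: norm_scaleR)
  then show ?thesis by (simp add: cosh_real_ge_1)
qed

lemma Phi_powr:
  obtains t where "0 < t" "t \<le> 1" "\<And>c. c \<ge> 1 \<Longrightarrow> \<Phi> c = c powr t"
proof -
  define g where "g x = ln (\<Phi> (exp x))" for x
  have add: "g (x + y) = g x + g y" if "0 \<le> x" "0 \<le> y" for x y
    using that Phi_ge_1[of "exp x"] Phi_ge_1[of "exp y"]
    by (simp add: g_def exp_add Phi_mult ln_mult)
  have nonneg: "0 \<le> g x" if "0 \<le> x" for x using that Phi_ge_1[of "exp x"] by (simp add: g_def)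
  have lin: "g x = x * g 1" if "0 \<le> x" for x
  proof -
    \<comment> \<open>An interval containing both \<open>x\<close> and 1, so that the slope found on
      it can be compared with \<open>g 1\<close>. Additivity and non-negativity make
      \<open>g\<close> bounded by \<open>g d\<close> there.\<close>
    define d where "d = max x 1"
    have bnd: "\<bar>g y\<bar> \<le> g d" if "0 \<le> y" "y \<le> d" for y
      using add[of y "d - y"] nonneg[of y] nonneg[of "d - y"] that by simp
    have "g y = y * (g d / d)" if "0 \<le> y" "y \<le> d" for y
      by (rule additive_bounded_linear[of d g, OF _ add bnd]) (use that in \<open>auto simp: d_def\<close>)
    from this[of x] this[of 1] show ?thesis using that by (simp add: d_def)
  qed
  define t where "t = g 1"
  have P: "\<Phi> c = c powr t" if "c \<ge> 1" for c
  proof -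
    have "ln (\<Phi> c) = ln c * t" using lin[of "ln c"] that by (simp add: g_def t_def)
    then have "exp (ln (\<Phi> c)) = exp (t * ln c)" by (simp add: mult.commute)
    then show ?thesis using that Phi_ge_1[OF that] by (simp add: powr_def)
  qed
  have "t \<noteq> 0"
  proof
    assume "t = 0"
    then have "cosh (dist (f x) (f y)) = 1" for x y using P[of "cosh (dist x y)"] by (simp add: Phi cosh_real_ge_1)
    then have "f x = f y" for x y
      using cosh_eq_iff_nonneg[of "dist (f x) (f y)" 0] by simp
    then show False using nonconstant by blast
  qed
  then have t: "t > 0" using nonneg[of 1] by (simp add: t_def)
  have "t \<le> 1"
  proof -
    text \<open>The triangle inequality for the images of \<open>-u\<close>, \<open>0\<close>, \<open>u\<close> with \<open>norm u = r\<close>.\<close>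
    define c :: real where "c = sqrt 2"
    obtain r where r: "0 \<le> r" "r < 1" "c = 1 / sqrt (1 - r\<^sup>2)" using cosh_attained[of c] by (auto simp: c_def)
    have r2: "1 - r\<^sup>2 > 0" using r by (simp add: abs_square_less_1)
    have "c\<^sup>2 = 1 / (1 - r\<^sup>2)" using r r2 by (simp add: power_divide)
    then have r2': "1 / (1 - r\<^sup>2) = 2" by (simp add: c_def)
    then have r2'': "r\<^sup>2 = 1 / 2" using r2 by (simp add: field_simps)
    obtain e :: 'h where e: "norm e = 1" by (rule unit_vector)
    define u where "u = r *\<^sub>R e"
    have nu: "norm u = r" using r e by (simp add: u_def)
    have uu: "cinner u (- u) = - complex_of_real (r\<^sup>2)"
      using cinner_self[of u] cinner_diff_right[of u 0 u] by (simp add: nu)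
    have "cosh (dist (pt u) (pt (- u))) = 3"
    proof -
      have "1 - cinner u (- u) = complex_of_real (1 + r\<^sup>2)" by (simp add: uu)
      then have "cmod (1 - cinner u (- u)) = 1 + r\<^sup>2" by (simp only: norm_of_real) simp
      then have c: "cmod (1 - cinner u (- u)) = 3 / 2" and m: "1 - r\<^sup>2 = 1 / 2" by (simp_all add: r2'')
      show ?thesis using cosh_dist_pt[of u "- u"] r(2) by (simp only: norm_minus_cancel nu c m) (simp add: real_sqrt_divide)
    qed
    then have 3: "cosh (dist (f (pt u)) (f (pt (- u)))) = 3 powr t" by (simp add: Phi P)
    define d where "d = dist (f (pt 0)) (f (pt u))"
    have c2: "cosh (dist (pt 0) (pt u)) = c" "cosh (dist (pt 0) (pt (- u))) = c"
      using cosh_dist_origin[of u] cosh_dist_origin[of "- u"] r by (simp_all add: nu)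
    then have "dist (pt 0) (pt (- u)) = dist (pt 0) (pt u)"
      using cosh_eq_iff_nonneg[of "dist (pt 0) (pt (- u))" "dist (pt 0) (pt u)"] by simp
    then have d: "dist (f (pt 0)) (f (pt (- u))) = d" unfolding d_def by (rule dist_f_cong)
    have cd: "cosh d = c powr t" unfolding d_def Phi c2(1) by (rule P) (simp add: c_def)
    have "dist (f (pt u)) (f (pt (- u))) \<le> d + d"
      using dist_triangle[of "f (pt u)" "f (pt (- u))" "f (pt 0)"] d by (simp add: d_def dist_commute)
    then have "3 powr t \<le> cosh (d + d)"
      unfolding 3[symmetric] by (subst cosh_real_nonneg_le_iff) (auto simp: d_def)
    also have "cosh (d + d) = 2 * (cosh d)\<^sup>2 - 1"
      using cosh_square_eq[of d] by (simp only: cosh_add) (simp add: power2_eq_square)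
    also have "(cosh d)\<^sup>2 = 2 powr t"
      unfolding cd by (simp add: c_def powr_half_sqrt[symmetric] powr_powr powr_power mult.commute)
    finally have le: "3 powr t + 1 \<le> 2 * 2 powr t" by simp
    show ?thesis
    proof (rule ccontr)
      assume "\<not> t \<le> 1"
      \<comment> \<open>After division by \<open>E\<close>, which is \<open>2 powr p\<close>, the
        exponentials are replaced by their tangents at zero. What remains is the sign of
        \<open>3 * ln 3 - 4 * ln 2\<close>, that is, \<open>27 > 16\<close>.\<close>
      define p where "p = t - 1"
      have p: "p > 0" using \<open>\<not> t \<le> 1\<close> by (simp add: p_def)
      define E where "E = exp (p * ln 2)"
      have "3 powr t = 3 * E * exp (p * (ln 3 - ln 2))"
      proof -
        have "3 powr t = 3 powr (1 + p)" by (simp add: p_def)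
        also have "\<dots> = 3 * exp (p * ln 3)" unfolding powr_add by (simp add: powr_def)
        also have "p * ln 3 = p * ln 2 + p * (ln 3 - ln 2)" by (simp add: right_diff_distrib)
        finally show ?thesis by (simp add: E_def exp_add)
      qed
      moreover have "2 * 2 powr t = 4 * E"
      proof -
        have "2 powr t = 2 powr (1 + p)" by (simp add: p_def)
        then show ?thesis unfolding powr_add by (simp add: powr_def E_def)
      qed
      moreover have "E * exp (- (p * ln 2)) = 1" by (simp add: E_def exp_minus)
      ultimately have "E * (3 * exp (p * (ln 3 - ln 2)) + exp (- (p * ln 2))) \<le> E * 4"
        using le by (simp add: algebra_simps)
      then have "3 * exp (p * (ln 3 - ln 2)) + exp (- (p * ln 2)) \<le> 4" by (simp add: E_def)
      moreover have "1 + p * (ln 3 - ln 2) \<le> exp (p * (ln 3 - ln 2))" by (rule exp_ge_add_one_self)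
      moreover have "1 + - (p * ln 2) \<le> exp (- (p * ln 2))" by (rule exp_ge_add_one_self)
      ultimately have "p * (3 * ln 3 - 4 * ln 2) \<le> 0" by (simp add: algebra_simps)
      moreover have "3 * ln 3 - 4 * ln (2::real) > 0"
      proof -
        have "3 * ln 3 = ln (27::real)" "4 * ln 2 = ln (16::real)"
          using ln_realpow[of "3::real" 3] ln_realpow[of "2::real" 4] by simp_all
        then show ?thesis by simp
      qed
      ultimately show False using p by (simp add: mult_le_0_iff)
    qed
  qed
  then show ?thesis using that t P by blast
qed

end


section \<open>The hermitian kernel\<close>

lemma cis_cartan_arg:
  assumes "hpositive X" "hpositive Y" "hpositive Z"
  shows "complex_of_real (cmod (triple X Y Z)) * cis (cartan_arg (chyp_of X) (chyp_of Y) (chyp_of Z)) = triple X Y Z"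
  using rcis_cmod_Arg[of "triple X Y Z"] by (simp add: cartan_arg_chyp_of[OF assms] triple_def rcis_def)

text \<open>Multiply the triple products of the four faces, two of them conjugated: every form value
  meets its conjugate, so the result is positive. The alternating sum of the arguments is thus a
  multiple of \<open>2 * pi\<close>, and four arguments below \<open>pi / 2\<close> in absolute
  value leave only zero.\<close>

lemma cartan_arg_cocycle:
  "cartan_arg x y w = cartan_arg x y z + cartan_arg x z w - cartan_arg y z w"
proof -
  obtain X Y Z W where p: "hpositive X" "hpositive Y" "hpositive Z" "hpositive W"
    and e: "x = chyp_of X" "y = chyp_of Y" "z = chyp_of Z" "w = chyp_of W" by (metis chyp_cases)
  define a b c d where "a = cartan_arg y z w" and "b = cartan_arg x z w"
    and "c = cartan_arg x y w" and "d = cartan_arg x y z"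
  define A B C D where "A = triple Y Z W" and "B = triple X Z W" and "C = triple X Y W" and "D = triple X Y Z"
  have A: "complex_of_real (cmod A) * cis a = A" and B: "complex_of_real (cmod B) * cis b = B"
    and C: "complex_of_real (cmod C) * cis c = C" and D: "complex_of_real (cmod D) * cis d = D"
    using cis_cartan_arg p unfolding a_def b_def c_def d_def A_def B_def C_def D_def e by blast+
  have nz: "A \<noteq> 0" "B \<noteq> 0" "C \<noteq> 0" "D \<noteq> 0"
    by (simp_all add: A_def B_def C_def D_def triple_def hform_nonzero p)
  have sq: "z * cnj z = complex_of_real ((cmod z)\<^sup>2)" for z by (simp add: complex_norm_square del: of_real_power)
  define q where "q = (cmod (hform Y Z))\<^sup>2 * (cmod (hform Z W))\<^sup>2 * (cmod (hform W Y))\<^sup>2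
      * (cmod (hform Z X))\<^sup>2 * (cmod (hform W X))\<^sup>2 * (cmod (hform X Y))\<^sup>2"
  have "A * cnj B * C * cnj D = (hform Y Z * cnj (hform Y Z)) * (hform Z W * cnj (hform Z W))
      * (hform W Y * hform Y W) * (cnj (hform X Z) * cnj (hform Z X)) * (hform W X * cnj (hform W X))
      * (hform X Y * cnj (hform X Y))"
    by (simp add: A_def B_def C_def D_def triple_def)
  also have "\<dots> = complex_of_real q"
    unfolding hform_commute[of Y W] hform_commute[of X Z] by (simp add: q_def sq mult_ac del: of_real_power)
  finally have q: "A * cnj B * C * cnj D = complex_of_real q" .
  have q0: "q \<ge> 0" by (simp add: q_def)
  have regroup: "(complex_of_real \<alpha> * u1) * cnj (complex_of_real \<beta> * u2) * (complex_of_real \<gamma> * u3) * cnj (complex_of_real \<delta> * u4)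
      = complex_of_real (\<alpha> * \<beta> * \<gamma> * \<delta>) * (u1 * cnj u2 * u3 * cnj u4)" for \<alpha> \<beta> \<gamma> \<delta> u1 u2 u3 u4
    by (simp add: mult_ac)
  have "A * cnj B * C * cnj D = complex_of_real (cmod A * cmod B * cmod C * cmod D) * (cis a * cnj (cis b) * cis c * cnj (cis d))"
    unfolding regroup[symmetric] A B C D ..
  also have "cis a * cnj (cis b) * cis c * cnj (cis d) = cis (a - b + c - d)"
    by (simp add: cis_cnj cis_mult)
  finally have "complex_of_real (cmod A * cmod B * cmod C * cmod D) * cis (a - b + c - d) = complex_of_real q"
    using q by simp
  moreover define Q where "Q = cmod A * cmod B * cmod C * cmod D"
  ultimately have "complex_of_real Q * cis (a - b + c - d) = complex_of_real q" by (simp only:)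
  moreover have "Q > 0" using nz by (simp add: Q_def)
  moreover have "z = complex_of_real (q / Q)" if "complex_of_real Q * z = complex_of_real q" "Q > 0" for z
    using that by (simp add: field_simps)
  ultimately have "cis (a - b + c - d) = complex_of_real (q / Q)" by blast
  then have s: "sin (a - b + c - d) = 0" "cos (a - b + c - d) \<ge> 0"
    using q0 \<open>Q > 0\<close> by (simp_all add: complex_eq_iff)
  have cos1: "cos (a - b + c - d) = 1"
    using sin_cos_squared_add[of "a - b + c - d"] s by (simp add: power2_eq_1_iff)
  obtain n :: int where n: "a - b + c - d = of_int n * (2 * pi)"
    using cos1 cos_one_2pi_int by (metis mult.assoc mult.commute)
  have "\<bar>a - b + c - d\<bar> < 1 * (2 * pi)"
    using cartan_arg_bound[of y z w] cartan_arg_bound[of x z w] cartan_arg_bound[of x y w] cartan_arg_bound[of x y z]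
    unfolding a_def b_def c_def d_def by linarith
  then have "\<bar>of_int n\<bar> * (2 * pi) < 1 * (2 * pi)" unfolding n by (simp add: abs_mult)
  then have "\<bar>real_of_int n\<bar> < 1" by (subst (asm) mult_less_cancel_right_pos) auto
  then have "n = 0" by linarith
  then show ?thesis using n unfolding a_def b_def c_def d_def by simp
qed

lemma cartan_arg_same [simp]: "cartan_arg x y x = 0"
  using cartan_arg_swap[of x x y] cartan_arg_cyclic[of x y x] cartan_arg_cyclic[of y x x] by simp

lemma cartan_arg_pt:
  assumes "norm u < 1" "norm v < 1"
  shows "cartan_arg (pt 0) (pt u) (pt v) = Arg (1 - cinner u v)"
  unfolding pt_def by (subst cartan_arg_chyp_of) (use assms in \<open>simp_all add: hpositive_pt, simp add: hform_pt\<close>)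

context equivariant_map
begin

text \<open>The hypothesis of the last clause says that the projections of \<open>Y\<close> and
  \<open>Z\<close> to the complement of \<open>X\<close> are orthogonal. It expresses a right angle
  at \<open>x\<close> through arbitrary lifts.\<close>

lemma normal_position:
  fixes x y z :: "'h chyp"
  obtains u v :: 'h where "norm u < 1" "norm v < 1" "dist x y = dist (pt 0) (pt u)"
    "cartan_arg x y z = cartan_arg (pt 0) (pt u) (pt v)"
    "cartan_arg (f x) (f y) (f z) = cartan_arg (f (pt 0)) (f (pt u)) (f (pt v))"
    "\<And>X Y Z. hpositive X \<Longrightarrow> hpositive Y \<Longrightarrow> hpositive Z \<Longrightarrow> x = chyp_of X \<Longrightarrow> y = chyp_of Y \<Longrightarrow> z = chyp_of Z \<Longrightarrow>
      hform Y Z * hform X X = hform Y X * hform X Z \<Longrightarrow> cinner u v = 0"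
proof -
  obtain T where T: "hsemilinear id T" "act T x = pt 0" by (rule Isom_transitive)
  obtain u where u: "norm u < 1" "act T y = pt u" by (rule pt_cases)
  obtain v where v: "norm v < 1" "act T z = pt v" by (rule pt_cases)
  define S where "S = inv_into UNIV T"
  have S: "hsemilinear id S" unfolding S_def by (rule hsemilinear_inv[OF T(1)])
  have ST: "S (T X) = X" for X unfolding S_def using hsemilinearD(5)[OF T(1)] by (simp add: bij_is_inj)
  have lifted: "w = chyp_of (S (1, a))" if "act T w = pt a" "norm a < 1" for w a
  proof -
    obtain W where W: "hpositive W" "w = chyp_of W" by (metis chyp_cases)
    then have "chyp_of (T W) = chyp_of (1, a)" using that act_chyp_of[OF T(1)] by (simp add: pt_def)
    moreover have "hpositive (T W)" "hpositive (1, a)"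
      using W that by (simp_all add: hsemilinear_hpositive[OF T(1)] hpositive_pt)
    ultimately obtain c where "c \<noteq> 0" "(1, a) = c *\<^sub>C T W" using chyp_of_eq_iff by blast
    then have "S (1, a) = c *\<^sub>C W" using hsemilinearD(3)[OF S, of c "T W"] ST by simp
    then show ?thesis using W \<open>c \<noteq> 0\<close> by (simp add: chyp_of_scaleC)
  qed
  have b: "x = chyp_of (S (1, 0))" "y = chyp_of (S (1, u))" "z = chyp_of (S (1, v))"
    using lifted T(2) u v by simp_all
  have hS: "hform (S X) (S Y) = hform X Y" for X Y using hsemilinearD(4)[OF S] by simp
  have pS: "hpositive (S (1, a)) \<longleftrightarrow> norm a < 1" for a by (simp add: hsemilinear_hpositive[OF S] hpositive_pt)
  show ?thesis
  proof (rule that[OF u(1) v(1)])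
    show "dist x y = dist (pt 0) (pt u)"
      using act_in_Isom[OF T(1)] T(2) u(2) by (metis in_Isom_iff)
    show "cartan_arg x y z = cartan_arg (pt 0) (pt u) (pt v)"
      using cartan_arg_act[OF T(1), of x y z] by (simp add: T u v)
    show "cartan_arg (f x) (f y) (f z) = cartan_arg (f (pt 0)) (f (pt u)) (f (pt v))"
      unfolding b pt_def by (rule f_gram(1)) (use u v in \<open>simp_all add: hpositive_pt hS\<close>)
    fix X Y Z assume X: "hpositive X" "hpositive Y" "hpositive Z" "x = chyp_of X" "y = chyp_of Y" "z = chyp_of Z"
      and o: "hform Y Z * hform X X = hform Y X * hform X Z"
    obtain c where c: "c \<noteq> 0" "X = c *\<^sub>C S (1, 0)"
      using X(1,4) b(1) chyp_of_eq_iff[of "S (1, 0)" X] by (auto simp: pS)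
    obtain d where d: "d \<noteq> 0" "Y = d *\<^sub>C S (1, u)"
      using X(2,5) b(2) u chyp_of_eq_iff[of "S (1, u)" Y] by (auto simp: pS)
    obtain e where e: "e \<noteq> 0" "Z = e *\<^sub>C S (1, v)"
      using X(3,6) b(3) v chyp_of_eq_iff[of "S (1, v)" Z] by (auto simp: pS)
    have "(cnj d * e * cnj c * c) * (1 - cinner u v) = (cnj d * e * cnj c * c) * 1"
      using o unfolding c(2) d(2) e(2) by (simp add: hform_scaleC_left hform_scaleC_right hS hform_pt mult_ac)
    then show "cinner u v = 0" using c d e by simp
  qed
qed

lemma right_angle:
  assumes "hpositive X" "hpositive Y" "hpositive Z" "hform Y Z * hform X X = hform Y X * hform X Z"
  shows "cartan_arg (f (chyp_of X)) (f (chyp_of Y)) (f (chyp_of Z)) = 0"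
proof -
  obtain u v where "norm u < 1" "norm v < 1" "cinner u v = 0"
    "cartan_arg (f (chyp_of X)) (f (chyp_of Y)) (f (chyp_of Z)) = cartan_arg (f (pt 0)) (f (pt u)) (f (pt v))"
    using normal_position[of "chyp_of X" "chyp_of Y" "chyp_of Z"] assms by metis
  then show ?thesis using orthogonal_points(2) by simp
qed

section \<open>Normalised lifts of the image and their kernel\<close>

definition P0 :: "complex \<times> 'h"
  where "P0 = (SOME P. hpositive P \<and> chyp_of P = f (pt 0) \<and> hform P P = 1)"

text \<open>The scaling copies the ball model, where \<open>(1, u)\<close> has product 1 with
  \<open>(1, 0)\<close>. It makes \<open>k\<close> the counterpart of \<open>1 - cinner u v\<close>,
  and \<open>Arg (k u v)\<close> a Cartan argument based at \<open>f (pt 0)\<close>.\<close>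

definition F :: "'h \<Rightarrow> complex \<times> 'h"
  where "F u = (SOME X. hpositive X \<and> chyp_of X = f (pt u) \<and> hform P0 X = 1)"

definition k :: "'h \<Rightarrow> 'h \<Rightarrow> complex"
  where "k u v = hform (F u) (F v)"

lemma P0: "hpositive P0" "chyp_of P0 = f (pt 0)" "hform P0 P0 = 1"
proof -
  have "hpositive P0 \<and> chyp_of P0 = f (pt 0) \<and> hform P0 P0 = 1"
    unfolding P0_def by (rule someI_ex) (metis chyp_cases)
  then show "hpositive P0" "chyp_of P0 = f (pt 0)" "hform P0 P0 = 1" by auto
qed

lemma F: "hpositive (F u)" "chyp_of (F u) = f (pt u)" "hform P0 (F u) = 1"
proof -
  have "\<exists>X. hpositive X \<and> chyp_of X = f (pt u) \<and> hform P0 X = 1"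
  proof -
    obtain X where X: "hpositive X" "f (pt u) = chyp_of X" by (metis chyp_cases)
    have nz: "hform P0 X \<noteq> 0" using hform_nonzero P0(1) X(1) by blast
    then show ?thesis using X
      by (intro exI[of _ "inverse (hform P0 X) *\<^sub>C X"]) (simp add: chyp_of_scaleC hform_scaleC_right)
  qed
  then have "hpositive (F u) \<and> chyp_of (F u) = f (pt u) \<and> hform P0 (F u) = 1"
    unfolding F_def by (rule someI_ex)
  then show "hpositive (F u)" "chyp_of (F u) = f (pt u)" "hform P0 (F u) = 1" by auto
qed

lemma F_0: "F 0 = P0"
proof -
  obtain c where "F 0 = c *\<^sub>C P0" using chyp_of_eq_iff[OF P0(1) F(1), of 0] P0(2) F(2) by auto
  then show ?thesis using F(3)[of 0] P0(3) by (simp add: hform_scaleC_right)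
qed

lemma k_commute: "k v u = cnj (k u v)"
  unfolding k_def by (rule hform_commute)

lemma k_0: "k 0 v = 1" "k u 0 = 1"
  using F(3)[of v] F(3)[of u] k_commute[of u 0] by (simp_all add: k_def F_0)

lemma Arg_k: "Arg (k u v) = cartan_arg (f (pt 0)) (f (pt u)) (f (pt v))"
  using cartan_arg_chyp_of[OF F(1)[of 0] F(1)[of u] F(1)[of v]] k_0 unfolding F(2) k_def by simp

lemma Arg_k_bound: "\<bar>Arg (k u v)\<bar> < pi / 2"
  unfolding Arg_k by (rule cartan_arg_bound)

end

locale equivariant_power_map = equivariant_map \<rho> f
  for \<rho> :: "('h::complex_hilbert chyp \<Rightarrow> 'h chyp) \<Rightarrow> 'h chyp \<Rightarrow> 'h chyp" and f +
  fixes t :: real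
  assumes t_pos: "0 < t" and t_le_1: "t \<le> 1"
    and Phi_eq: "\<And>c. c \<ge> 1 \<Longrightarrow> \<Phi> c = c powr t"
begin

lemma cosh_dist_f: "cosh (dist (f x) (f y)) = cosh (dist x y) powr t"
  by (simp add: Phi Phi_eq cosh_real_ge_1)

lemma k_self:
  assumes "norm u < 1"
  shows "k u u = complex_of_real ((1 - (norm u)\<^sup>2) powr t)"
proof -
  define q where "q = Re (k u u)"
  have q: "q > 0" using F(1)[of u] by (simp add: q_def k_def hpositive_def)
  have n: "1 - (norm u)\<^sup>2 > 0" using assms norm_less_1_iff[of u] by simp
  have "cosh (dist (f (pt 0)) (f (pt u))) = 1 / sqrt q"
    using cosh_dist_eq_hcosh[OF P0(1) F(1)[of u]] by (simp add: P0 F hcosh_def q_def k_def)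
  then have "1 / sqrt q = (1 / sqrt (1 - (norm u)\<^sup>2)) powr t"
    using cosh_dist_f[of "pt 0" "pt u"] cosh_dist_origin[OF assms] by simp
  then have "(1 / sqrt q)\<^sup>2 = ((1 / sqrt (1 - (norm u)\<^sup>2)) powr t)\<^sup>2" by simp
  have sq: "(x powr t)\<^sup>2 = (x\<^sup>2) powr t" if "x \<ge> 0" for x
    using that by (simp add: power2_eq_square powr_mult)
  note \<open>(1 / sqrt q)\<^sup>2 = ((1 / sqrt (1 - (norm u)\<^sup>2)) powr t)\<^sup>2\<close>
  also have "((1 / sqrt (1 - (norm u)\<^sup>2)) powr t)\<^sup>2 = ((1 / sqrt (1 - (norm u)\<^sup>2))\<^sup>2) powr t"
    using n by (intro sq) simp
  also have "(1 / sqrt (1 - (norm u)\<^sup>2))\<^sup>2 = 1 / (1 - (norm u)\<^sup>2)" using n by (simp add: power_divide)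
  finally have "1 / q = 1 / (1 - (norm u)\<^sup>2) powr t" using q n by (simp add: power_divide powr_divide)
  then have "q = (1 - (norm u)\<^sup>2) powr t" by simp
  moreover have "k u u = complex_of_real q" unfolding q_def k_def by (rule hform_self)
  ultimately show ?thesis by simp
qed

lemma cmod_k:
  assumes "norm u < 1" "norm v < 1"
  shows "cmod (k u v) = cmod (1 - cinner u v) powr t"
proof -
  define a b where "a = 1 - (norm u)\<^sup>2" and "b = 1 - (norm v)\<^sup>2"
  have ab: "a > 0" "b > 0" using assms norm_less_1_iff[of u] norm_less_1_iff[of v] by (simp_all add: a_def b_def)
  have "cosh (dist (f (pt u)) (f (pt v))) = cmod (k u v) / sqrt (a powr t * b powr t)"
    using cosh_dist_eq_hcosh[OF F(1)[of u] F(1)[of v]] k_self assms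
    by (simp add: F hcosh_def k_def[symmetric] a_def b_def)
  moreover have "cosh (dist (f (pt u)) (f (pt v))) = (cmod (1 - cinner u v) / sqrt (a * b)) powr t"
    unfolding cosh_dist_f cosh_dist_pt[OF assms] a_def b_def ..
  moreover have "sqrt (a powr t * b powr t) = sqrt (a * b) powr t"
    using ab by (simp add: powr_half_sqrt[symmetric] powr_powr powr_mult mult.commute)
  ultimately show ?thesis using ab by (simp add: powr_divide)
qed

lemma k_eqI:
  assumes "norm u < 1" "norm v < 1" "norm u' < 1" "norm v' < 1" "cmod (1 - cinner u' v') = cmod (1 - cinner u v)"
    "cartan_arg (f (pt 0)) (f (pt u')) (f (pt v')) = cartan_arg (f (pt 0)) (f (pt u)) (f (pt v))"
  shows "k u' v' = k u v"
proof -
  have "cmod (k u' v') = cmod (k u v)" "Arg (k u' v') = Arg (k u v)"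
    using assms by (simp_all add: cmod_k Arg_k)
  then show ?thesis by (metis rcis_cmod_Arg)
qed

text \<open>The right angle at \<open>u\<close> survives \<open>f\<close> as a vanishing Cartan
  argument, which settles the phase of the identity. The moduli follow from the same identity for
  \<open>1 - cinner\<close> by raising it to the power \<open>t\<close>.\<close>

lemma k_right_angle:
  assumes n: "norm u < 1" "norm v < 1" "norm w < 1"
    and o: "(1 - cinner v w) * (1 - cinner u u) = (1 - cinner v u) * (1 - cinner u w)"
  shows "k v w * k u u = k v u * k u w"
proof -
  have "cartan_arg (f (pt u)) (f (pt v)) (f (pt w)) = 0"
    unfolding pt_def by (rule right_angle) (use n o in \<open>simp_all add: hpositive_pt hform_pt\<close>)
  then have "Arg (k u v * k v w * k w u) = 0"
    using cartan_arg_chyp_of[OF F(1)[of u] F(1)[of v] F(1)[of w]] unfolding F(2) k_def by simp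
  then have 1: "k u v * k v w * k w u = complex_of_real (cmod (k u v) * cmod (k v w) * cmod (k w u))"
    using Arg_eq_0_imp[of "k u v * k v w * k w u"] by (simp add: norm_mult)
  have ku: "k u u = complex_of_real (cmod (k u u))" using k_self[OF n(1)] by simp
  have "cmod (1 - cinner v w) * cmod (1 - cinner u u) = cmod (1 - cinner v u) * cmod (1 - cinner u w)"
    using arg_cong[OF o, of cmod] by (simp add: norm_mult)
  then have "(cmod (1 - cinner v w) * cmod (1 - cinner u u)) powr t = (cmod (1 - cinner v u) * cmod (1 - cinner u w)) powr t"
    by simp
  then have m: "cmod (k v w) * cmod (k u u) = cmod (k v u) * cmod (k u w)"
    using n by (simp add: cmod_k powr_mult)
  have c: "cmod (k u v) = cmod (k v u)" "cmod (k w u) = cmod (k u w)"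
    unfolding k_commute[of u v] k_commute[of w u] by simp_all
  have nz: "k u v \<noteq> 0" "k w u \<noteq> 0" by (simp_all add: k_def hform_nonzero F(1))
  have sq: "k u v * k v u = complex_of_real ((cmod (k v u))\<^sup>2)" "k w u * k u w = complex_of_real ((cmod (k u w))\<^sup>2)"
    unfolding k_commute[of u v] k_commute[of w u] by (simp_all add: complex_norm_square mult.commute del: of_real_power)
  have "(k u v * k w u) * (k v w * k u u) = (k u v * k v w * k w u) * k u u" by simp
  also have "\<dots> = complex_of_real (cmod (k v u) * cmod (k u w) * (cmod (k v w) * cmod (k u u)))"
    unfolding 1 c by (subst ku) simp
  also have "\<dots> = (k u v * k v u) * (k w u * k u w)" unfolding m sq by (simp add: power2_eq_square)
  also have "\<dots> = (k u v * k w u) * (k v u * k u w)" by simp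
  finally show ?thesis using nz by simp
qed

text \<open>There is a right angle at \<open>u\<close> between the directions to
  \<open>u + \<alpha>\<close> and to \<open>v\<close>, and also between those to
  \<open>u + \<alpha>\<close> and to the origin. The second one, where \<open>k\<close> is 1,
  evaluates the factor \<open>k (u + \<alpha>) u\<close> occurring in the first.\<close>

lemma k_add_orthogonal:
  assumes n: "norm u < 1" "norm (u + \<alpha>) < 1" "norm v < 1" and o: "cinner \<alpha> u = 0" "cinner \<alpha> v = 0"
  shows "k (u + \<alpha>) v = k u v"
proof -
  have nz: "k u u \<noteq> 0" by (simp add: k_def hform_nonzero F(1))
  have 1: "k (u + \<alpha>) v * k u u = k (u + \<alpha>) u * k u v"
    by (rule k_right_angle) (use n o in \<open>simp_all add: cinner_add_left\<close>)
  have "k (u + \<alpha>) 0 * k u u = k (u + \<alpha>) u * k u 0"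
    by (rule k_right_angle) (use n o in \<open>simp_all add: cinner_add_left\<close>)
  then have "k (u + \<alpha>) u = k u u" by (simp add: k_0)
  then show ?thesis using 1 nz by simp
qed

text \<open>Equal scalar products alone do not give equal Gram matrices. Adding orthogonal vectors
  brings all norms to the common value \<open>m\<close> without changing scalar products or
  \<open>k\<close>; then the Gram matrices agree.\<close>

lemma k_cinner:
  assumes n: "norm u < 1" "norm v < 1" "norm u' < 1" "norm v' < 1" and e: "cinner u v = cinner u' v'"
  shows "k u v = k u' v'"
proof -
  define m where "m = max (max (norm u) (norm v)) (max (norm u') (norm v'))"
  have m: "0 \<le> m" "m < 1" "norm u \<le> m" "norm v \<le> m" "norm u' \<le> m" "norm v' \<le> m"
    using n by (auto simp: m_def le_max_iff_disj)
  have ext: "\<exists>u1 v1. norm u1 = m \<and> norm v1 = m \<and> cinner u1 v1 = cinner u v \<and> k u1 v1 = k u v"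
    if n: "norm u \<le> m" "norm v \<le> m" for u v
  proof -
    have orth: "\<exists>a::'h. norm a = 1 \<and> cinner a x = 0 \<and> cinner a y = 0 \<and> cinner x a = 0 \<and> cinner y a = 0" for x y
      using orthogonal_unit_exists[OF infinite_dimensional, of "{x, y}"]
      by (metis finite.emptyI finite_insert insertCI)
    obtain a where a: "norm a = 1" "cinner a u = 0" "cinner a v = 0" "cinner u a = 0"
      using orth by blast
    define \<alpha> where "\<alpha> = complex_of_real (sqrt (m\<^sup>2 - (norm u)\<^sup>2)) *\<^sub>C a"
    obtain b where b: "norm b = 1" "cinner b (u + \<alpha>) = 0" "cinner b v = 0" "cinner v b = 0" "cinner (u + \<alpha>) b = 0"
      using orth by blast
    define \<beta> where "\<beta> = complex_of_real (sqrt (m\<^sup>2 - (norm v)\<^sup>2)) *\<^sub>C b"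
    have norm_ext: "norm (x + complex_of_real (sqrt (m\<^sup>2 - (norm x)\<^sup>2)) *\<^sub>C y) = m"
      if "norm y = 1" "cinner y x = 0" "cinner x y = 0" "norm x \<le> m" for x y :: 'h
    proof -
      define r where "r = sqrt (m\<^sup>2 - (norm x)\<^sup>2)"
      have r: "r * r = m\<^sup>2 - (norm x)\<^sup>2" using that by (simp add: r_def power_mono)
      have "cinner (x + complex_of_real r *\<^sub>C y) (x + complex_of_real r *\<^sub>C y)
          = complex_of_real ((norm x)\<^sup>2) + complex_of_real (r * r)"
        using that cinner_self[of y]
        by (simp add: cinner_add_left cinner_add_right cinner_scaleC_left cinner_scaleC_right cinner_self[of x])
      also have "\<dots> = complex_of_real (m\<^sup>2)" unfolding r by simp
      finally have "(norm (x + complex_of_real r *\<^sub>C y))\<^sup>2 = m\<^sup>2" unfolding cinner_self of_real_eq_iff .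
      then show ?thesis using m(1) by (simp add: r_def power2_eq_iff_nonneg)
    qed
    have nu: "norm (u + \<alpha>) = m" unfolding \<alpha>_def using a n by (intro norm_ext) auto
    have nv: "norm (v + \<beta>) = m" unfolding \<beta>_def using b n by (intro norm_ext) auto
    have "k (u + \<alpha>) v = k u v"
      by (rule k_add_orthogonal) (use n m nu a in \<open>auto simp: \<alpha>_def cinner_scaleC_left\<close>)
    moreover have "k (v + \<beta>) (u + \<alpha>) = k v (u + \<alpha>)"
      by (rule k_add_orthogonal) (use n m nu nv b in \<open>auto simp: \<beta>_def cinner_scaleC_left\<close>)
    then have "k (u + \<alpha>) (v + \<beta>) = k (u + \<alpha>) v" by (metis k_commute)
    moreover have "cinner (u + \<alpha>) (v + \<beta>) = cinner u v"
      using a b by (simp add: cinner_add_right[of "u + \<alpha>"] \<beta>_def cinner_scaleC_right)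
        (simp add: \<alpha>_def cinner_add_left cinner_scaleC_left)
    ultimately show ?thesis using nu nv by metis
  qed
  obtain u1 v1 where 1: "norm u1 = m" "norm v1 = m" "cinner u1 v1 = cinner u v" "k u1 v1 = k u v"
    using ext m by metis
  obtain u2 v2 where 2: "norm u2 = m" "norm v2 = m" "cinner u2 v2 = cinner u' v'" "k u2 v2 = k u' v'"
    using ext m by metis
  have "k u2 v2 = k u1 v1"
    by (rule k_eqI) (use 1 2 e m in \<open>auto intro!: f_pt_gram\<close>)
  then show ?thesis using 1 2 by simp
qed

section \<open>The kernel as a function of the scalar product\<close>

definition e0 :: 'h
  where "e0 = (SOME e. norm e = 1)"

lemma norm_e0 [simp]: "norm e0 = 1"
  unfolding e0_def by (rule someI_ex) (metis unit_vector)

lemma cinner_e0 [simp]: "cinner e0 e0 = 1"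
  by (simp add: cinner_self)

text \<open>The two vectors have scalar product \<open>s\<close>, and both lie in the ball when
  \<open>cmod s < 1 / 2\<close>; only such arguments carry meaning.\<close>

definition \<kappa> :: "complex \<Rightarrow> complex"
  where "\<kappa> s = k ((1 / 2) *\<^sub>C e0) ((2 * s) *\<^sub>C e0)"

lemma k_kappa:
  assumes "norm u < 1" "norm v < 1" "cmod (cinner u v) < 1 / 2"
  shows "k u v = \<kappa> (cinner u v)"
  unfolding \<kappa>_def
  by (rule k_cinner) (use assms in \<open>simp_all add: norm_scaleC norm_mult cinner_scaleC_left cinner_scaleC_right\<close>)

lemma kappa_cnj:
  assumes "cmod s < 1 / 2"
  shows "\<kappa> (cnj s) = cnj (\<kappa> s)"
proof -
  define u v where "u = (1 / 2 :: complex) *\<^sub>C e0" and "v = (2 * s) *\<^sub>C e0"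
  have n: "norm u < 1" "norm v < 1" "cinner u v = s"
    using assms by (simp_all add: u_def v_def norm_scaleC norm_mult cinner_scaleC_left cinner_scaleC_right)
  then have "cinner v u = cnj s" using cinner_commute[of v u] by simp
  then show ?thesis using k_kappa[OF n(1,2)] k_kappa[OF n(2,1)] n assms k_commute[of v u] by simp
qed

lemma cmod_kappa:
  assumes "cmod s < 1 / 2"
  shows "cmod (\<kappa> s) = cmod (1 - s) powr t"
  unfolding \<kappa>_def
  by (subst cmod_k) (use assms in \<open>simp_all add: norm_scaleC norm_mult cinner_scaleC_left cinner_scaleC_right\<close>)

lemma Arg_kappa_bound: "\<bar>Arg (\<kappa> s)\<bar> < pi / 2"
  unfolding \<kappa>_def by (rule Arg_k_bound)

lemma kappa_0: "\<kappa> 0 = 1"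
  by (simp add: \<kappa>_def k_0)

end


section \<open>The Cartan argument of image points\<close>

text \<open>The numerator is \<open>p + m + 2 * Re q - 4\<close> from \<open>kappa_square\<close>
  for the kernel with exponents \<open>t\<close> and \<open>\<tau>\<close>. Constant and linear
  terms cancel.\<close>

lemma quadratic_rate:
  fixes t \<tau> :: real
  shows "((\<lambda>x. ((1 - x) powr t + (1 + x) powr t + 2 * ((1 + x\<^sup>2) powr (t / 2) * cos (\<tau> * arctan x)) - 4) / x\<^sup>2) \<longlongrightarrow> t\<^sup>2 - \<tau>\<^sup>2) (at_right 0)"
proof -
  have "((\<lambda>x. ((1 - x) powr t + (1 + x) powr t + 2 * ((1 + x\<^sup>2) powr (t / 2) * cos (\<tau> * arctan x)) - 4) / x\<^sup>2)
      \<longlongrightarrow> t * (t - 1) + (t - \<tau> * \<tau>)) (at_right 0)"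
    by real_asymp
  then show ?thesis by (simp add: power2_eq_square algebra_simps)
qed

text \<open>The numerator is \<open>p - m - 2 * Im q\<close> from \<open>kappa_square\<close> for
  the kernel with exponents \<open>t\<close> and \<open>\<tau>\<close>.\<close>

lemma linear_rate:
  fixes t \<tau> :: real
  shows "((\<lambda>x. ((1 - x) powr t - (1 + x) powr t + 2 * ((1 + x\<^sup>2) powr (t / 2) * sin (\<tau> * arctan x))) / x) \<longlongrightarrow> 2 * \<tau> - 2 * t) (at_right 0)"
  by real_asymp

context equivariant_power_map
begin

text \<open>A right triangle with its right angle at a point of squared norm 1/100, where
  \<open>99 / 100\<close> is \<open>1 - cinner u u\<close>. The numbers \<open>a\<close> and
  \<open>b\<close> are free, and the right angle prescribes the third scalar product.\<close>

lemma kappa_right_angle: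
  assumes a: "cmod a \<le> 1 / 100" and b: "cmod b \<le> 1 / 100"
  shows "\<kappa> (1 - (1 - a) * (1 - b) / (99 / 100)) * \<kappa> (1 / 100) = \<kappa> a * \<kappa> b"
proof -
  define s where "s = 1 - (1 - a) * (1 - b) / (99 / 100)"
  define m where "m = s - 100 * (a * b)"
  have ab: "cmod (a * b) \<le> 1 / 10000"
    using mult_mono[OF a b] by (simp add: norm_mult)
  have s: "cmod s \<le> 4 / 100"
  proof -
    have "s = (- 1 / 99 + (100 / 99) * a) + ((100 / 99) * b + (- 100 / 99) * (a * b))"
      by (simp add: s_def field_simps)
    then have "cmod s \<le> (cmod (- 1 / 99) + cmod ((100 / 99) * a)) + (cmod ((100 / 99) * b) + cmod ((- 100 / 99) * (a * b)))"
      by (simp only:) (rule order_trans[OF norm_triangle_ineq add_mono[OF norm_triangle_ineq norm_triangle_ineq]])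
    also have "\<dots> = 1 / 99 + 100 / 99 * cmod a + (100 / 99 * cmod b + 100 / 99 * cmod (a * b))"
      by (simp only: norm_mult[of "100 / 99"] norm_mult[of "- 100 / 99"]) simp
    finally show ?thesis using a b ab by simp
  qed
  have m: "cmod m \<le> 1 / 10"
  proof -
    have "cmod m \<le> cmod s + cmod (100 * (a * b))" unfolding m_def by (rule norm_triangle_ineq4)
    also have "cmod (100 * (a * b)) = 100 * cmod (a * b)" by (simp only: norm_mult[of 100]) simp
    finally show ?thesis using s ab by simp
  qed
  obtain e1 :: 'h where e1: "norm e1 = 1" "cinner e1 e0 = 0" "cinner e0 e1 = 0"
    using orthogonal_unit_exists[OF infinite_dimensional, of "{e0}"]
    by (metis finite.emptyI finite_insert insertCI)
  have e11: "cinner e1 e1 = 1" using e1 by (simp add: cinner_self)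
  \<comment> \<open>The components along \<open>e0\<close> give \<open>cinner v u = a\<close> and
    \<open>cinner u w = b\<close> and contribute \<open>100 * (a * b)\<close> to
    \<open>cinner v w\<close>. The components along \<open>e1\<close> supply the missing
    \<open>m\<close>; the bounds on \<open>a\<close> and \<open>b\<close> keep all vectors in the
    ball.\<close>
  define u v w where "u = (1 / 10 :: complex) *\<^sub>C e0"
    and "v = (10 * cnj a) *\<^sub>C e0 + (1 / 2 :: complex) *\<^sub>C e1"
    and "w = (10 * b) *\<^sub>C e0 + (2 * m) *\<^sub>C e1"
  note ci = cinner_add_left cinner_add_right cinner_scaleC_left cinner_scaleC_right e1 e11
  have uu: "cinner u u = 1 / 100" by (simp add: u_def ci)
  have vu: "cinner v u = a" by (simp add: u_def v_def ci)
  have uw: "cinner u w = b" by (simp add: u_def w_def ci)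
  have vw: "cinner v w = s" by (simp add: v_def w_def ci m_def algebra_simps)
  have nu: "norm u < 1" by (simp add: u_def norm_scaleC)
  have "norm v \<le> 10 * cmod a + 1 / 2" unfolding v_def
    by (rule order_trans[OF norm_triangle_ineq]) (simp add: norm_scaleC norm_mult e1)
  then have nv: "norm v < 1" using a by simp
  have "norm w \<le> 10 * cmod b + 2 * cmod m" unfolding w_def
    by (rule order_trans[OF norm_triangle_ineq]) (simp add: norm_scaleC norm_mult e1)
  then have nw: "norm w < 1" using b m by simp
  have "k v w * k u u = k v u * k u w"
    by (rule k_right_angle[OF nu nv nw]) (simp add: uu vu uw vw s_def field_simps)
  moreover have "k v w = \<kappa> s" "k u u = \<kappa> (1 / 100)" "k v u = \<kappa> a" "k u w = \<kappa> b"
    using k_kappa[OF nv nw] k_kappa[OF nu nu] k_kappa[OF nv nu] k_kappa[OF nu nw] a b s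
    by (simp_all add: uu vu uw vw)
  ultimately show ?thesis by (simp add: s_def)
qed

text \<open>With \<open>c = a + b - a * b\<close>, the pairs \<open>c\<close>, 0 and
  \<open>a\<close>, \<open>b\<close> have the same product \<open>(1 - a) * (1 - b)\<close>. So
  \<open>kappa_right_angle\<close> has the same left side for both, whatever the value
  \<open>\<kappa> (1 / 100)\<close>. The bound 1/300 keeps \<open>c\<close> within 1/100.\<close>

lemma kappa_mult:
  assumes a: "cmod a \<le> 1 / 300" and b: "cmod b \<le> 1 / 300"
  shows "\<kappa> (a + b - a * b) = \<kappa> a * \<kappa> b"
proof -
  define c where "c = a + b - a * b"
  have "cmod c \<le> cmod a + cmod b + cmod a * cmod b"
    unfolding c_def by (metis norm_mult norm_triangle_ineq norm_triangle_ineq4 add_right_mono order_trans)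
  moreover have "cmod a * cmod b \<le> 1 / 300 * (1 / 300)" using a b by (intro mult_mono) auto
  ultimately have c: "cmod c \<le> 1 / 100" using a b by simp
  have "(1 - c) * (1 - 0) = (1 - a) * (1 - b)" by (simp add: c_def algebra_simps)
  then have "\<kappa> c * \<kappa> 0 = \<kappa> a * \<kappa> b"
    using kappa_right_angle[OF c, of 0] kappa_right_angle[of a b] a b by simp
  then show ?thesis by (simp add: kappa_0 c_def)
qed

text \<open>Conjugation negates \<open>Arg\<close> except at the value \<open>pi\<close>, which
  \<open>Arg_kappa_bound\<close> excludes.\<close>

lemma Arg_kappa_cnj:
  assumes "cmod s < 1 / 2"
  shows "Arg (\<kappa> (cnj s)) = - Arg (\<kappa> s)"
proof -
  have "Arg (\<kappa> s) = 0" if "\<kappa> s \<in> \<real>"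
    using that Arg_kappa_bound[of s] Arg_real[OF that] pi_gt_zero by (auto split: if_splits)
  then show ?thesis using kappa_cnj[OF assms] by (auto simp: Arg_cnj)
qed

text \<open>
  On the imaginary axis \<open>Arg \<circ> \<kappa>\<close> composed with \<open>z \<mapsto> 1 - exp z\<close> is additive, without
  wrapping around since it is bounded by \<open>pi / 2\<close>.
\<close>
lemma local_character:
  obtains \<tau> \<epsilon> where "\<epsilon> > 0" "\<And>s. cmod s < \<epsilon> \<Longrightarrow> Arg (\<kappa> s) = \<tau> * Arg (1 - s)"
proof -
  define \<omega> where "\<omega> z = \<kappa> (1 - exp z)" for z
  have "isCont (\<lambda>z. 1 - exp z) (0::complex)" by (intro continuous_intros)
  from this[unfolded continuous_at_eps_delta, rule_format, of "1 / 300"]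
  obtain \<delta> where \<delta>: "\<delta> > 0" "\<And>z. cmod z < \<delta> \<Longrightarrow> cmod (1 - exp z) < 1 / 300"
    by (auto simp: dist_norm)
  have mult: "\<omega> (z + z') = \<omega> z * \<omega> z'" if "cmod z < \<delta>" "cmod z' < \<delta>" for z z'
  proof -
    have "1 - exp (z + z') = (1 - exp z) + (1 - exp z') - (1 - exp z) * (1 - exp z')"
      by (simp add: exp_add algebra_simps)
    then show ?thesis using \<delta>(2)[OF that(1)] \<delta>(2)[OF that(2)] unfolding \<omega>_def by (simp only: kappa_mult less_imp_le)
  qed
  have small: "cmod (1 - exp z) < 1 / 2" if "cmod z < \<delta>" for z using \<delta>(2)[OF that] by simp
  have bnd: "\<bar>Arg (\<omega> z)\<bar> < pi / 2" for z unfolding \<omega>_def by (rule Arg_kappa_bound)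
  have nz: "\<omega> z \<noteq> 0" if "cmod z < \<delta>" for z
    using cmod_kappa[OF small[OF that]] by (auto simp: \<omega>_def)
  have Arg_mult: "Arg (\<omega> (z + z')) = Arg (\<omega> z) + Arg (\<omega> z')" if "cmod z < \<delta>" "cmod z' < \<delta>" for z z'
    unfolding mult[OF that] using bnd[of z] bnd[of z'] nz that by (subst Arg_times) auto
  have Arg_cnj: "Arg (\<omega> (cnj z)) = - Arg (\<omega> z)" if "cmod z < \<delta>" for z
    using Arg_kappa_cnj[OF small[OF that]] by (simp add: \<omega>_def exp_cnj)
  \<comment> \<open>Conjugation fixes a real argument and negates the value there.\<close>
  have Arg_real: "Arg (\<omega> (complex_of_real x)) = 0" if "\<bar>x\<bar> < \<delta>" for x
    using Arg_cnj[of "complex_of_real x"] that by simp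
  define d where "d = \<delta> / 2"
  have d: "d > 0" "d < \<delta>" using \<delta>(1) by (simp_all add: d_def)
  define g where "g y = Arg (\<omega> (\<i> * complex_of_real y))" for y
  define \<tau> where "\<tau> = g d / d"
  have lin_pos: "g y = y * \<tau>" if "0 \<le> y" "y \<le> d" for y
    unfolding \<tau>_def
  proof (rule additive_bounded_linear[of d g _ y])
    show "g (x + y) = g x + g y" if "0 \<le> x" "0 \<le> y" "x + y \<le> d" for x y
      using Arg_mult[of "\<i> * complex_of_real x" "\<i> * complex_of_real y"] that d
      by (simp add: g_def distrib_left norm_mult)
    show "\<bar>g x\<bar> \<le> pi / 2" for x using bnd less_imp_le unfolding g_def by blast
  qed (use that d in auto)
  have lin: "g y = y * \<tau>" if "\<bar>y\<bar> \<le> d" for y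
  proof (cases "0 \<le> y")
    case False
    have "g y = - g (- y)"
      using Arg_cnj[of "\<i> * complex_of_real (- y)"] that d by (simp add: g_def norm_mult)
    then show ?thesis using lin_pos[of "- y"] False that by simp
  qed (use lin_pos that in auto)
  have "isCont (\<lambda>s. Ln (1 - s)) (0::complex)" by (intro continuous_intros) auto
  from this[unfolded continuous_at_eps_delta, rule_format, OF d(1)]
  obtain \<epsilon> where \<epsilon>: "\<epsilon> > 0" "\<And>s. cmod s < \<epsilon> \<Longrightarrow> cmod (Ln (1 - s)) < d"
    by (auto simp: dist_norm)
  show thesis
  proof (rule that[of "min \<epsilon> 1"])
    fix s assume s: "cmod s < min \<epsilon> 1"
    then have "1 - s \<noteq> 0" by auto
    define z where "z = Ln (1 - s)"
    have z: "cmod z < d" using \<epsilon>(2)[of s] s by (simp add: z_def)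
    have "s = 1 - exp z" using \<open>1 - s \<noteq> 0\<close> by (simp add: z_def)
    then have "Arg (\<kappa> s) = Arg (\<omega> z)" by (simp add: \<omega>_def)
    \<comment> \<open>The real part of \<open>Ln (1 - s)\<close> contributes nothing, so only the
      imaginary part \<open>Arg (1 - s)\<close> enters, with slope \<open>\<tau>\<close>.\<close>
    also have "z = complex_of_real (Re z) + \<i> * complex_of_real (Im z)" by (rule complex_eq)
    also have "Arg (\<omega> \<dots>) = Arg (\<omega> (complex_of_real (Re z))) + g (Im z)"
      unfolding g_def using z d abs_Re_le_cmod[of z] abs_Im_le_cmod[of z]
      by (intro Arg_mult) (auto simp: norm_mult)
    also have "\<dots> = \<tau> * Im z"
      using Arg_real[of "Re z"] lin[of "Im z"] z d abs_Re_le_cmod[of z] abs_Im_le_cmod[of z] by simp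
    also have "Im z = Arg (1 - s)" using \<open>1 - s \<noteq> 0\<close> by (simp add: z_def Arg_def)
    finally show "Arg (\<kappa> s) = \<tau> * Arg (1 - s)" .
  qed (use \<epsilon> in auto)
qed

lemma hform_F_P0: "hform (F u) P0 = 1"
  using F(3)[of u] hform_commute[of "F u" P0] by simp

lemma orthogonal_combination_nonpos:
  assumes "hform P0 W = 0"
  shows "Re (hform W W) \<le> 0"
  using hform_orthogonal_neg[OF P0(1) assms] by (cases "W = 0") auto

text \<open>The Gram matrix of the four lifts is circulant, hence diagonalised by the characters of
  the cyclic group of order four. The bounds come from the trivial character, corrected by
  \<open>P0\<close>, and from the two characters of order four; these combinations are orthogonal to
  \<open>P0\<close>, so their self-products are not positive.\<close>

lemma kappa_square:
  assumes x: "0 < x" "x < 1 / 2"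
  defines "p \<equiv> Re (\<kappa> (complex_of_real x))" and "m \<equiv> Re (\<kappa> (- complex_of_real x))" and "q \<equiv> \<kappa> (\<i> * complex_of_real x)"
  shows "p + m + 2 * Re q \<le> 4" "p - m - 2 * Im q \<le> 0" "p - m + 2 * Im q \<le> 0"
proof -
  \<comment> \<open>The square root makes the scalar products among the four points equal to
    \<open>x\<close> times fourth roots of unity.\<close>
  define r where "r = complex_of_real (sqrt x)"
  have rr: "r * r = complex_of_real x" using x by (simp add: r_def flip: of_real_mult)
  have cr: "cnj r = r" by (simp add: r_def)
  have nr: "cmod r < 1" using x by (simp add: r_def)
  define A B C D where "A = F (r *\<^sub>C e0)" and "B = F ((\<i> * r) *\<^sub>C e0)" and "C = F ((- r) *\<^sub>C e0)" and "D = F ((- \<i> * r) *\<^sub>C e0)"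
  have kk: "hform (F (a *\<^sub>C e0)) (F (b *\<^sub>C e0)) = \<kappa> (cnj a * b)" if "cmod a = cmod r" "cmod b = cmod r" for a b
  proof -
    have "cmod (cnj a * b) = cmod (r * r)" using that by (simp add: norm_mult)
    also have "\<dots> < 1 / 2" unfolding rr using x by simp
    finally show ?thesis
      using that nr k_kappa[of "a *\<^sub>C e0" "b *\<^sub>C e0"]
      by (simp add: norm_scaleC k_def cinner_scaleC_left cinner_scaleC_right mult.commute[of b])
  qed
  have real: "\<kappa> (complex_of_real y) = complex_of_real (Re (\<kappa> (complex_of_real y)))" if "\<bar>y\<bar> < 1 / 2" for y
    using kappa_cnj[of "complex_of_real y"] that by (simp add: complex_eq_iff)
  have P: "\<kappa> (r * r) = complex_of_real p" unfolding rr p_def using real[of x] x by simp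
  have M: "\<kappa> (- (r * r)) = complex_of_real m" unfolding rr m_def using real[of "- x"] x by simp
  have Q: "\<kappa> (\<i> * (r * r)) = q" by (simp add: q_def rr)
  have Q': "\<kappa> (- (\<i> * (r * r))) = cnj q"
    using kappa_cnj[of "\<i> * complex_of_real x"] x by (simp add: q_def rr norm_mult)
  have ii: "\<i> * (\<i> * z) = - z" for z by (simp add: mult.assoc[symmetric])
  have h: "hform A A = p" "hform B B = p" "hform C C = p" "hform D D = p"
    "hform A C = m" "hform C A = m" "hform B D = m" "hform D B = m"
    "hform A B = q" "hform B C = q" "hform C D = q" "hform D A = q"
    "hform B A = cnj q" "hform C B = cnj q" "hform D C = cnj q" "hform A D = cnj q"
    unfolding A_def B_def C_def D_def using P M Q Q'
    by (simp_all add: kk norm_mult cr mult_ac ii)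
  have h0: "hform P0 V = 1" "hform V P0 = 1" if "V \<in> {A, B, C, D}" for V
    using that F(3) hform_F_P0 by (auto simp: A_def B_def C_def D_def)
  note hs = hform_add_left hform_add_right hform_diff_left hform_diff_right hform_scaleC_left hform_scaleC_right h h0 P0(3)
  have "hform P0 (A + B + C + D - 4 *\<^sub>C P0) = 0" by (simp add: hs)
  from orthogonal_combination_nonpos[OF this]
  show "p + m + 2 * Re q \<le> 4" by (simp add: hs)
  have "hform P0 (A + \<i> *\<^sub>C B - C - \<i> *\<^sub>C D) = 0" by (simp add: hs)
  from orthogonal_combination_nonpos[OF this]
  show "p - m - 2 * Im q \<le> 0" by (simp add: hs)
  have "hform P0 (A - \<i> *\<^sub>C B - C + \<i> *\<^sub>C D) = 0" by (simp add: hs)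
  from orthogonal_combination_nonpos[OF this]
  show "p - m + 2 * Im q \<le> 0" by (simp add: hs)
qed

text \<open>As \<open>x\<close> tends to zero, the first bound of \<open>kappa_square\<close> gives
  \<open>t\<^sup>2 \<le> \<tau>\<^sup>2\<close> at second order, and the other two give
  \<open>\<bar>\<tau>\<bar> \<le> t\<close> at first order.\<close>

lemma character_exponent:
  assumes \<epsilon>: "\<epsilon> > 0" and loc: "\<And>s. cmod s < \<epsilon> \<Longrightarrow> Arg (\<kappa> s) = \<tau> * Arg (1 - s)"
  shows "\<tau> = t \<or> \<tau> = - t"
proof -
  define \<epsilon>' where "\<epsilon>' = min \<epsilon> (1 / 2)"
  have \<epsilon>': "\<epsilon>' > 0" using \<epsilon> by (simp add: \<epsilon>'_def)
  have Kreal: "Re (\<kappa> (complex_of_real x)) = (1 - x) powr t" if "\<bar>x\<bar> < \<epsilon>'" for x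
  proof -
    have x: "\<bar>x\<bar> < 1 / 2" "\<bar>x\<bar> < \<epsilon>" using that by (simp_all add: \<epsilon>'_def)
    have "Arg (1 - complex_of_real x) = 0" using x by (subst Arg_eq_0) auto
    then have "Arg (\<kappa> (complex_of_real x)) = 0" using loc[of "complex_of_real x"] x by simp
    then have "\<kappa> (complex_of_real x) = complex_of_real (cmod (\<kappa> (complex_of_real x)))" by (rule Arg_eq_0_imp)
    also have "cmod (\<kappa> (complex_of_real x)) = cmod (complex_of_real (1 - x)) powr t" using x by (simp add: cmod_kappa)
    also have "cmod (complex_of_real (1 - x)) = 1 - x" using x by (simp only: norm_of_real)
    finally show ?thesis by simp
  qed
  have Kimag: "\<kappa> (\<i> * complex_of_real x) = complex_of_real ((1 + x\<^sup>2) powr (t / 2)) * cis (- (\<tau> * arctan x))" if "\<bar>x\<bar> < \<epsilon>'" for x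
  proof -
    have x: "\<bar>x\<bar> < 1 / 2" "\<bar>x\<bar> < \<epsilon>" using that by (simp_all add: \<epsilon>'_def)
    have x2: "1 + x\<^sup>2 > 0" by (simp add: add_pos_nonneg)
    have "1 - \<i> * complex_of_real x = rcis (sqrt (1 + x\<^sup>2)) (- arctan x)"
      using x2 by (simp add: complex_eq_iff cos_arctan sin_arctan)
    then have A: "Arg (1 - \<i> * complex_of_real x) = - arctan x" and N: "cmod (1 - \<i> * complex_of_real x) = sqrt (1 + x\<^sup>2)"
      using arctan_bounded[of x] x2 by (simp_all add: norm_mult rcis_def Arg_cis)
    have "cmod (\<kappa> (\<i> * complex_of_real x)) = sqrt (1 + x\<^sup>2) powr t"
      using x by (subst cmod_kappa) (simp_all add: N norm_mult)
    also have "\<dots> = (1 + x\<^sup>2) powr (t / 2)" by (simp add: powr_half_sqrt[symmetric] powr_powr)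
    finally have "cmod (\<kappa> (\<i> * complex_of_real x)) = (1 + x\<^sup>2) powr (t / 2)" .
    moreover have "Arg (\<kappa> (\<i> * complex_of_real x)) = - (\<tau> * arctan x)"
      using loc[of "\<i> * complex_of_real x"] x by (simp add: A norm_mult)
    ultimately show ?thesis using rcis_cmod_Arg[of "\<kappa> (\<i> * complex_of_real x)"] by (simp add: rcis_def)
  qed
  have ineq: "(1 - x) powr t + (1 + x) powr t + 2 * ((1 + x\<^sup>2) powr (t / 2) * cos (\<tau> * arctan x)) - 4 \<le> 0"
    "(1 - x) powr t - (1 + x) powr t + 2 * ((1 + x\<^sup>2) powr (t / 2) * sin (\<tau> * arctan x)) \<le> 0"
    "(1 - x) powr t - (1 + x) powr t + 2 * ((1 + x\<^sup>2) powr (t / 2) * sin (- \<tau> * arctan x)) \<le> 0"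
    if "0 < x" "x < \<epsilon>'" for x
    using kappa_square[of x] Kreal[of x] Kreal[of "- x"] Kimag[of x] that by (simp_all add: \<epsilon>'_def)
  have ev: "eventually (\<lambda>x. 0 < x \<and> x < \<epsilon>') (at_right 0)"
    using eventually_at_right_real[OF \<epsilon>'] by (auto elim: eventually_mono)
  have "t\<^sup>2 - \<tau>\<^sup>2 \<le> 0"
  proof (rule tendsto_upperbound[OF quadratic_rate])
    show "\<forall>\<^sub>F x in at_right 0. ((1 - x) powr t + (1 + x) powr t
        + 2 * ((1 + x\<^sup>2) powr (t / 2) * cos (\<tau> * arctan x)) - 4) / x\<^sup>2 \<le> 0"
      using ev by eventually_elim (simp only: ineq divide_nonpos_nonneg zero_le_power2)
  qed simp
  moreover have "2 * \<tau>' - 2 * t \<le> 0" if "\<tau>' = \<tau> \<or> \<tau>' = - \<tau>" for \<tau>'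
  proof (rule tendsto_upperbound[OF linear_rate])
    show "\<forall>\<^sub>F x in at_right 0. ((1 - x) powr t - (1 + x) powr t
        + 2 * ((1 + x\<^sup>2) powr (t / 2) * sin (\<tau>' * arctan x))) / x \<le> 0"
      using ev by eventually_elim (use that ineq(2,3) in \<open>auto intro!: divide_nonpos_pos\<close>)
  qed simp
  from this[of \<tau>] this[of "- \<tau>"] have "2 * \<tau> - 2 * t \<le> 0" "2 * (- \<tau>) - 2 * t \<le> 0" by simp_all
  ultimately have "t\<^sup>2 \<le> \<tau>\<^sup>2" "\<bar>\<tau>\<bar> \<le> t" by auto
  then have "\<bar>\<tau>\<bar> = t" using t_pos abs_le_square_iff[of t \<tau>] by simp
  then show ?thesis by linarith
qed

lemma cartan_arg_f:
  obtains \<tau> where "\<tau> = t \<or> \<tau> = - t" "\<And>x y z. cartan_arg (f x) (f y) (f z) = \<tau> * cartan_arg x y z"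
proof -
  obtain \<tau> \<epsilon> where \<epsilon>: "\<epsilon> > 0" "\<And>s. cmod s < \<epsilon> \<Longrightarrow> Arg (\<kappa> s) = \<tau> * Arg (1 - s)" using local_character by blast
  define \<epsilon>' where "\<epsilon>' = min \<epsilon> (1 / 2)"
  have \<epsilon>': "0 < \<epsilon>'" "\<epsilon>' \<le> 1 / 2" "\<epsilon>' \<le> \<epsilon>" using \<epsilon> by (simp_all add: \<epsilon>'_def)
  \<comment> \<open>The distance from the origin of points of norm \<open>\<epsilon>'\<close>. One
    short side is enough: if \<open>norm u < \<epsilon>'\<close>, then \<open>cinner u v\<close> is
    below \<open>\<epsilon>'\<close> in modulus for every \<open>v\<close> in the ball.\<close>
  define \<eta> where "\<eta> = arcosh (1 / sqrt (1 - \<epsilon>'\<^sup>2))"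
  have \<epsilon>2: "0 < 1 - \<epsilon>'\<^sup>2" "1 - \<epsilon>'\<^sup>2 < 1" using \<epsilon>' by (simp_all add: abs_square_less_1)
  have ge1: "1 < 1 / sqrt (1 - \<epsilon>'\<^sup>2)" using \<epsilon>2 by (simp add: real_less_rsqrt)
  then have \<eta>: "\<eta> > 0" "cosh \<eta> = 1 / sqrt (1 - \<epsilon>'\<^sup>2)" unfolding \<eta>_def using arcosh_real_gt_1_iff[of "1 / sqrt (1 - \<epsilon>'\<^sup>2)"]
    cosh_arcosh_real[of "1 / sqrt (1 - \<epsilon>'\<^sup>2)"] by linarith+
  have thin: "cartan_arg (f x) (f y) (f z) = \<tau> * cartan_arg x y z" if d: "dist x y < \<eta>" for x y z
  proof -
    obtain u v where uv: "norm u < 1" "norm v < 1" "dist x y = dist (pt 0) (pt u)"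
      "cartan_arg x y z = cartan_arg (pt 0) (pt u) (pt v)"
      "cartan_arg (f x) (f y) (f z) = cartan_arg (f (pt 0)) (f (pt u)) (f (pt v))"
      using normal_position[of x y z] by metis
    have "cosh (dist (pt 0) (pt u)) < cosh \<eta>"
      using d \<eta> unfolding uv(3)[symmetric] by (subst cosh_real_nonneg_less_iff) auto
    then have lt: "1 / sqrt (1 - (norm u)\<^sup>2) < 1 / sqrt (1 - \<epsilon>'\<^sup>2)" using cosh_dist_origin[OF uv(1)] \<eta> by simp
    have u1: "1 - (norm u)\<^sup>2 > 0" using uv(1) norm_less_1_iff[of u] by simp
    have "sqrt (1 - \<epsilon>'\<^sup>2) < sqrt (1 - (norm u)\<^sup>2)" using lt u1 \<epsilon>2 by (simp add: field_simps)
    then have "(norm u)\<^sup>2 < \<epsilon>'\<^sup>2" by simp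
    then have "norm u < \<epsilon>'" using \<epsilon>' by (simp add: power_less_imp_less_base)
    moreover have "cmod (cinner u v) \<le> norm u * 1"
      by (rule order_trans[OF norm_cinner_le]) (use uv in \<open>intro mult_left_mono, auto\<close>)
    ultimately have s: "cmod (cinner u v) < \<epsilon>'" by simp
    then have "Arg (k u v) = \<tau> * Arg (1 - cinner u v)" using k_kappa[OF uv(1,2)] \<epsilon>(2) \<epsilon>' by simp
    then show ?thesis unfolding uv(4,5) Arg_k[symmetric] cartan_arg_pt[OF uv(1,2)] .
  qed
  \<comment> \<open>The defect inherits the cocycle identity from both Cartan arguments and vanishes
    on triangles with a short side.\<close>
  define E where "E x y z = cartan_arg (f x) (f y) (f z) - \<tau> * cartan_arg x y z" for x y z
  have E_thin: "E x y z = 0" "E z x y = 0" if "dist x y < \<eta>" for x y z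
    using thin[OF that] cartan_arg_cyclic by (simp_all add: E_def cartan_arg_cyclic[of z x y] cartan_arg_cyclic[of "f z" "f x" "f y"])
  have E_cocycle: "E x y w = E x y z + E x z w - E y z w" for x y z w
    unfolding E_def cartan_arg_cocycle[of x y w z] cartan_arg_cocycle[of "f x" "f y" "f w" "f z"]
    by (simp add: algebra_simps)
  have E0: "E x y z = 0" for x y z
  proof -
    obtain u v where uv: "norm u < 1" "norm v < 1" "cartan_arg x y z = cartan_arg (pt 0) (pt u) (pt v)"
      "cartan_arg (f x) (f y) (f z) = cartan_arg (f (pt 0)) (f (pt u)) (f (pt v))"
      using normal_position[of x y z] by metis
    \<comment> \<open>The third vertex moves along the radius from the origin to \<open>v\<close> in
      steps shorter than \<open>\<eta>\<close>. At each step the two additional triangles of the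
      cocycle identity have the step as a short side; at the start the first and third vertices
      coincide.\<close>
    define \<gamma> where "\<gamma> s = pt (s *\<^sub>R v)" for s
    have nsv: "norm (s *\<^sub>R v) < 1" if "s \<in> {0..1}" for s
      using that uv(2) mult_left_le_one_le[of "norm v" s] by simp
    have "continuous_on {0..1} \<gamma>"
      unfolding continuous_on_def \<gamma>_def using nsv by (auto intro!: tendsto_pt tendsto_intros)
    then have "uniformly_continuous_on {0..1} \<gamma>" by (intro compact_uniformly_continuous) auto
    then obtain \<delta> where \<delta>: "\<delta> > 0" "\<And>s s'. s \<in> {0..1} \<Longrightarrow> s' \<in> {0..1} \<Longrightarrow> dist s' s < \<delta> \<Longrightarrow> dist (\<gamma> s') (\<gamma> s) < \<eta>"
      unfolding uniformly_continuous_on_def using \<eta>(1) by metis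
    obtain n :: nat where n: "real n > 1 / \<delta>" using reals_Archimedean2 by blast
    moreover have "1 / \<delta> > 0" using \<delta>(1) by simp
    ultimately have n0: "real n > 0" by linarith
    have "E (pt 0) (pt u) (\<gamma> (real i / real n)) = 0" if "i \<le> n" for i
      using that
    proof (induction i)
      case 0
      then show ?case by (simp add: E_def \<gamma>_def)
    next
      case (Suc i)
      have "dist (real i / real n) (real (Suc i) / real n) < \<delta>"
        using n n0 \<delta>(1) by (simp add: dist_real_def field_simps)
      moreover have "real i / real n \<in> {0..1}" "real (Suc i) / real n \<in> {0..1}" using Suc.prems n0 by auto
      ultimately have "dist (\<gamma> (real i / real n)) (\<gamma> (real (Suc i) / real n)) < \<eta>" using \<delta>(2) by blast
      then have "E (pt 0) (\<gamma> (real i / real n)) (\<gamma> (real (Suc i) / real n)) = 0"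
        "E (pt u) (\<gamma> (real i / real n)) (\<gamma> (real (Suc i) / real n)) = 0"
        using E_thin(2) by blast+
      then show ?case
        using E_cocycle[of "pt 0" "pt u" "\<gamma> (real (Suc i) / real n)" "\<gamma> (real i / real n)"] Suc by simp
    qed
    from this[of n] have "E (pt 0) (pt u) (pt v) = 0" using n0 by (simp add: \<gamma>_def)
    then show ?thesis using uv by (simp add: E_def)
  qed
  show thesis
    by (rule that[OF character_exponent[OF \<epsilon>]]) (use E0 in \<open>simp_all add: E_def\<close>)
qed

end


section \<open>Continuity\<close>

text \<open>The lifts are those whose phase is aligned with \<open>Y\<close>. Their products with
  \<open>Y\<close> tend to 1, and \<open>norm_le_hform\<close> converts this into convergence in
  norm.\<close>

lemma lift_tendsto:
  assumes y: "(y \<longlongrightarrow> chyp_of Y) F" and Y: "hpositive Y" "hform Y Y = 1"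
  obtains Z where "\<And>i. hpositive (Z i)" "\<And>i. chyp_of (Z i) = y i" "\<And>i. hform (Z i) (Z i) = 1" "(Z \<longlongrightarrow> Y) F"
proof -
  have "\<exists>X. hpositive X \<and> chyp_of X = y i \<and> hform X X = 1 \<and> hform Y X = complex_of_real (cosh (dist (chyp_of Y) (y i)))" for i
    using unit_lift[OF Y] by metis
  then obtain Z where Z: "\<And>i. hpositive (Z i)" "\<And>i. chyp_of (Z i) = y i" "\<And>i. hform (Z i) (Z i) = 1"
    "\<And>i. hform Y (Z i) = complex_of_real (cosh (dist (chyp_of Y) (y i)))" by metis
  obtain C where C: "C > 0" "\<And>D. (norm D)\<^sup>2 \<le> C * ((cmod (hform Y D))\<^sup>2 + \<bar>Re (hform D D)\<bar>)"
    using norm_le_hform[OF Y(1)] by metis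
  define q where "q i = cosh (dist (chyp_of Y) (y i))" for i
  have "((\<lambda>i. dist (chyp_of Y) (y i)) \<longlongrightarrow> dist (chyp_of Y) (chyp_of Y)) F" by (intro tendsto_intros y)
  then have "(q \<longlongrightarrow> cosh (dist (chyp_of Y) (chyp_of Y))) F" unfolding q_def by (rule tendsto_cosh)
  then have q: "(q \<longlongrightarrow> 1) F" by simp
  have ZY: "hform (Z i) Y = complex_of_real (q i)" for i
    using Z(4)[of i] hform_commute[of "Z i" Y] by (simp add: q_def)
  have bound: "(norm (Z i - Y))\<^sup>2 \<le> C * ((q i - 1)\<^sup>2 + \<bar>2 - 2 * q i\<bar>)" for i
  proof -
    have "hform Y (Z i - Y) = complex_of_real (q i - 1)" using Z(4) by (simp add: hform_diff_right Y q_def)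
    then have "cmod (hform Y (Z i - Y)) = \<bar>q i - 1\<bar>" by (simp only: norm_of_real)
    moreover have "Re (hform (Z i - Y) (Z i - Y)) = 2 - 2 * q i"
      using Z(4) by (simp add: hform_diff_left hform_diff_right Z Y ZY q_def)
    ultimately show ?thesis using C(2)[of "Z i - Y"] by simp
  qed
  have "((\<lambda>i. C * ((q i - 1)\<^sup>2 + \<bar>2 - 2 * q i\<bar>)) \<longlongrightarrow> C * ((1 - 1)\<^sup>2 + \<bar>2 - 2 * 1\<bar>)) F"
    by (intro tendsto_intros q)
  then have lim: "((\<lambda>i. C * ((q i - 1)\<^sup>2 + \<bar>2 - 2 * q i\<bar>)) \<longlongrightarrow> 0) F" by simp
  have "((\<lambda>i. (norm (Z i - Y))\<^sup>2) \<longlongrightarrow> 0) F"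
    by (rule tendsto_sandwich[OF _ _ tendsto_const lim]) (simp_all add: bound)
  then have "((\<lambda>i. sqrt ((norm (Z i - Y))\<^sup>2)) \<longlongrightarrow> sqrt 0) F" by (rule tendsto_real_sqrt)
  then have "((\<lambda>i. Z i - Y) \<longlongrightarrow> 0) F" by (simp add: tendsto_norm_zero_iff)
  then have "(Z \<longlongrightarrow> Y) F" by (simp add: LIM_zero_iff)
  then show ?thesis using that Z by blast
qed

text \<open>\<open>Arg\<close> is continuous here because the limiting triple product has positive
  real part and so avoids the branch cut.\<close>

lemma tendsto_cartan_arg:
  assumes "(x \<longlongrightarrow> a) F" "(y \<longlongrightarrow> b) F" "(z \<longlongrightarrow> c) F"
  shows "((\<lambda>i. cartan_arg (x i) (y i) (z i)) \<longlongrightarrow> cartan_arg a b c) F"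
proof -
  obtain A B C where ABC: "hpositive A" "a = chyp_of A" "hform A A = 1" "hpositive B" "b = chyp_of B" "hform B B = 1"
    "hpositive C" "c = chyp_of C" "hform C C = 1" by (metis chyp_cases)
  obtain X where X: "\<And>i. hpositive (X i)" "\<And>i. chyp_of (X i) = x i" "(X \<longlongrightarrow> A) F"
    using lift_tendsto[of x A F] assms ABC by metis
  obtain Y where Y: "\<And>i. hpositive (Y i)" "\<And>i. chyp_of (Y i) = y i" "(Y \<longlongrightarrow> B) F"
    using lift_tendsto[of y B F] assms ABC by metis
  obtain Z where Z: "\<And>i. hpositive (Z i)" "\<And>i. chyp_of (Z i) = z i" "(Z \<longlongrightarrow> C) F"
    using lift_tendsto[of z C F] assms ABC by metis
  have "hform A B * hform B C * hform C A \<notin> \<real>\<^sub>\<le>\<^sub>0"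
    using Re_triple_pos[of A B C] ABC by (auto simp: complex_nonpos_Reals_iff)
  then have "((\<lambda>i. Arg (hform (X i) (Y i) * hform (Y i) (Z i) * hform (Z i) (X i))) \<longlongrightarrow> Arg (hform A B * hform B C * hform C A)) F"
    by (intro tendsto_Arg tendsto_mult tendsto_hform X Y Z)
  moreover have "cartan_arg (x i) (y i) (z i) = Arg (hform (X i) (Y i) * hform (Y i) (Z i) * hform (Z i) (X i))" for i
    unfolding X(2)[symmetric] Y(2)[symmetric] Z(2)[symmetric] by (rule cartan_arg_chyp_of[OF X(1) Y(1) Z(1)])
  ultimately show ?thesis using ABC by (simp add: cartan_arg_chyp_of)
qed

definition lifts :: "'h::complex_hilbert chyp set \<Rightarrow> (complex \<times> 'h) set"
  where "lifts S = {X. hpositive X \<and> chyp_of X \<in> S}"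

text \<open>The real span is already complex, because the generating set is stable under non-zero
  complex factors.\<close>

lemma scaleC_in_span_lifts:
  assumes "X \<in> span (lifts S)"
  shows "c *\<^sub>C X \<in> span (lifts S)"
  using assms
proof (induction rule: span_induct_alt)
  case base
  then show ?case by (simp add: span_zero)
next
  case (step r X Y)
  have "c *\<^sub>C X \<in> span (lifts S)"
  proof (cases "c = 0")
    case False
    then have "c *\<^sub>C X \<in> lifts S" using step(1) chyp_of_scaleC[of X c] by (simp add: lifts_def)
    then show ?thesis by (rule span_base)
  qed (simp add: span_zero)
  then show ?case using step by (simp add: scaleC_add_right scaleC_scaleR_commute span_add span_scale)
qed

lemma norm_scaleC_prod: "norm (c *\<^sub>C X) = cmod c * norm (X :: complex \<times> 'h::complex_hilbert)"
proof -
  have "(norm (c *\<^sub>C X))\<^sup>2 = (cmod c * norm X)\<^sup>2"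
    by (simp add: norm_prod_def scaleC_prod_def norm_scaleC scaleC_complex_def norm_mult power_mult_distrib algebra_simps)
  then show ?thesis by (simp add: power2_eq_iff_nonneg)
qed

lemma bounded_linear_scaleC: "bounded_linear (\<lambda>X::complex \<times> 'h::complex_hilbert. c *\<^sub>C X)"
proof (rule bounded_linear_intro[where K = "cmod c"])
  show "norm (c *\<^sub>C X) \<le> norm X * cmod c" for X :: "complex \<times> 'h"
    by (simp add: norm_scaleC_prod)
qed (simp_all add: scaleC_add_right scaleC_scaleR_commute)

lemma subspace_closure:
  fixes V :: "'a::real_normed_vector set"
  assumes V: "subspace V"
  shows "subspace (closure V)"
  unfolding subspace_def
proof (intro conjI ballI allI)
  show "0 \<in> closure V" using subspace_0[OF V] closure_subset by blast
next
  fix x y assume "x \<in> closure V" "y \<in> closure V"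
  then obtain a b where ab: "\<And>n. a n \<in> V" "a \<longlonglongrightarrow> x" "\<And>n. b n \<in> V" "b \<longlonglongrightarrow> y"
    unfolding closure_sequential by blast
  have "(\<lambda>n. a n + b n) \<longlonglongrightarrow> x + y" by (intro tendsto_add ab)
  moreover have "a n + b n \<in> V" for n by (intro subspace_add V ab)
  ultimately show "x + y \<in> closure V"
    unfolding closure_sequential by (intro exI[of _ "\<lambda>n. a n + b n"]) simp
next
  fix r x assume "x \<in> closure V"
  then obtain a where a: "\<And>n. a n \<in> V" "a \<longlonglongrightarrow> x" unfolding closure_sequential by blast
  have "(\<lambda>n. r *\<^sub>R a n) \<longlonglongrightarrow> r *\<^sub>R x" by (intro tendsto_intros a)
  moreover have "r *\<^sub>R a n \<in> V" for n by (intro subspace_scale V a)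
  ultimately show "r *\<^sub>R x \<in> closure V"
    unfolding closure_sequential by (intro exI[of _ "\<lambda>n. r *\<^sub>R a n"]) simp
qed

lemma csubspace_closure_span_lifts: "csubspace (closure (span (lifts S)))"
  unfolding csubspace_def
proof (intro conjI ballI allI)
  have sub: "subspace (closure (span (lifts S)))" by (intro subspace_closure subspace_span)
  then show "0 \<in> closure (span (lifts S))" by (rule subspace_0)
  show "X + Y \<in> closure (span (lifts S))" if "X \<in> closure (span (lifts S))" "Y \<in> closure (span (lifts S))" for X Y
    using sub that by (rule subspace_add)
  show "c *\<^sub>C X \<in> closure (span (lifts S))" if "X \<in> closure (span (lifts S))" for c X
  proof -
    have "(\<lambda>X. c *\<^sub>C X) ` closure (span (lifts S)) \<subseteq> closure ((\<lambda>X. c *\<^sub>C X) ` span (lifts S))"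
      by (rule closure_bounded_linear_image_subset[OF bounded_linear_scaleC])
    also have "\<dots> \<subseteq> closure (span (lifts S))"
      by (intro closure_mono) (auto intro: scaleC_in_span_lifts)
    finally show ?thesis using that by blast
  qed
qed

text \<open>
  The points with non-zero Cartan argument exclude anti-holomorphic isometries; without them the
  isometries could converge to a reflection in a real subspace.
\<close>
lemma isometries_converge:
  fixes h :: "'i \<Rightarrow> 'h::complex_hilbert chyp \<Rightarrow> 'h chyp"
  assumes h: "\<And>i. h i \<in> carrier Isom" and S: "\<And>y. y \<in> S \<Longrightarrow> ((\<lambda>i. h i y) \<longlongrightarrow> y) F"
    and abc: "a \<in> S" "b \<in> S" "c \<in> S" "cartan_arg a b c \<noteq> 0"
    and dense: "\<And>X. hpositive X \<Longrightarrow> X \<in> closure (span (lifts S))"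
  shows "((\<lambda>i. h i y) \<longlongrightarrow> y) F"
proof -
  have "\<exists>s T. hsemilinear s T \<and> h i = act T" for i using Isom_hsemilinear[OF h] by metis
  then obtain s T where T: "\<And>i. hsemilinear (s i) (T i)" "\<And>i. h i = act (T i)" by metis
  have ev: "eventually (\<lambda>i. s i = id) F"
  proof -
    have "((\<lambda>i. cartan_arg (h i a) (h i b) (h i c)) \<longlongrightarrow> cartan_arg a b c) F"
      using abc by (intro tendsto_cartan_arg S)
    from tendstoD[OF this, of "\<bar>cartan_arg a b c\<bar>"] abc(4)
    have "\<forall>\<^sub>F i in F. dist (cartan_arg (h i a) (h i b) (h i c)) (cartan_arg a b c) < \<bar>cartan_arg a b c\<bar>" by simp
    then show ?thesis
    proof eventually_elim
      case (elim i)
      show ?case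
      proof (rule ccontr)
        assume "s i \<noteq> id"
        then have "cartan_arg (h i a) (h i b) (h i c) = - cartan_arg a b c"
          using cartan_arg_act[OF T(1)[of i], of a b c] T(2)[of i] by simp
        then show False using elim by (simp add: dist_real_def)
      qed
    qed
  qed
  obtain A where A: "hpositive A" "a = chyp_of A" "hform A A = 1" by (rule chyp_cases)
  obtain Z where Z: "\<And>i. hpositive (Z i)" "\<And>i. chyp_of (Z i) = h i a" "\<And>i. hform (Z i) (Z i) = 1" "(Z \<longlongrightarrow> A) F"
    using lift_tendsto[of "\<lambda>i. h i a" A F] S[OF abc(1)] A by metis
  have "\<exists>k. k \<noteq> 0 \<and> Z i = k *\<^sub>C T i A" for i
    using chyp_of_eq_iff[of "T i A" "Z i"] Z A T act_chyp_of[OF T(1)] hsemilinear_hpositive[OF T(1)] by metis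
  then obtain k where k: "\<And>i. k i \<noteq> 0" "\<And>i. Z i = k i *\<^sub>C T i A" by metis
  have k1: "k i * cnj (k i) = 1" for i
  proof -
    have "hform (T i A) (T i A) = 1" using hsemilinearD(1,4)[OF T(1)[of i]] A(3) by auto
    then show ?thesis using Z(3)[of i] unfolding k(2)[of i] by (simp add: hform_scaleC_left hform_scaleC_right)
  qed
  \<comment> \<open>The factor \<open>k i\<close> normalises the phase at \<open>A\<close>, so that
    \<open>U i A\<close> tends to \<open>A\<close>. The default value \<open>X\<close> at the
    anti-linear indices, which eventually disappear, keeps every \<open>U i\<close> linear and
    form-preserving.\<close>
  define U where "U i X = (if s i = id then k i *\<^sub>C T i X else X)" for i X
  have U_add: "U i (X + Y) = U i X + U i Y" for i X Y
    using hsemilinearD(2)[OF T(1)[of i]] by (simp add: U_def scaleC_add_right)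
  have U_scale: "U i (w *\<^sub>C X) = w *\<^sub>C U i X" for i w X
    using hsemilinearD(3)[OF T(1)[of i], of w X] by (simp add: U_def scaleC_scaleC mult.commute)
  have U_hform: "hform (U i X) (U i Y) = hform X Y" for i X Y
    using hsemilinearD(4)[OF T(1)[of i], of X Y] k1[of i]
    by (simp add: U_def hform_scaleC_left hform_scaleC_right mult.assoc[symmetric])
  have U_act: "h i (chyp_of X) = chyp_of (U i X)" if "s i = id" "hpositive X" for i X
    using that act_chyp_of[OF T(1)[of i] that(2)] T(2)[of i] k(1)[of i] hsemilinear_hpositive[OF T(1)[of i]]
    by (simp add: U_def chyp_of_scaleC)
  have UA: "((\<lambda>i. U i A) \<longlongrightarrow> A) F"
    by (rule Lim_transform_eventually[OF Z(4)]) (use ev in eventually_elim, simp add: U_def k(2))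
  have unit: "((\<lambda>i. U i Y) \<longlongrightarrow> Y) F" if Y: "hpositive Y" "chyp_of Y \<in> S" "hform Y Y = 1" for Y
  proof -
    obtain W where W: "\<And>i. hpositive (W i)" "\<And>i. chyp_of (W i) = h i (chyp_of Y)" "\<And>i. hform (W i) (W i) = 1" "(W \<longlongrightarrow> Y) F"
      using lift_tendsto[of "\<lambda>i. h i (chyp_of Y)" Y F] S[OF Y(2)] Y by metis
    \<comment> \<open>\<open>W i\<close> is a multiple of \<open>U i Y\<close> by some phase, and
      comparison with \<open>U i A\<close> shows that this phase is \<open>d i\<close>. As it tends
      to 1, the correction by \<open>cnj (d i)\<close> does not affect the limit.\<close>
    define d where "d i = hform (U i A) (W i) / hform A Y" for i
    have AY: "hform A Y \<noteq> 0" using hform_nonzero A Y by blast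
    have "(d \<longlongrightarrow> hform A Y / hform A Y) F" unfolding d_def by (intro tendsto_intros tendsto_hform UA W AY)
    then have d: "(d \<longlongrightarrow> 1) F" using AY by simp
    have "((\<lambda>i. norm (cnj (d i) *\<^sub>C W i - Y)) \<longlongrightarrow> 0) F"
    proof (rule tendsto_sandwich[OF _ _ tendsto_const])
      show "\<forall>\<^sub>F i in F. norm (cnj (d i) *\<^sub>C W i - Y) \<le> cmod (cnj (d i) - 1) * norm (W i) + norm (W i - Y)"
      proof (intro always_eventually allI)
        fix i
        have e: "cnj (d i) *\<^sub>C W i - Y = (cnj (d i) - 1) *\<^sub>C W i + (W i - Y)" by (simp add: scaleC_diff_left)
        show "norm (cnj (d i) *\<^sub>C W i - Y) \<le> cmod (cnj (d i) - 1) * norm (W i) + norm (W i - Y)"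
          unfolding e norm_scaleC_prod[symmetric] by (rule norm_triangle_ineq)
      qed
      have "((\<lambda>i. cmod (cnj (d i) - 1) * norm (W i) + norm (W i - Y)) \<longlongrightarrow> cmod (cnj 1 - 1) * norm Y + norm (Y - Y)) F"
        by (intro tendsto_intros d W)
      then show "((\<lambda>i. cmod (cnj (d i) - 1) * norm (W i) + norm (W i - Y)) \<longlongrightarrow> 0) F" by simp
    qed simp
    then have lim: "((\<lambda>i. cnj (d i) *\<^sub>C W i) \<longlongrightarrow> Y) F" by (simp add: tendsto_norm_zero_iff LIM_zero_iff)
    have "\<forall>\<^sub>F i in F. cnj (d i) *\<^sub>C W i = U i Y"
      using ev
    proof eventually_elim
      case (elim i)
      have p: "hpositive (U i Y)" using U_hform[of i Y Y] Y(1) by (simp add: hpositive_def)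
      obtain m where m: "m \<noteq> 0" "W i = m *\<^sub>C U i Y"
        using chyp_of_eq_iff[OF p W(1)[of i]] W(2)[of i] U_act[OF elim Y(1)] by auto
      have "d i = m" using AY by (simp add: d_def m(2) hform_scaleC_right U_hform)
      moreover have "cnj m * m = 1"
        using W(3)[of i] unfolding m(2) by (simp add: hform_scaleC_left hform_scaleC_right U_hform Y mult.commute)
      ultimately show ?case by (simp add: m(2) scaleC_scaleC)
    qed
    then show ?thesis by (rule Lim_transform_eventually[OF lim])
  qed
  have sub: "subspace {X. ((\<lambda>i. U i X) \<longlongrightarrow> X) F}"
    unfolding subspace_def
  proof (intro conjI ballI allI; (elim CollectE)?)
    have "U i 0 = 0" for i using U_scale[of i 0 0] by simp
    then show "0 \<in> {X. ((\<lambda>i. U i X) \<longlongrightarrow> X) F}" by simp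
  next
    fix X Y assume "((\<lambda>i. U i X) \<longlongrightarrow> X) F" "((\<lambda>i. U i Y) \<longlongrightarrow> Y) F"
    then show "X + Y \<in> {X. ((\<lambda>i. U i X) \<longlongrightarrow> X) F}" by (simp add: U_add tendsto_add)
  next
    fix r X assume "((\<lambda>i. U i X) \<longlongrightarrow> X) F"
    then show "r *\<^sub>R X \<in> {X. ((\<lambda>i. U i X) \<longlongrightarrow> X) F}"
      by (simp add: scaleR_prod_scaleC U_scale) (simp add: tendsto_scaleR flip: scaleR_prod_scaleC)
  qed
  have "lifts S \<subseteq> {X. ((\<lambda>i. U i X) \<longlongrightarrow> X) F}"
  proof
    fix X assume X: "X \<in> lifts S"
    define r where "r = sqrt (Re (hform X X))"
    have r: "r > 0" "r * r = Re (hform X X)" using X by (simp_all add: r_def lifts_def hpositive_def)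
    define Y where "Y = complex_of_real (1 / r) *\<^sub>C X"
    have "Re (hform Y Y) = 1" unfolding Y_def Re_hform_scaleC r(2)[symmetric] using r(1) by (simp add: norm_divide power_divide power2_eq_square)
    then have "hform Y Y = 1" by (subst hform_self) simp
    moreover have "hpositive Y" "chyp_of Y \<in> S" using X r by (simp_all add: Y_def lifts_def chyp_of_scaleC)
    ultimately have "((\<lambda>i. U i Y) \<longlongrightarrow> Y) F" using unit by blast
    then have "r *\<^sub>R Y \<in> {X. ((\<lambda>i. U i X) \<longlongrightarrow> X) F}" using subspace_scale[OF sub] by blast
    moreover have "r *\<^sub>R Y = X" using r by (simp add: Y_def scaleR_prod_scaleC scaleC_scaleC)
    ultimately show "X \<in> {X. ((\<lambda>i. U i X) \<longlongrightarrow> X) F}" by simp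
  qed
  then have span: "((\<lambda>i. U i X) \<longlongrightarrow> X) F" if "X \<in> span (lifts S)" for X
    using span_minimal[OF _ sub] that by blast
  show ?thesis
  proof (rule tendstoI)
    fix \<epsilon> :: real assume \<epsilon>: "\<epsilon> > 0"
    obtain Y where Y: "hpositive Y" "y = chyp_of Y" by (metis chyp_cases)
    obtain V where V: "\<And>n. V n \<in> span (lifts S)" "V \<longlonglongrightarrow> Y"
      using dense[OF Y(1)] closure_sequential by blast
    note t = chyp_of_tendsto[OF V(2) Y(1)]
    have "\<forall>\<^sub>F n in sequentially. hpositive (V n) \<and> dist (chyp_of (V n)) y < \<epsilon> / 3"
      using t(2) tendstoD[OF t(1), of "\<epsilon> / 3"] \<epsilon> Y(2) by (intro eventually_conj) auto
    then obtain n where n: "hpositive (V n)" "dist (chyp_of (V n)) y < \<epsilon> / 3"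
      by (auto simp: eventually_sequentially)
    have "((\<lambda>i. chyp_of (U i (V n))) \<longlongrightarrow> chyp_of (V n)) F"
      by (rule chyp_of_tendsto(1)[OF span[OF V(1)] n(1)])
    from tendstoD[OF this, of "\<epsilon> / 3"] \<epsilon>
    have "\<forall>\<^sub>F i in F. dist (chyp_of (U i (V n))) (chyp_of (V n)) < \<epsilon> / 3" by simp
    then show "\<forall>\<^sub>F i in F. dist (h i y) y < \<epsilon>"
      using ev
    proof eventually_elim
      case (elim i)
      have "dist (h i y) (h i (chyp_of (V n))) = dist y (chyp_of (V n))" using h by (simp add: in_Isom_iff)
      moreover have "dist (h i (chyp_of (V n))) (chyp_of (V n)) < \<epsilon> / 3" using elim U_act n(1) by simp
      moreover have "dist (h i y) y \<le> dist (h i y) (h i (chyp_of (V n))) + dist (h i (chyp_of (V n))) (chyp_of (V n)) + dist (chyp_of (V n)) y"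
        by (meson add_mono dist_triangle order_refl order_trans)
      ultimately show ?case using n(2) by (simp add: dist_commute)
    qed
  qed
qed

lemma chyp_subspace_image:
  assumes g: "g \<in> carrier Isom" and Y: "chyp_subspace Y"
  shows "chyp_subspace (g ` Y)"
proof -
  obtain W where W: "csubspace W" "closed W" "Y = chyp_of ` {X \<in> W. hpositive X}" "Y \<noteq> {}"
    using Y by (auto simp: chyp_subspace_def)
  obtain s T where T: "hsemilinear s T" "g = act T" using Isom_hsemilinear[OF g] .
  note D = hsemilinearD[OF T(1)]
  define S where "S = inv_into UNIV T"
  have S: "hsemilinear s S" unfolding S_def by (rule hsemilinear_inv[OF T(1)])
  have TS: "T (S X) = X" "S (T X) = X" for X
    unfolding S_def using D(5) by (simp_all add: bij_is_inj bij_is_surj surj_f_inv_f)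
  have "csubspace (T ` W)"
    unfolding csubspace_def
  proof (intro conjI ballI allI)
    have "T 0 = 0" using D(3)[of 0 0] D(9)[of 0] by simp
    then show "0 \<in> T ` W" using W(1) by (force simp: csubspace_def)
    show "X + Y \<in> T ` W" if XY: "X \<in> T ` W" "Y \<in> T ` W" for X Y
    proof -
      obtain V V' where "V \<in> W" "X = T V" "V' \<in> W" "Y = T V'" using XY by blast
      then show ?thesis using W(1) D(2)[of V V'] unfolding csubspace_def by (metis imageI)
    qed
    show "c *\<^sub>C X \<in> T ` W" if X: "X \<in> T ` W" for c X
    proof -
      obtain V where V: "V \<in> W" "X = T V" using X by blast
      have "c *\<^sub>C X = T (s c *\<^sub>C V)" using D(3)[of "s c" V] D(8)[of c] V by simp
      then show ?thesis using V W(1) by (auto simp: csubspace_def)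
    qed
  qed
  moreover have "closed (T ` W)"
  proof -
    have "T ` W = S -` W" using TS by (auto simp: image_iff) (metis TS)
    moreover have "continuous_on UNIV S" by (intro linear_continuous_on hsemilinear_bounded[OF S])
    ultimately show ?thesis using W(2) by (simp add: closed_vimage)
  qed
  moreover have "g ` Y = chyp_of ` {X \<in> T ` W. hpositive X}"
    unfolding W(3) T(2) using act_chyp_of[OF T(1)] hsemilinear_hpositive[OF T(1)]
    by (auto simp: image_iff) (metis act_chyp_of[OF T(1)])+
  ultimately show ?thesis using W(4) unfolding chyp_subspace_def by blast
qed

context equivariant_power_map
begin

text \<open>The closed span of the lifts cuts out an invariant complex hyperbolic subspace, because
  every \<open>\<rho> g\<close> permutes the image of \<open>f\<close>. Irreducibility makes it
  everything.\<close>

lemma span_lifts_dense: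
  assumes irr: "irreducible_part (\<rho> ` carrier Isom) UNIV" and X: "hpositive X"
  shows "X \<in> closure (span (lifts (range f)))"
proof -
  define W where "W = closure (span (lifts (range f)))"
  define Y where "Y = chyp_of ` {X \<in> W. hpositive X}"
  have sub: "\<rho> g ` Y \<subseteq> Y" "Y \<subseteq> \<rho> g ` Y" if g: "g \<in> carrier Isom" for g
  proof -
    obtain s T where T: "hsemilinear s T" "\<rho> g = act T" using Isom_hsemilinear[OF rho_Isom[OF g]] .
    define S where "S = inv_into UNIV T"
    have S: "hsemilinear s S" unfolding S_def by (rule hsemilinear_inv[OF T(1)])
    have TS: "T (S X) = X" "S (T X) = X" for X
      unfolding S_def using hsemilinearD(5)[OF T(1)] by (simp_all add: bij_is_inj bij_is_surj surj_f_inv_f)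
    have TL: "T ` lifts (range f) \<subseteq> lifts (range f)"
    proof
      fix Z assume "Z \<in> T ` lifts (range f)"
      then obtain X x where X: "Z = T X" "hpositive X" "chyp_of X = f x" by (auto simp: lifts_def)
      have "chyp_of (T X) = f (g x)" using act_chyp_of[OF T(1) X(2)] equivariant[OF g, of x] X T by simp
      then show "Z \<in> lifts (range f)" using X by (simp add: lifts_def hsemilinear_hpositive[OF T(1)])
    qed
    have SL: "S ` lifts (range f) \<subseteq> lifts (range f)"
    proof
      fix Z assume "Z \<in> S ` lifts (range f)"
      then obtain X x where X: "Z = S X" "hpositive X" "chyp_of X = f x" by (auto simp: lifts_def)
      define x' where "x' = inv_into UNIV g x"
      have "g x' = x" unfolding x'_def by (rule Isom_inv_into(2)[OF g])
      then have "act T (f x') = f x" using equivariant[OF g, of x'] T(2) by simp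
      moreover have "act T (chyp_of (S X)) = chyp_of X"
        using act_chyp_of[OF T(1)] X(2) by (simp add: hsemilinear_hpositive[OF S] TS)
      ultimately have "act T (chyp_of (S X)) = act T (f x')" using X(3) by simp
      then have "chyp_of (S X) = f x'"
        using act_in_Isom[OF T(1)] by (simp add: in_Isom_iff bij_is_inj inj_eq)
      then show "Z \<in> lifts (range f)" using X by (simp add: lifts_def hsemilinear_hpositive[OF S])
    qed
    have WW: "R V \<in> W" if R: "hsemilinear s R" "R ` lifts (range f) \<subseteq> lifts (range f)" and V: "V \<in> W" for R V
    proof -
      note bl = hsemilinear_bounded[OF R(1)]
      have "R ` span (lifts (range f)) = span (R ` lifts (range f))"
        using linear_span_image[OF bounded_linear.linear[OF bl]] by simp
      also have "\<dots> \<subseteq> span (lifts (range f))" by (rule span_mono[OF R(2)])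
      finally have "closure (R ` span (lifts (range f))) \<subseteq> W" unfolding W_def by (rule closure_mono)
      then show ?thesis using closure_bounded_linear_image_subset[OF bl, of "span (lifts (range f))"] V
        unfolding W_def by blast
    qed
    show "\<rho> g ` Y \<subseteq> Y"
    proof
      fix z assume "z \<in> \<rho> g ` Y"
      then obtain X where X: "X \<in> W" "hpositive X" "z = \<rho> g (chyp_of X)" by (auto simp: Y_def)
      then have "z = chyp_of (T X)" by (simp add: T(2) act_chyp_of[OF T(1)])
      then show "z \<in> Y" using WW[OF T(1) TL X(1)] X(2) by (auto simp: Y_def hsemilinear_hpositive[OF T(1)])
    qed
    show "Y \<subseteq> \<rho> g ` Y"
    proof
      fix z assume "z \<in> Y"
      then obtain X where X: "X \<in> W" "hpositive X" "z = chyp_of X" by (auto simp: Y_def)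
      then have "z = \<rho> g (chyp_of (S X))"
        using act_chyp_of[OF T(1)] by (simp add: T(2) hsemilinear_hpositive[OF S] TS)
      moreover have "chyp_of (S X) \<in> Y" using WW[OF S SL X(1)] X(2) by (auto simp: Y_def hsemilinear_hpositive[OF S])
      ultimately show "z \<in> \<rho> g ` Y" by blast
    qed
  qed
  have "F 0 \<in> lifts (range f)" using F by (simp add: lifts_def)
  then have "F 0 \<in> W" unfolding W_def using closure_subset span_base by blast
  then have "Y \<noteq> {}" using F(1)[of 0] unfolding Y_def by blast
  then have "chyp_subspace Y"
    unfolding chyp_subspace_def using csubspace_closure_span_lifts[of "range f"] closed_closure
    unfolding Y_def W_def by blast
  moreover have "\<forall>k \<in> \<rho> ` carrier Isom. k ` Y = Y" using sub by blast
  ultimately have "Y = UNIV" using irr unfolding irreducible_part_def by blast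
  then have "chyp_of X \<in> Y" by simp
  then obtain V where V: "V \<in> W" "hpositive V" "chyp_of X = chyp_of V" unfolding Y_def by blast
  obtain c where "X = c *\<^sub>C V" using chyp_of_eq_iff[OF V(2) X] V(3) by auto
  then show ?thesis using csubspace_closure_span_lifts[of "range f"] V(1) unfolding W_def csubspace_def by blast
qed

lemma rho_continuous:
  assumes irr: "irreducible_part (\<rho> ` carrier Isom) UNIV"
  shows "continuous_on (carrier Isom) \<rho>"
proof (rule continuous_on_coordinatewise_then_product)
  fix y :: "'h chyp"
  obtain \<tau> where \<tau>: "\<tau> = t \<or> \<tau> = - t" "\<And>x y z. cartan_arg (f x) (f y) (f z) = \<tau> * cartan_arg x y z"
    using cartan_arg_f by blast
  \<comment> \<open>With the origin these form a triangle of non-zero Cartan argument, since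
    \<open>1 - \<i> / 4\<close> is not real; as \<open>\<tau>\<close> is non-zero, the image
    triangle has the same property.\<close>
  define u v where "u = (1 / 2 :: complex) *\<^sub>C e0" and "v = (\<i> / 2) *\<^sub>C e0"
  have uv: "norm u < 1" "norm v < 1" "cinner u v = \<i> / 4"
    by (simp_all add: u_def v_def norm_scaleC norm_divide cinner_scaleC_left cinner_scaleC_right)
  have "1 - \<i> / 4 \<notin> \<real>" by (simp add: complex_is_Real_iff)
  then have "Arg (1 - cinner u v) \<noteq> 0" unfolding uv(3) by (subst Arg_eq_0) simp
  then have nz: "cartan_arg (f (pt 0)) (f (pt u)) (f (pt v)) \<noteq> 0"
    using \<tau> t_pos by (auto simp: cartan_arg_pt[OF uv(1,2)])
  show "continuous_on (carrier Isom) (\<lambda>g. \<rho> g y)"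
    unfolding continuous_on_def
  proof
    fix g0 :: "'h chyp \<Rightarrow> 'h chyp" assume g0: "g0 \<in> carrier Isom"
    let ?F = "at g0 within carrier Isom"
    define r where "r = inv_into UNIV (\<rho> g0)"
    have r: "r \<in> carrier Isom" "\<rho> g0 (r x) = x" "r (\<rho> g0 x) = x" for x
      unfolding r_def using Isom_inv_into[OF rho_Isom[OF g0]] by blast+
    \<comment> \<open>Composing with the inverse of \<open>\<rho> g0\<close> reduces continuity at
      \<open>g0\<close> to convergence to the identity. The default \<open>id\<close> makes
      \<open>h g\<close> an isometry for every index, as \<open>isometries_converge\<close>
      requires.\<close>
    define h where "h g = (if g \<in> carrier Isom then r \<circ> \<rho> g else id)" for g
    have id: "id \<in> carrier Isom" by (simp add: in_Isom_iff)
    have hI: "h g \<in> carrier Isom" for g by (auto simp: h_def intro!: Isom_compose r(1) rho_Isom id)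
    have evI: "\<forall>\<^sub>F g in ?F. g \<in> carrier Isom" by (simp add: eventually_at_filter)
    have dh: "dist (h g x) x = dist (\<rho> g x) (\<rho> g0 x)" if "g \<in> carrier Isom" for g x
    proof -
      have "dist (h g x) x = dist (r (\<rho> g x)) (r (\<rho> g0 x))" using that r(3) by (simp add: h_def)
      then show ?thesis using r(1) by (simp add: in_Isom_iff)
    qed
    have coord: "((\<lambda>g. g x) \<longlongrightarrow> g0 x) ?F" for x
      using continuous_on_subset[OF continuous_on_product_coordinates[of x] subset_UNIV, of "carrier Isom"] g0
      unfolding continuous_on_def by blast
    have "((\<lambda>g. h g z) \<longlongrightarrow> z) ?F" if z: "z \<in> range f" for z
    proof -
      obtain x where x: "z = f x" using z by blast
      have "((\<lambda>g. f (g x)) \<longlongrightarrow> f (g0 x)) ?F" by (rule f_tendsto[OF coord])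
      then have "((\<lambda>g. dist (f (g x)) (f (g0 x))) \<longlongrightarrow> 0) ?F" by (rule tendsto_dist_iff[THEN iffD1])
      then have "((\<lambda>g. dist (h g z) z) \<longlongrightarrow> 0) ?F"
        by (rule Lim_transform_eventually) (use evI in eventually_elim, simp add: dh x equivariant g0)
      then show ?thesis by (rule tendsto_dist_iff[THEN iffD2])
    qed
    then have "((\<lambda>g. h g y) \<longlongrightarrow> y) ?F"
      by (rule isometries_converge[OF hI _ rangeI rangeI rangeI nz span_lifts_dense[OF irr]])
    then have "((\<lambda>g. dist (h g y) y) \<longlongrightarrow> 0) ?F" by (rule tendsto_dist_iff[THEN iffD1])
    then have "((\<lambda>g. dist (\<rho> g y) (\<rho> g0 y)) \<longlongrightarrow> 0) ?F"
      by (rule Lim_transform_eventually) (use evI in eventually_elim, simp add: dh)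
    then show "((\<lambda>g. \<rho> g y) \<longlongrightarrow> \<rho> g0 y) ?F" by (rule tendsto_dist_iff[THEN iffD2])
  qed
qed

end


section \<open>Conjugation\<close>

lemma boundary_action_ideal_boundary:
  assumes k: "k \<in> carrier Isom" and \<xi>: "\<xi> \<in> ideal_boundary"
  shows "boundary_action k \<xi> \<in> ideal_boundary"
proof -
  obtain r where r: "geodesic_ray r" "\<xi> = asymptotic_rays `` {r}"
    using \<xi> by (auto simp: ideal_boundary_def quotient_def)
  define k' where "k' = inv_into UNIV k"
  have k': "k' \<in> carrier Isom" "\<And>x. k (k' x) = x" "\<And>x. k' (k x) = x"
    unfolding k'_def using Isom_inv_into[OF k] by blast+
  have d: "dist (k x) (k y) = dist x y" "dist (k' x) (k' y) = dist x y" for x y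
    using k k' by (simp_all add: in_Isom_iff)
  have "boundary_action k \<xi> = asymptotic_rays `` {k \<circ> r}"
  proof
    show "boundary_action k \<xi> \<subseteq> asymptotic_rays `` {k \<circ> r}"
      unfolding r(2) by (auto simp: boundary_action_def asymptotic_rays_def geodesic_ray_def d) blast
    show "asymptotic_rays `` {k \<circ> r} \<subseteq> boundary_action k \<xi>"
    proof
      fix r' assume "r' \<in> asymptotic_rays `` {k \<circ> r}"
      then obtain C where r': "geodesic_ray r'" "\<And>t. t \<ge> 0 \<Longrightarrow> dist (k (r t)) (r' t) \<le> C"
        by (auto simp: asymptotic_rays_def)
      have "dist (r t) (k' (r' t)) = dist (k (r t)) (r' t)" for t
        using d(1)[of "r t" "k' (r' t)"] k'(2) by simp
      then have "k' \<circ> r' \<in> \<xi>"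
        using r r' by (auto simp: asymptotic_rays_def geodesic_ray_def d intro!: exI[of _ C])
      moreover have "r' = k \<circ> (k' \<circ> r')" using k'(2) by auto
      ultimately show "r' \<in> boundary_action k \<xi>" unfolding boundary_action_def by blast
    qed
  qed
  moreover have "geodesic_ray (k \<circ> r)" using r(1) by (simp add: geodesic_ray_def d)
  ultimately show ?thesis by (auto simp: ideal_boundary_def quotient_def)
qed

lemma map_sum_boundary_action_compose:
  "map_sum (g \<circ> h) (boundary_action (g \<circ> h)) ` S
    = map_sum g (boundary_action g) ` map_sum h (boundary_action h) ` S"
proof -
  have "map_sum (g \<circ> h) (boundary_action (g \<circ> h)) x = map_sum g (boundary_action g) (map_sum h (boundary_action h) x)" for x
    by (cases x) (simp_all add: boundary_action_def image_image comp_assoc)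
  then show ?thesis by (simp add: image_image)
qed

text \<open>The inverse of \<open>h\<close> carries a finite set preserved by the conjugates to one
  preserved by \<open>A\<close>, on the space and on its boundary alike.\<close>

lemma nonelementary_conjugate:
  assumes A: "nonelementary A" and h: "h \<in> carrier Isom"
  shows "nonelementary ((\<lambda>g. h \<circ> g \<circ> inv_into UNIV h) ` A)"
  unfolding nonelementary_def
proof
  define k where "k = inv_into UNIV h"
  have k: "k \<in> carrier Isom" "k \<circ> h = id"
    unfolding k_def using Isom_inv_into[OF h] by auto
  assume "\<exists>S \<subseteq> UNIV <+> ideal_boundary. finite S \<and> S \<noteq> {} \<and>
      (\<forall>g\<in>(\<lambda>g. h \<circ> g \<circ> inv_into UNIV h) ` A. map_sum g (boundary_action g) ` S = S)"
  then obtain S where S: "S \<subseteq> UNIV <+> ideal_boundary" "finite S" "S \<noteq> {}"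
    and inv: "\<forall>g\<in>(\<lambda>g. h \<circ> g \<circ> k) ` A. map_sum g (boundary_action g) ` S = S"
    unfolding k_def by (elim exE conjE)
  have inv: "map_sum (h \<circ> g \<circ> k) (boundary_action (h \<circ> g \<circ> k)) ` S = S" if "g \<in> A" for g
    by (rule inv[rule_format]) (use that in blast)
  define S' where "S' = map_sum k (boundary_action k) ` S"
  have "map_sum g (boundary_action g) ` S' = S'" if "g \<in> A" for g
  proof -
    have "S' = map_sum k (boundary_action k) ` map_sum (h \<circ> g \<circ> k) (boundary_action (h \<circ> g \<circ> k)) ` S"
      unfolding S'_def inv[OF that] ..
    also have "\<dots> = map_sum (k \<circ> (h \<circ> g \<circ> k)) (boundary_action (k \<circ> (h \<circ> g \<circ> k))) ` S"
      by (rule map_sum_boundary_action_compose[symmetric])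
    also have "k \<circ> (h \<circ> g \<circ> k) = g \<circ> k" using k(2) by (metis comp_assoc id_comp)
    also have "map_sum (g \<circ> k) (boundary_action (g \<circ> k)) ` S = map_sum g (boundary_action g) ` S'"
      unfolding S'_def by (rule map_sum_boundary_action_compose)
    finally show ?thesis by simp
  qed
  moreover have "S' \<subseteq> UNIV <+> ideal_boundary"
  proof
    fix z assume "z \<in> S'"
    then obtain x where x: "x \<in> S" "z = map_sum k (boundary_action k) x" unfolding S'_def by blast
    then have "x \<in> UNIV <+> ideal_boundary" using S(1) by blast
    then show "z \<in> UNIV <+> ideal_boundary"
      unfolding x(2) by (rule PlusE) (simp_all add: boundary_action_ideal_boundary[OF k(1)] InlI InrI)
  qed
  moreover have "finite S'" "S' \<noteq> {}" using S by (simp_all add: S'_def)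
  ultimately show False using A unfolding nonelementary_def by blast
qed

lemma irreducible_action_conjugate:
  fixes A :: "('h::complex_hilbert chyp \<Rightarrow> 'h chyp) set"
  assumes A: "irreducible_action A" and AI: "A \<subseteq> carrier Isom" and h: "h \<in> carrier Isom"
  shows "irreducible_action ((\<lambda>g. h \<circ> g \<circ> inv_into UNIV h) ` A)"
proof -
  define k where "k = inv_into UNIV h"
  have k: "k \<in> carrier Isom" "\<And>x. k (h x) = x" "\<And>x. h (k x) = x"
    unfolding k_def using Isom_inv_into[OF h] by auto
  have irr: "chyp_subspace (UNIV :: 'h chyp set)"
    "\<And>Y. chyp_subspace Y \<Longrightarrow> (\<And>g. g \<in> A \<Longrightarrow> g ` Y = Y) \<Longrightarrow> Y = UNIV"
    using A by (auto simp: irreducible_action_def irreducible_part_def)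
  have "irreducible_part ((\<lambda>g. h \<circ> g \<circ> k) ` A) UNIV"
    unfolding irreducible_part_def
  proof (intro conjI ballI allI impI)
    fix g assume "g \<in> (\<lambda>g. h \<circ> g \<circ> k) ` A"
    then obtain g' where "g' \<in> carrier Isom" "g = h \<circ> g' \<circ> k" using AI by blast
    then have "g \<in> carrier Isom" using h k(1) Isom_compose by blast
    then show "g ` UNIV = UNIV" by (simp add: in_Isom_iff bij_is_surj)
  next
    fix Y assume Y: "chyp_subspace Y \<and> Y \<subseteq> UNIV \<and> (\<forall>g\<in>(\<lambda>g. h \<circ> g \<circ> k) ` A. g ` Y = Y)"
    have "k ` Y = UNIV"
    proof (rule irr(2))
      show "chyp_subspace (k ` Y)" using chyp_subspace_image[OF k(1)] Y by blast
      fix g assume "g \<in> A"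
      then have "h ` g ` k ` Y = Y" using Y by (auto simp: image_comp)
      then have "k ` h ` g ` k ` Y = k ` Y" by simp
      then show "g ` k ` Y = k ` Y" by (simp add: image_image k(2))
    qed
    then have "h ` k ` Y = h ` UNIV" by simp
    moreover have "h ` UNIV = UNIV" using h by (simp add: in_Isom_iff bij_is_surj)
    ultimately show "Y = UNIV" by (simp add: image_image k(3))
  qed (rule irr(1))
  then show ?thesis
    using A nonelementary_conjugate[OF _ h] by (simp add: irreducible_action_def k_def)
qed

lemma inv_Isom:
  assumes "h \<in> carrier Isom"
  shows "inv\<^bsub>Isom\<^esub> h = inv_into UNIV h"
  by (rule group.inv_equality[OF group_Isom])
    (use Isom_inv_into[OF assms] assms in \<open>auto simp: fun_eq_iff\<close>)

text \<open>Complex conjugation with respect to \<open>V\<close>, which sends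
  \<open>A + \<i> *\<^sub>C B\<close> to \<open>A - \<i> *\<^sub>C B\<close>. It provides the
  anti-holomorphic isometry that changes the sign of \<open>\<tau>\<close>.\<close>

lemma real_form_conjugation:
  fixes V :: "(complex \<times> 'h::complex_hilbert) set"
  assumes V: "real_form V"
  obtains J :: "complex \<times> 'h \<Rightarrow> complex \<times> 'h" where "hsemilinear cnj J"
proof -
  have sub: "subspace V" using V by (simp only: real_form_def)
  have ex: "\<exists>!(A, B). A \<in> V \<and> B \<in> V \<and> X = A + \<i> *\<^sub>C B" for X
    using V unfolding real_form_def by (elim conjE allE)
  have re: "hform X Y \<in> \<real>" if "X \<in> V" "Y \<in> V" for X Y
    using V that unfolding real_form_def by (elim conjE) (simp only:)
  have "\<exists>p. fst p \<in> V \<and> snd p \<in> V \<and> X = fst p + \<i> *\<^sub>C snd p" for X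
    using ex1_implies_ex[OF ex[of X]] by auto
  then obtain p where p: "\<And>X. fst (p X) \<in> V" "\<And>X. snd (p X) \<in> V" "\<And>X. X = fst (p X) + \<i> *\<^sub>C snd (p X)"
    by metis
  define a b where "a X = fst (p X)" and "b X = snd (p X)" for X
  have ab: "a X \<in> V" "b X \<in> V" "X = a X + \<i> *\<^sub>C b X" for X using p by (simp_all add: a_def b_def)
  have uniq: "a X = A \<and> b X = B" if "A \<in> V" "B \<in> V" "X = A + \<i> *\<^sub>C B" for X A B
  proof -
    obtain q where q: "\<And>r. (case r of (A, B) \<Rightarrow> A \<in> V \<and> B \<in> V \<and> X = A + \<i> *\<^sub>C B) \<Longrightarrow> r = q"
      using ex[of X] by (metis (no_types, lifting))
    have "(A, B) = q" using q[of "(A, B)"] that by simp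
    moreover have "(a X, b X) = q" using q[of "(a X, b X)"] ab[of X] by simp
    ultimately have "(a X, b X) = (A, B)" by simp
    then show ?thesis by simp
  qed
  have ii: "\<i> *\<^sub>C \<i> *\<^sub>C X = - X" for X :: "complex \<times> 'h" by (simp add: scaleC_scaleC scaleC_minus_left)
  define J where "J X = a X - \<i> *\<^sub>C b X" for X
  have add: "a (X + Y) = a X + a Y \<and> b (X + Y) = b X + b Y" for X Y
    by (rule uniq) (use ab[of X] ab[of Y] sub in \<open>auto simp: subspace_add scaleC_add_right algebra_simps\<close>)
  have scR: "a (r *\<^sub>R X) = r *\<^sub>R a X \<and> b (r *\<^sub>R X) = r *\<^sub>R b X" for r X
  proof (rule uniq)
    have "r *\<^sub>R X = r *\<^sub>R (a X + \<i> *\<^sub>C b X)" using ab(3)[of X] by (rule arg_cong)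
    then show "r *\<^sub>R X = r *\<^sub>R a X + \<i> *\<^sub>C (r *\<^sub>R b X)" by (simp add: scaleR_add_right scaleC_scaleR_commute)
  qed (rule subspace_scale[OF sub ab(1)], rule subspace_scale[OF sub ab(2)])
  have sci: "a (\<i> *\<^sub>C X) = - b X \<and> b (\<i> *\<^sub>C X) = a X" for X
  proof (rule uniq)
    have "\<i> *\<^sub>C X = \<i> *\<^sub>C (a X + \<i> *\<^sub>C b X)" using ab(3)[of X] by (rule arg_cong)
    then show "\<i> *\<^sub>C X = - b X + \<i> *\<^sub>C a X" by (simp add: scaleC_add_right ii)
  qed (rule subspace_neg[OF sub ab(2)], rule ab(1))
  have J_add: "J (X + Y) = J X + J Y" for X Y by (simp add: J_def add scaleC_add_right)
  have J_scR: "J (r *\<^sub>R X) = r *\<^sub>R J X" for r X by (simp add: J_def scR scaleR_diff_right scaleC_scaleR_commute)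
  have J_i: "J (\<i> *\<^sub>C X) = - (\<i> *\<^sub>C J X)" for X by (simp add: J_def sci scaleC_diff_right ii)
  have J_c: "J (c *\<^sub>C X) = cnj c *\<^sub>C J X" for c X
  proof -
    have "J (c *\<^sub>C X) = Re c *\<^sub>R J X - \<i> *\<^sub>C (Im c *\<^sub>R J X)"
      unfolding scaleC_complex_cases[of c X] J_add J_i J_scR by simp
    also have "\<dots> = cnj c *\<^sub>C J X"
      unfolding scaleC_complex_cases[of "cnj c" "J X"] by (simp add: scaleC_minus_right)
    finally show ?thesis .
  qed
  have J_J: "J (J X) = X" for X
  proof -
    have "a (J X) = a X \<and> b (J X) = - b X"
      by (rule uniq[OF ab(1) subspace_neg[OF sub ab(2)]]) (simp add: J_def scaleC_minus_right)
    then have "J (J X) = a X + \<i> *\<^sub>C b X" by (simp add: J_def[of "J X"] scaleC_minus_right)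
    then show ?thesis using ab(3)[of X] by simp
  qed
  have J_form: "hform (J X) (J Y) = cnj (hform X Y)" for X Y
  proof -
    have r: "cnj (hform A B) = hform A B" if "A \<in> V" "B \<in> V" for A B
      using re[OF that] by (simp add: Reals_cnj_iff)
    have "hform X Y = hform (a X + \<i> *\<^sub>C b X) (a Y + \<i> *\<^sub>C b Y)"
      using ab(3)[of X] ab(3)[of Y] by (rule arg_cong2)
    also have "\<dots> = hform (a X) (a Y) + hform (b X) (b Y) + \<i> * hform (a X) (b Y) - \<i> * hform (b X) (a Y)"
      by (simp add: hform_add_left hform_add_right hform_scaleC_left hform_scaleC_right algebra_simps)
    finally have XY: "hform X Y = hform (a X) (a Y) + hform (b X) (b Y) + \<i> * hform (a X) (b Y) - \<i> * hform (b X) (a Y)" .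
    have "hform (J X) (J Y) = hform (a X) (a Y) + hform (b X) (b Y) - \<i> * hform (a X) (b Y) + \<i> * hform (b X) (a Y)"
      by (simp add: J_def hform_diff_left hform_diff_right hform_scaleC_left hform_scaleC_right algebra_simps)
    then show ?thesis unfolding XY by (simp add: r ab(1,2))
  qed
  have "bij J" using J_J by (intro o_bij[of J]) auto
  then have "hsemilinear cnj J" using J_add J_c J_form by (simp add: hsemilinear_def del: split_paired_All)
  then show ?thesis by (rule that)
qed

text \<open>The orbit map of \<^term>\<open>p\<close> is well defined because the stabiliser of \<^term>\<open>q\<close> fixes \<^term>\<open>p\<close>.\<close>
lemma orbit_map_exists:
  fixes \<rho> :: "('h::complex_hilbert chyp \<Rightarrow> 'h chyp) \<Rightarrow> 'h chyp \<Rightarrow> 'h chyp"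
  assumes separable: "\<exists>D::'h set. countable D \<and> closure D = UNIV"
    and infinite_dimensional: "\<nexists>S::'h set. finite S \<and> span S = UNIV"
    and hom: "\<rho> \<in> hom Isom Isom"
    and irreducible: "irreducible_action (\<rho> ` carrier Isom)"
    and fix_p: "{y. \<forall>g\<in>carrier Isom. g q = q \<longrightarrow> \<rho> g y = y} = {p}"
  obtains f where "equivariant_map \<rho> f"
proof -
  have rI: "\<rho> g \<in> carrier Isom" if "g \<in> carrier Isom" for g
    using hom that by (simp add: hom_def Pi_iff)
  have rc: "\<rho> (g \<circ> h) x = \<rho> g (\<rho> h x)" if "g \<in> carrier Isom" "h \<in> carrier Isom" for g h x
    using hom that by (simp add: hom_def)
  have p_fix: "\<rho> g p = p" if "g \<in> carrier Isom" "g q = q" for g using fix_p that by blast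
  have inj: "x = y" if "\<rho> g x = \<rho> g y" "g \<in> carrier Isom" for g x y
    using rI[OF that(2)] that(1) by (simp add: in_Isom_iff bij_is_inj inj_eq)
  have trans: "\<exists>g \<in> carrier Isom. g q = x" for x
    using Isom_transitive[of q x] act_in_Isom by metis
  define f where "f x = \<rho> (SOME g. g \<in> carrier Isom \<and> g q = x) p" for x
  have f: "f (g q) = \<rho> g p" if g: "g \<in> carrier Isom" for g
  proof -
    define k where "k = (SOME k. k \<in> carrier Isom \<and> k q = g q)"
    have k: "k \<in> carrier Isom" "k q = g q" using someI_ex[of "\<lambda>k. k \<in> carrier Isom \<and> k q = g q"] g
      unfolding k_def by blast+
    define g' where "g' = inv_into UNIV g"
    have g': "g' \<in> carrier Isom" "\<And>x. g (g' x) = x" "\<And>x. g' (g x) = x"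
      unfolding g'_def using Isom_inv_into[OF g] by blast+
    have "\<rho> (g' \<circ> k) p = p" by (rule p_fix) (use k g' Isom_compose in auto)
    moreover have "k = g \<circ> (g' \<circ> k)" using g' by auto
    ultimately have "\<rho> k p = \<rho> g p" using rc[OF g Isom_compose[OF g'(1) k(1)], of p] by simp
    then show ?thesis by (simp add: f_def k_def)
  qed
  have equiv: "f (g x) = \<rho> g (f x)" if g: "g \<in> carrier Isom" for g x
  proof -
    obtain k where k: "k \<in> carrier Isom" "k q = x" using trans by blast
    then show ?thesis using f[OF Isom_compose[OF g k(1)]] f[OF k(1)] rc[OF g k(1), of p] by simp
  qed
  have "equivariant_map \<rho> f"
  proof
    show "\<exists>D::'h set. countable D \<and> closure D = UNIV" by (rule separable)
    show "\<nexists>S::'h set. finite S \<and> span S = UNIV" by (rule infinite_dimensional)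
    show "\<rho> \<in> hom Isom Isom" by (rule hom)
    show "f (g x) = \<rho> g (f x)" if "g \<in> carrier Isom" for g x using equiv that .
    show "y = f (pt 0)" if y: "\<And>g. g \<in> carrier Isom \<Longrightarrow> g (pt 0) = pt 0 \<Longrightarrow> \<rho> g y = y" for y
    proof -
      \<comment> \<open>The uniqueness of the fixed point is known at \<open>q\<close>. Conjugation
        by \<open>b\<close> identifies the stabilisers of \<open>q\<close> and \<open>pt 0\<close>,
        so the inverse of \<open>b\<close> moves \<open>y\<close> to a point that must be
        \<open>p\<close>.\<close>
      obtain b where b: "b \<in> carrier Isom" "b q = pt 0" using trans by blast
      define c where "c = inv_into UNIV b"
      have c: "c \<in> carrier Isom" "\<And>x. b (c x) = x" "\<And>x. c (b x) = x"
        unfolding c_def using Isom_inv_into[OF b(1)] by blast+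
      have bc: "\<rho> b (\<rho> k (\<rho> c y)) = y" if k: "k \<in> carrier Isom" "k q = q" for k
      proof -
        have "\<rho> (b \<circ> (k \<circ> c)) y = y"
          by (rule y) (use b c k in \<open>auto intro!: Isom_compose simp flip: b(2)\<close>)
        then show ?thesis using rc[OF b(1) Isom_compose[OF k(1) c(1)], of y] rc[OF k(1) c(1), of y] by simp
      qed
      have id: "id \<in> carrier Isom" by (simp add: in_Isom_iff)
      have "\<rho> k (\<rho> c y) = \<rho> c y" if "k \<in> carrier Isom" "k q = q" for k
      proof -
        have "\<rho> (b \<circ> c) y = y" by (rule y) (use b c Isom_compose in auto)
        then have "\<rho> b (\<rho> c y) = y" using rc[OF b(1) c(1), of y] by simp
        then have "\<rho> b (\<rho> k (\<rho> c y)) = \<rho> b (\<rho> c y)" using bc[OF that] by (simp only:)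
        then show ?thesis by (rule inj[OF _ b(1)])
      qed
      then have "\<rho> c y = p" using fix_p by blast
      then have "f (pt 0) = \<rho> b (\<rho> id (\<rho> c y))"
        using f[OF b(1)] b(2) p_fix[OF id] by simp
      then show ?thesis using bc[OF id] by simp
    qed
    show "\<exists>x y. f x \<noteq> f y"
    proof (rule ccontr)
      assume "\<not> ?thesis"
      \<comment> \<open>A constant equivariant map would have a global fixed point as its value,
        which a non-elementary action excludes.\<close>
      then have "f x = f (pt 0)" for x by blast
      then have "\<rho> g (f (pt 0)) = f (pt 0)" if "g \<in> carrier Isom" for g using equiv[OF that] by metis
      then have "\<forall>g\<in>\<rho> ` carrier Isom. map_sum g (boundary_action g) ` {Inl (f (pt 0))} = {Inl (f (pt 0))}" by simp
      moreover have "{Inl (f (pt 0))} \<subseteq> UNIV <+> (ideal_boundary :: (real \<Rightarrow> 'h chyp) set set)" by auto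
      ultimately show False
        using irreducible unfolding irreducible_action_def nonelementary_def by blast
    qed
  qed
  then show ?thesis using that by blast
qed

theorem theorem1p17:
  fixes \<rho> :: "('h::complex_hilbert chyp \<Rightarrow> 'h chyp) \<Rightarrow> 'h chyp \<Rightarrow> 'h chyp"
    and V :: "(complex \<times> 'h) set"
    and Orb\<^sub>C Orb\<^sub>R :: "'h chyp set"
  assumes separable: "\<exists>D::'h set. countable D \<and> closure D = UNIV"
    and infinite_dimensional: "\<nexists>S::'h set. finite S \<and> span S = UNIV"
    and real_form: "real_form V"
    and representation: "\<rho> \<in> hom Isom Isom"
    and irreducible: "irreducible_action (\<rho> ` carrier Isom)"
    and complex_orbit: "canonical_orbit (carrier Isom) UNIV \<rho> Orb\<^sub>C"
    and real_orbit: "canonical_orbit (real_Isom V) (real_hyp V) \<rho> Orb\<^sub>R"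
    and contains: "Orb\<^sub>R \<subseteq> Orb\<^sub>C"
  shows "\<exists>t>0. t \<le> 1 \<and>
    (\<exists>h \<in> carrier (Isom :: ('h chyp \<Rightarrow> 'h chyp) monoid). \<exists>\<rho>\<^sub>t \<in> hom Isom Isom.
      (\<forall>g \<in> carrier Isom. \<rho>\<^sub>t g = h \<otimes>\<^bsub>Isom\<^esub> \<rho> g \<otimes>\<^bsub>Isom\<^esub> inv\<^bsub>Isom\<^esub> h) \<and>
      irreducible_action (\<rho>\<^sub>t ` carrier Isom) \<and>
      continuous_on (carrier Isom) \<rho>\<^sub>t \<and>
      (\<exists>f :: 'h chyp \<Rightarrow> 'h chyp.
        (\<forall>g \<in> carrier Isom. \<forall>x. f (g x) = \<rho>\<^sub>t g (f x)) \<and>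
        (\<forall>x y. cosh (dist (f x) (f y)) = (cosh (dist x y)) powr t) \<and>
        (\<forall>x y z. cartan_arg (f x) (f y) (f z) = t * cartan_arg x y z)))"
proof -
  have irr: "irreducible_part (\<rho> ` carrier Isom) UNIV" using irreducible by (simp add: irreducible_action_def)
  obtain Y q p where Y: "irreducible_part (\<rho> ` carrier Isom) Y"
    and p: "{y \<in> Y. \<forall>g\<in>carrier Isom. g q = q \<longrightarrow> \<rho> g y = y} = {p}"
    using complex_orbit unfolding canonical_orbit_def by blast
  \<comment> \<open>\<open>Y\<close> is an invariant hyperbolic subspace, and irreducibility makes
    the whole space minimal among these.\<close>
  have "Y = UNIV" using Y irr unfolding irreducible_part_def by blast
  then have fix_p: "{y. \<forall>g\<in>carrier Isom. g q = q \<longrightarrow> \<rho> g y = y} = {p}" using p by simp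
  obtain f where "equivariant_map \<rho> f"
    by (rule orbit_map_exists[OF separable infinite_dimensional representation irreducible fix_p])
  then interpret equivariant_map \<rho> f .
  obtain t where t: "0 < t" "t \<le> 1" "\<And>c. c \<ge> 1 \<Longrightarrow> \<Phi> c = c powr t" using Phi_powr by blast
  interpret equivariant_power_map \<rho> f t by unfold_locales (use t in auto)
  obtain \<tau> where \<tau>: "\<tau> = t \<or> \<tau> = - t" "\<And>x y z. cartan_arg (f x) (f y) (f z) = \<tau> * cartan_arg x y z"
    using cartan_arg_f by blast
  obtain h where h: "h \<in> carrier Isom" "\<And>x y z. cartan_arg (h (f x)) (h (f y)) (h (f z)) = t * cartan_arg x y z"
  proof (cases "\<tau> = t")
    case True
    have "id \<in> carrier (Isom :: ('h chyp \<Rightarrow> 'h chyp) monoid)" by (simp add: in_Isom_iff)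
    then show ?thesis using that[of id] \<tau>(2) True by simp
  next
    case False
    obtain J :: "complex \<times> 'h \<Rightarrow> complex \<times> 'h" where J: "hsemilinear cnj J"
      by (rule real_form_conjugation[OF real_form])
    have "cnj \<noteq> id" by (rule notI, drule fun_cong[of _ _ \<i>]) simp
    then show ?thesis using that[OF act_in_Isom[OF J]] \<tau> False by (auto simp: cartan_arg_act[OF J])
  qed
  define k where "k = inv_into UNIV h"
  have k: "k \<in> carrier Isom" "\<And>x. k (h x) = x"
    unfolding k_def using Isom_inv_into[OF h(1)] by blast+
  define \<rho>\<^sub>t where "\<rho>\<^sub>t g = h \<circ> \<rho> g \<circ> k" for g
  have "\<rho>\<^sub>t \<in> hom Isom Isom"
    unfolding hom_def
  proof (intro CollectI conjI ballI funcsetI)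
    show "\<rho>\<^sub>t g \<in> carrier Isom" if "g \<in> carrier Isom" for g
      unfolding \<rho>\<^sub>t_def by (intro Isom_compose h(1) k(1) rho_Isom that)
    show "\<rho>\<^sub>t (g \<otimes>\<^bsub>Isom\<^esub> g') = \<rho>\<^sub>t g \<otimes>\<^bsub>Isom\<^esub> \<rho>\<^sub>t g'" if "g \<in> carrier Isom" "g' \<in> carrier Isom" for g g'
      using that by (simp add: \<rho>\<^sub>t_def rho_compose fun_eq_iff k(2))
  qed
  moreover have "\<forall>g \<in> carrier Isom. \<rho>\<^sub>t g = h \<otimes>\<^bsub>Isom\<^esub> \<rho> g \<otimes>\<^bsub>Isom\<^esub> inv\<^bsub>Isom\<^esub> h"
    by (simp add: \<rho>\<^sub>t_def inv_Isom[OF h(1)] k_def)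
  moreover have "irreducible_action (\<rho>\<^sub>t ` carrier Isom)"
  proof -
    have "\<rho>\<^sub>t ` carrier Isom = (\<lambda>g. h \<circ> g \<circ> inv_into UNIV h) ` \<rho> ` carrier Isom"
      by (simp add: \<rho>\<^sub>t_def k_def image_image)
    then show ?thesis
      using irreducible_action_conjugate[OF irreducible _ h(1)] rho_Isom by auto
  qed
  moreover have "continuous_on (carrier Isom) \<rho>\<^sub>t"
  proof (rule continuous_on_coordinatewise_then_product)
    fix x
    have "continuous_on (carrier Isom) (\<lambda>g. \<rho> g (k x))"
      by (rule continuous_on_product_then_coordinatewise[OF rho_continuous[OF irr]])
    moreover have "continuous_on UNIV h"
      using h(1) by (intro continuous_onI exI conjI) (auto simp: in_Isom_iff)
    ultimately show "continuous_on (carrier Isom) (\<lambda>g. \<rho>\<^sub>t g x)"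
      using continuous_on_compose2[of UNIV h "carrier Isom" "\<lambda>g. \<rho> g (k x)"] by (simp add: \<rho>\<^sub>t_def)
  qed
  moreover have "\<forall>g \<in> carrier Isom. \<forall>x. (h \<circ> f) (g x) = \<rho>\<^sub>t g ((h \<circ> f) x)"
    by (simp add: \<rho>\<^sub>t_def k(2) equivariant)
  moreover have "\<forall>x y. cosh (dist ((h \<circ> f) x) ((h \<circ> f) y)) = (cosh (dist x y)) powr t"
    using h(1) by (simp add: in_Isom_iff cosh_dist_f)
  moreover have "\<forall>x y z. cartan_arg ((h \<circ> f) x) ((h \<circ> f) y) ((h \<circ> f) z) = t * cartan_arg x y z"
    using h(2) by simp
  ultimately show ?thesis using t(1,2) h(1) by blast
qed

end
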